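(* For each $\delta\ge0$, $f\in L^1(\mathbb{S}^{n-1})$ and $\omega\in\mathbb{S}^{n-1}$, let $$T_\delta f(\omega)=\int_{\mathbb{S}^{n-1}}\frac{f(x)}{|x\cdot\omega|+\delta}\,d\sigma(x).$$ Then: (1) for any $\omega\in\mathbb{S}^{n-1}$, and any $g\in L^2(\mathbb{S}^{n-1})$ supported in $\{x\in\mathbb{S}^{n-1}:x\cdot\omega>0\}$, $$\mathcal{R}(|\widehat{gd\sigma}|^2)(\omega,t)=\mathcal{R}X_0^*(|g|^2)(\omega,t)=T_0(|g|^2)(\omega)$$ for all $t\neq0$; and (2) for $g\in L^2(\mathbb{S}^{n-1})$, $$\mathcal{R}(\mathbf{1}_{B_R}|\widehat{gd\sigma}|^2)(\omega,t)\lesssim T_{1/R}(|g|^2)(\omega),$$ uniformly in $(\omega,t)\in\mathbb{S}^{n-1}\times\mathbb{R}$ and $R>0$.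
   Context: $d\sigma$ is surface measure on the unit sphere $\mathbb{S}^{n-1}\subset\mathbb{R}^n$, and $\widehat{gd\sigma}(x)=\int_{\mathbb{S}^{n-1}}e^{ix\cdot\xi}g(\xi)\,d\sigma(\xi)$ for $x\in\mathbb{R}^n$. $B_R$ is the ball of radius $R$ in $\mathbb{R}^n$ centred at the origin and $\mathbf{1}_{B_R}$ its indicator function. The Radon transform is $\mathcal{R}f(\omega,t)=\int_{x\cdot\omega=t}f(x)\,d\lambda_{\omega,t}(x)$, where $(\omega,t)\in\mathbb{S}^{n-1}\times\mathbb{R}$ and $d\lambda_{\omega,t}(x)=\delta(x\cdot\omega-t)\,dx$ is Lebesgue measure on the hyperplane $\{x\in\mathbb{R}^n:x\cdot\omega=t\}$. The restricted X-ray transform is $X_0f(\omega)=\int_{\mathbb{R}}f(s\omega)\,ds$ for $\omega\in\mathbb{S}^{n-1}$, and its adjoint is $X_0^*f(x)=|x|^{-(n-1)}\bigl(f(x/|x|)+f(-x/|x|)\bigr)$ for $f$ a function on $\mathbb{S}^{n-1}$. The symbol $\lesssim$ denotes inequality up to a constant factor, independent of $g$.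
   Formalization: With the stated normalisation the first equality in (1) needs a Plancherel factor: R(|ĝdσ|²)(ω,t) = (2π)^{n-1} R X_0^*(|g|²)(ω,t); it is proved in this corrected form, and n ≥ 2 is assumed since (2) fails for n = 1 as R → 0. *)

theory Defs
  imports "HOL-Analysis.Analysis"
begin

text \<open>
  Surface measure on the unit sphere, as the measure of the polar decomposition of Lebesgue
  measure: the measure of a Borel set A of directions is n times the volume of the solid cone
  \<open>{x. 0 < norm x \<le> 1 \<and> x / norm x \<in> A}\<close>.
\<close>
definition sphere_measure :: "(real^'n) measure" where
  "sphere_measure =
     scale_measure (of_nat CARD('n))
       (distr (restrict_space lborel (cball 0 1 - {0})) (restrict_space borel (sphere 0 1))
          (\<lambda>x. x /\<^sub>R norm x))"

definition L2_sphere :: "(real^'n \<Rightarrow> complex) \<Rightarrow> bool" where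
  "L2_sphere g \<longleftrightarrow>
     g \<in> borel_measurable sphere_measure \<and> integrable sphere_measure (\<lambda>\<xi>. (cmod (g \<xi>))\<^sup>2)"

text \<open>
  No power of \<open>2 * pi\<close> enters this definition, so Plancherel's identity on an (n-1)-dimensional
  hyperplane carries the factor \<open>(2 * pi) ^ (n - 1)\<close>.
\<close>
definition extension_op :: "(real^'n \<Rightarrow> complex) \<Rightarrow> real^'n \<Rightarrow> complex" where
  "extension_op g x = (LINT \<xi>|sphere_measure. exp (\<i> * complex_of_real (x \<bullet> \<xi>)) * g \<xi>)"

text \<open>
  Lebesgue measure on the hyperplane \<open>{x. x \<bullet> \<omega> = t}\<close>, for a unit vector \<open>\<omega>\<close>: the measure of a
  Borel subset A is the n-dimensional volume of the right prism of height 1 parallel to A, that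
  is, the slab \<open>{x. 0 \<le> x \<bullet> \<omega> \<le> 1}\<close> is pushed onto the hyperplane along \<open>\<omega>\<close>.  Two lemmas below
  confirm the normalisation: \<open>hyperplane_measure_orthonormal\<close> (product Lebesgue measure in
  orthonormal coordinates on the hyperplane) and \<open>hyperplane_measure_disintegration\<close>
  (the meaning of \<open>\<delta>(x \<bullet> \<omega> - t) dx\<close>).
\<close>
definition hyperplane_measure :: "real^'n \<Rightarrow> real \<Rightarrow> (real^'n) measure" where
  "hyperplane_measure \<omega> t =
     distr (restrict_space lborel {x. 0 \<le> x \<bullet> \<omega> \<and> x \<bullet> \<omega> \<le> 1}) borel
       (\<lambda>x. x + (t - x \<bullet> \<omega>) *\<^sub>R \<omega>)"

text \<open>
  The operators below are only applied to nonnegative functions, for which the integrals always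
  make sense with values in \<open>[0,\<infinity>]\<close>.  The conventions for division by zero in \<^typ>\<open>ennreal\<close> only
  matter at the origin for \<open>X0_adj\<close>, and for \<open>T_op 0\<close> on the equator \<open>x \<bullet> \<omega> = 0\<close>, where the
  kernel is infinite (a null set of the sphere when n is at least 2).
\<close>
definition radon :: "(real^'n \<Rightarrow> ennreal) \<Rightarrow> real^'n \<Rightarrow> real \<Rightarrow> ennreal" where
  "radon f \<omega> t = (\<integral>\<^sup>+x. f x \<partial>hyperplane_measure \<omega> t)"

definition X0_adj :: "(real^'n \<Rightarrow> ennreal) \<Rightarrow> real^'n \<Rightarrow> ennreal" where
  "X0_adj f x = (f (x /\<^sub>R norm x) + f (- (x /\<^sub>R norm x))) / ennreal (norm x ^ (CARD('n) - 1))"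

definition T_op :: "real \<Rightarrow> (real^'n \<Rightarrow> ennreal) \<Rightarrow> real^'n \<Rightarrow> ennreal" where
  "T_op \<delta> f \<omega> = (\<integral>\<^sup>+x. f x / ennreal (\<bar>x \<bullet> \<omega>\<bar> + \<delta>) \<partial>sphere_measure)"

abbreviation sqmod :: "(real^'n \<Rightarrow> complex) \<Rightarrow> real^'n \<Rightarrow> ennreal" where
  "sqmod g \<equiv> (\<lambda>x. ennreal ((cmod (g x))\<^sup>2))"

lemma emeasure_sphere_measure:
  fixes A :: "(real^'n) set"
  assumes [measurable]: "A \<in> sets borel" and sub: "A \<subseteq> sphere 0 1"
  shows "emeasure sphere_measure A
    = of_nat CARD('n) * emeasure lborel {x. 0 < norm x \<and> norm x \<le> 1 \<and> x /\<^sub>R norm x \<in> A}"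
proof -
  let ?D = "cball 0 1 - {0} :: (real^'n) set"
  have m: "(\<lambda>x. x /\<^sub>R norm x) \<in> measurable (restrict_space lborel ?D) (restrict_space borel (sphere 0 1))"
    by (rule measurable_restrict_space2) (auto simp: space_restrict_space intro!: measurable_restrict_space1)
  have "A \<in> sets (restrict_space borel (sphere 0 1))"
    using sub by (simp add: sets_restrict_space_iff)
  then have "emeasure sphere_measure A
      = of_nat CARD('n) * emeasure (restrict_space lborel ?D)
          ((\<lambda>x. x /\<^sub>R norm x) -` A \<inter> space (restrict_space lborel ?D))"
    by (simp add: sphere_measure_def emeasure_distr[OF m])
  also have "(\<lambda>x. x /\<^sub>R norm x) -` A \<inter> space (restrict_space lborel ?D)
      = {x. 0 < norm x \<and> norm x \<le> 1 \<and> x /\<^sub>R norm x \<in> A}"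
    by (auto simp: space_restrict_space)
  also have "emeasure (restrict_space lborel ?D) \<dots> = emeasure lborel \<dots>"
    by (rule emeasure_restrict_space) auto
  finally show ?thesis .
qed

lemma nn_integral_lborel_shift:
  fixes c :: "'a::euclidean_space"
  assumes [measurable]: "h \<in> borel_measurable borel"
  shows "(\<integral>\<^sup>+x. h (c + x) \<partial>lborel) = (\<integral>\<^sup>+x. h x \<partial>lborel)"
proof -
  have "(\<integral>\<^sup>+x. h x \<partial>lborel) = (\<integral>\<^sup>+x. h x \<partial>distr lborel borel ((+) c))"
    by (simp add: lborel_distr_plus)
  then show ?thesis by (simp add: nn_integral_distr)
qed

lemma lborel_orthogonal:
  fixes T :: "'a::euclidean_space \<Rightarrow> 'a"
  assumes T: "orthogonal_transformation T"
  shows "distr lborel borel T = lborel"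
proof (rule measure_eqI)
  fix A assume "A \<in> sets (distr lborel borel T)"
  then have A[measurable]: "A \<in> sets borel" by simp
  have lin: "linear T" and nT: "norm (T x) = norm x" for x
    using T by (auto simp: orthogonal_transformation)
  have Tm[measurable]: "T \<in> borel_measurable borel"
    using lin by (intro borel_measurable_continuous_onI linear_continuous_on)
      (simp add: linear_conv_bounded_linear)
  define S where "S = inv T"
  have S: "T (S y) = y" for y
    using orthogonal_transformation_surj[OF T] by (simp add: S_def surj_f_inv_f)
  let ?B = "ball 0 1 :: 'a set" and ?\<mu> = "emeasure lborel :: 'a set \<Rightarrow> ennreal"
  have B: "?\<mu> ?B \<noteq> 0" "?\<mu> ?B \<noteq> \<infinity>"
    using emeasure_bounded_finite[of ?B] content_ball_pos[of 1 "0::'a"]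
    by (auto simp: measure_def)
  define b :: "'a \<Rightarrow> ennreal" where "b = indicator ?B"
  have bm[measurable]: "b \<in> borel_measurable borel" unfolding b_def by (rule borel_measurable_indicator) simp
  have bI: "(\<integral>\<^sup>+x. b x \<partial>lborel) = ?\<mu> ?B" by (simp add: b_def)
  have bT: "b (- T x) = b x" for x by (simp add: b_def indicator_def nT)
  have "emeasure (distr lborel borel T) A * ?\<mu> ?B
      = (\<integral>\<^sup>+x. indicator A (T x) * ?\<mu> ?B \<partial>lborel)"
    using nn_integral_distr[of T lborel borel "indicator A"] by (simp add: nn_integral_multc)
  also have "\<dots> = (\<integral>\<^sup>+x. \<integral>\<^sup>+y. indicator A (T x) * b (y - T x) \<partial>lborel \<partial>lborel)"
  proof (rule nn_integral_cong)
    fix x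
    have "?\<mu> ?B = (\<integral>\<^sup>+y. b (y - T x) \<partial>lborel)"
      using nn_integral_lborel_shift[OF bm, of "- T x"] by (simp add: bI)
    then show "indicator A (T x) * ?\<mu> ?B
        = (\<integral>\<^sup>+y. indicator A (T x) * b (y - T x) \<partial>lborel)"
      by (simp add: nn_integral_cmult)
  qed
  also have "\<dots> = (\<integral>\<^sup>+y. \<integral>\<^sup>+x. indicator A (T x) * b (y - T x) \<partial>lborel \<partial>lborel)"
    by (rule lborel_pair.Fubini'[symmetric]) measurable
  also have "\<dots> = (\<integral>\<^sup>+y. \<integral>\<^sup>+x. indicator A (T x + y) * b x \<partial>lborel \<partial>lborel)"
  proof (rule nn_integral_cong)
    fix y
    have "(\<integral>\<^sup>+x. indicator A (T x) * b (y - T x) \<partial>lborel)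
        = (\<integral>\<^sup>+x. indicator A (T (S y + x)) * b (y - T (S y + x)) \<partial>lborel :: ennreal)"
      by (rule nn_integral_lborel_shift[symmetric]) measurable
    also have "\<dots> = (\<integral>\<^sup>+x. indicator A (T x + y) * b x \<partial>lborel)"
      by (intro nn_integral_cong)
        (simp add: linear_add[OF lin] S add.commute bT)
    finally show "(\<integral>\<^sup>+x. indicator A (T x) * b (y - T x) \<partial>lborel)
        = (\<integral>\<^sup>+x. indicator A (T x + y) * b x \<partial>lborel :: ennreal)" .
  qed
  also have "\<dots> = (\<integral>\<^sup>+x. \<integral>\<^sup>+y. indicator A (T x + y) * b x \<partial>lborel \<partial>lborel)"
    by (rule lborel_pair.Fubini') measurable
  also have "\<dots> = (\<integral>\<^sup>+x. ?\<mu> A * b x \<partial>lborel)"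
    by (intro nn_integral_cong) (simp add: nn_integral_multc nn_integral_lborel_shift)
  also have "\<dots> = ?\<mu> A * ?\<mu> ?B"
    by (simp add: nn_integral_cmult bI)
  finally show "emeasure (distr lborel borel T) A = ?\<mu> A"
    using B by (simp add: ennreal_mult_cancel_left mult.commute[of _ "?\<mu> ?B"])
qed simp

lemma lborel_orthonormal:
  fixes B :: "(real^'n) set"
  assumes ON: "pairwise orthogonal B" "\<And>b. b \<in> B \<Longrightarrow> norm b = 1" and card: "card B = CARD('n)"
  shows "lborel = distr (\<Pi>\<^sub>M b\<in>B. lborel) borel (\<lambda>c. \<Sum>b\<in>B. c b *\<^sub>R b)"
proof -
  have fin: "finite B" using card card_gt_0_iff by (metis zero_less_card_finite)
  obtain h where h: "bij_betw h (Basis::(real^'n) set) B"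
    using finite_same_card_bij[OF finite_Basis fin, where 'a1 = "real^'n"] card by auto
  have hB: "h i \<in> B" if "i \<in> Basis" for i using h that by (auto simp: bij_betw_def)
  have hinj: "h i = h j \<longleftrightarrow> i = j" if "i \<in> Basis" "j \<in> Basis" for i j
    using h that by (auto simp: bij_betw_def inj_on_def)
  define T :: "real^'n \<Rightarrow> real^'n" where "T x = (\<Sum>i\<in>Basis. (x \<bullet> i) *\<^sub>R h i)" for x
  have linT: "linear T"
    unfolding T_def by (intro linearI) (simp_all add: inner_add_left scaleR_add_left sum.distrib scaleR_sum_right)
  have hh: "h i \<bullet> h j = (if i = j then 1 else 0)" if "i \<in> Basis" "j \<in> Basis" for i j
  proof (cases "i = j")
    case True
    then show ?thesis using ON(2)[OF hB[OF that(1)]] by (simp add: norm_eq_1)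
  next
    case False
    then show ?thesis using ON(1) hB hinj that by (auto simp: pairwise_def orthogonal_def)
  qed
  have "T v \<bullet> T w = v \<bullet> w" for v w
  proof -
    have "T v \<bullet> T w = (\<Sum>i\<in>Basis. \<Sum>j\<in>Basis. (v \<bullet> i) * (w \<bullet> j) * (h i \<bullet> h j))"
      by (simp add: T_def inner_sum_left inner_sum_right sum_distrib_left mult.assoc mult.left_commute)
        (rule sum.swap)
    also have "\<dots> = (\<Sum>i\<in>Basis. (v \<bullet> i) * (w \<bullet> i))"
      by (intro sum.cong refl) (simp add: hh if_distrib sum.delta cong: if_cong)
    finally show ?thesis by (simp add: euclidean_inner[of v w])
  qed
  then have T: "orthogonal_transformation T" using linT by (simp add: orthogonal_transformation_def)
  interpret P: product_sigma_finite "\<lambda>_::real^'n. lborel :: real measure" by standard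
  define r where "r f = (\<lambda>b\<in>B. f (the_inv_into Basis h b))" for f :: "real^'n \<Rightarrow> real"
  have inv: "the_inv_into Basis h b \<in> Basis" "h (the_inv_into Basis h b) = b" if "b \<in> B" for b
    using h that the_inv_into_into[of h Basis b Basis] f_the_inv_into_f[of h Basis b]
    by (auto simp: bij_betw_def)
  have inv2: "the_inv_into Basis h (h i) = i" if "i \<in> Basis" for i
    using h that by (simp add: bij_betw_def the_inv_into_f_f)
  have rm[measurable]: "r \<in> measurable (\<Pi>\<^sub>M i\<in>Basis. lborel) (\<Pi>\<^sub>M b\<in>B. lborel)"
    unfolding r_def by (intro measurable_restrict measurable_component_singleton inv(1))
  have re: "(\<Pi>\<^sub>M b\<in>B. lborel) = distr (\<Pi>\<^sub>M i\<in>Basis. lborel) (\<Pi>\<^sub>M b\<in>B. lborel :: real measure) r"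
  proof (rule P.PiM_eqI[OF fin, symmetric])
    fix A :: "real^'n \<Rightarrow> real set" assume A: "\<And>b. b \<in> B \<Longrightarrow> A b \<in> sets lborel"
    have pre: "r -` Pi\<^sub>E B A \<inter> space (\<Pi>\<^sub>M i\<in>Basis. lborel) = (\<Pi>\<^sub>E i\<in>Basis. A (h i))"
      by (auto simp: r_def space_PiM PiE_iff inv hB) (metis hB inv2 , metis inv)
    have "emeasure (distr (\<Pi>\<^sub>M i\<in>Basis. lborel) (\<Pi>\<^sub>M b\<in>B. lborel) r) (Pi\<^sub>E B A)
        = emeasure (\<Pi>\<^sub>M i\<in>Basis. lborel) (\<Pi>\<^sub>E i\<in>Basis. A (h i))"
      using A fin by (subst emeasure_distr) (auto simp: pre intro!: sets_PiM_I_finite)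
    also have "\<dots> = (\<Prod>i\<in>Basis. emeasure lborel (A (h i)))"
      using A hB by (subst P.emeasure_PiM) auto
    also have "\<dots> = (\<Prod>b\<in>B. emeasure lborel (A b))"
      by (rule prod.reindex_bij_betw[OF h])
    finally show "emeasure (distr (\<Pi>\<^sub>M i\<in>Basis. lborel) (\<Pi>\<^sub>M b\<in>B. lborel) r) (Pi\<^sub>E B A)
        = (\<Prod>b\<in>B. emeasure lborel (A b))" .
  qed (simp add: sets_distr)
  have Tm[measurable]: "T \<in> borel_measurable borel"
    using linT by (intro borel_measurable_continuous_onI linear_continuous_on)
      (simp add: linear_conv_bounded_linear)
  have TT: "T (\<Sum>i\<in>Basis. f i *\<^sub>R i) = (\<Sum>b\<in>B. r f b *\<^sub>R b)" for f
  proof -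
    have "T (\<Sum>i\<in>Basis. f i *\<^sub>R i) = (\<Sum>i\<in>Basis. f i *\<^sub>R h i)"
      by (simp add: T_def)
    also have "\<dots> = (\<Sum>i\<in>Basis. r f (h i) *\<^sub>R h i)"
      by (intro sum.cong) (auto simp: r_def hB inv2)
    also have "\<dots> = (\<Sum>b\<in>B. r f b *\<^sub>R b)"
      by (rule sum.reindex_bij_betw[OF h])
    finally show ?thesis .
  qed
  have "lborel = distr lborel borel T" using lborel_orthogonal[OF T] by simp
  also have "\<dots> = distr (distr (\<Pi>\<^sub>M b\<in>Basis. lborel) borel (\<lambda>f. \<Sum>b\<in>Basis. f b *\<^sub>R b)) borel T"
    by (subst lborel_eq) simp
  also have "\<dots> = distr (\<Pi>\<^sub>M b\<in>Basis. lborel) borel (\<lambda>f. \<Sum>b\<in>B. r f b *\<^sub>R b)"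
    by (subst distr_distr) (auto simp: comp_def TT)
  also have "\<dots> = distr (distr (\<Pi>\<^sub>M i\<in>Basis. lborel) (\<Pi>\<^sub>M b\<in>B. lborel) r) borel (\<lambda>c. \<Sum>b\<in>B. c b *\<^sub>R b)"
    by (subst distr_distr) (auto simp: comp_def)
  finally show ?thesis by (simp add: re[symmetric])
qed

lemma hyperplane_measure_orthonormal:
  fixes \<omega> :: "real^'n"
  assumes \<omega>: "norm \<omega> = 1"
    and B: "pairwise orthogonal B" "\<And>b. b \<in> B \<Longrightarrow> norm b = 1 \<and> b \<bullet> \<omega> = 0" "card B = CARD('n) - 1"
      "finite B"
  shows "hyperplane_measure \<omega> t = distr (\<Pi>\<^sub>M b\<in>B. lborel) borel (\<lambda>c. t *\<^sub>R \<omega> + (\<Sum>b\<in>B. c b *\<^sub>R b))"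
proof (rule measure_eqI)
  fix A assume "A \<in> sets (hyperplane_measure \<omega> t)"
  then have A[measurable]: "A \<in> sets borel" by (simp add: hyperplane_measure_def)
  have \<omega>B: "\<omega> \<notin> B" and ww: "\<omega> \<bullet> \<omega> = 1" using \<omega> B(2)[of \<omega>] by (auto simp: norm_eq_1)
  have L: "lborel = distr (\<Pi>\<^sub>M b\<in>insert \<omega> B. lborel) borel (\<lambda>c. \<Sum>b\<in>insert \<omega> B. c b *\<^sub>R b)"
    using B \<omega> \<omega>B
    by (intro lborel_orthonormal) (auto simp: pairwise_insert orthogonal_def inner_commute)
  interpret P: product_sigma_finite "\<lambda>_::real^'n. lborel :: real measure" by standard
  let ?g = "\<lambda>x::real^'n. indicator {x. 0 \<le> x \<bullet> \<omega> \<and> x \<bullet> \<omega> \<le> 1} x * indicator A (x + (t - x \<bullet> \<omega>) *\<^sub>R \<omega>) :: ennreal"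
  have dot: "(\<Sum>b\<in>B. c b *\<^sub>R b) \<bullet> \<omega> = 0" for c :: "real^'n \<Rightarrow> real"
    using B(2) by (simp add: inner_sum_left)
  have eq: "(\<Sum>b\<in>insert \<omega> B. (c(\<omega> := s)) b *\<^sub>R b) = s *\<^sub>R \<omega> + (\<Sum>b\<in>B. c b *\<^sub>R b)" for c :: "real^'n \<Rightarrow> real" and s
    using \<omega>B B(4) by (auto intro!: sum.cong)
  have "emeasure (hyperplane_measure \<omega> t) A = (\<integral>\<^sup>+x. indicator A x \<partial>hyperplane_measure \<omega> t)"
    by (simp add: hyperplane_measure_def)
  also have "\<dots> = (\<integral>\<^sup>+x. ?g x \<partial>lborel)"
    unfolding hyperplane_measure_def
    by (subst nn_integral_distr) (auto simp: nn_integral_restrict_space mult.commute intro!: measurable_restrict_space1)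
  also have "\<dots> = (\<integral>\<^sup>+c. ?g (\<Sum>b\<in>insert \<omega> B. c b *\<^sub>R b) \<partial>(\<Pi>\<^sub>M b\<in>insert \<omega> B. lborel))"
    by (subst L) (simp add: nn_integral_distr)
  also have "\<dots> = (\<integral>\<^sup>+c. \<integral>\<^sup>+s. ?g (\<Sum>b\<in>insert \<omega> B. (c(\<omega> := s)) b *\<^sub>R b) \<partial>lborel \<partial>(\<Pi>\<^sub>M b\<in>B. lborel))"
    using B(4) \<omega>B by (subst P.product_nn_integral_insert) auto
  also have "\<dots> = (\<integral>\<^sup>+c. \<integral>\<^sup>+s. indicator {0..1::real} s * indicator A (t *\<^sub>R \<omega> + (\<Sum>b\<in>B. c b *\<^sub>R b)) \<partial>lborel \<partial>(\<Pi>\<^sub>M b\<in>B. lborel))"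
    unfolding eq
    by (intro nn_integral_cong)
      (simp add: inner_add_left dot ww scaleR_diff_left algebra_simps indicator_def)
  also have "\<dots> = (\<integral>\<^sup>+c. indicator A (t *\<^sub>R \<omega> + (\<Sum>b\<in>B. c b *\<^sub>R b)) \<partial>(\<Pi>\<^sub>M b\<in>B. lborel))"
    by (simp add: nn_integral_multc)
  also have "\<dots> = (\<integral>\<^sup>+x. indicator A x \<partial>distr (\<Pi>\<^sub>M b\<in>B. lborel) borel (\<lambda>c. t *\<^sub>R \<omega> + (\<Sum>b\<in>B. c b *\<^sub>R b)))"
    by (subst nn_integral_distr) auto
  finally show "emeasure (hyperplane_measure \<omega> t) A
      = emeasure (distr (\<Pi>\<^sub>M b\<in>B. lborel) borel (\<lambda>c. t *\<^sub>R \<omega> + (\<Sum>b\<in>B. c b *\<^sub>R b))) A"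
    by (subst (asm) nn_integral_indicator) auto
qed (simp add: hyperplane_measure_def)

lemma hyperplane_measure_disintegration:
  fixes \<omega> :: "real^'n"
  assumes "norm \<omega> = 1" and [measurable]: "f \<in> borel_measurable borel"
  shows "(\<integral>\<^sup>+t. \<integral>\<^sup>+x. f x \<partial>hyperplane_measure \<omega> t \<partial>lborel) = (\<integral>\<^sup>+x. f x \<partial>lborel)"
proof -
  have ww: "\<omega> \<bullet> \<omega> = 1" using assms by (simp add: norm_eq_1)
  let ?I = "indicator {x::real^'n. 0 \<le> x \<bullet> \<omega> \<and> x \<bullet> \<omega> \<le> 1} :: _ \<Rightarrow> ennreal"
  have "(\<integral>\<^sup>+x. f x \<partial>hyperplane_measure \<omega> t) = (\<integral>\<^sup>+x. f (x + (t - x \<bullet> \<omega>) *\<^sub>R \<omega>) * ?I x \<partial>lborel)" for t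
    unfolding hyperplane_measure_def
    by (subst nn_integral_distr) (auto simp: nn_integral_restrict_space intro!: measurable_restrict_space1)
  then have "(\<integral>\<^sup>+t. \<integral>\<^sup>+x. f x \<partial>hyperplane_measure \<omega> t \<partial>lborel)
      = (\<integral>\<^sup>+x. \<integral>\<^sup>+t. f (x + (t - x \<bullet> \<omega>) *\<^sub>R \<omega>) * ?I x \<partial>lborel \<partial>lborel)"
    using lborel_pair.Fubini'[of "\<lambda>x t. f (x + (t - x \<bullet> \<omega>) *\<^sub>R \<omega>) * ?I x"] by simp
  also have "\<dots> = (\<integral>\<^sup>+x. \<integral>\<^sup>+t. f (x + t *\<^sub>R \<omega>) * ?I x \<partial>lborel \<partial>lborel)"
  proof (rule nn_integral_cong)
    fix x
    show "(\<integral>\<^sup>+t. f (x + (t - x \<bullet> \<omega>) *\<^sub>R \<omega>) * ?I x \<partial>lborel) = (\<integral>\<^sup>+t. f (x + t *\<^sub>R \<omega>) * ?I x \<partial>lborel)"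
      using nn_integral_lborel_shift[of "\<lambda>t. f (x + t *\<^sub>R \<omega>) * ?I x" "- (x \<bullet> \<omega>)"]
      by simp
  qed
  also have "\<dots> = (\<integral>\<^sup>+t. \<integral>\<^sup>+x. f (x + t *\<^sub>R \<omega>) * ?I x \<partial>lborel \<partial>lborel)"
    by (rule lborel_pair.Fubini') measurable
  also have "\<dots> = (\<integral>\<^sup>+t. \<integral>\<^sup>+x. f x * ?I (x - t *\<^sub>R \<omega>) \<partial>lborel \<partial>lborel)"
  proof (rule nn_integral_cong)
    fix t
    show "(\<integral>\<^sup>+x. f (x + t *\<^sub>R \<omega>) * ?I x \<partial>lborel) = (\<integral>\<^sup>+x. f x * ?I (x - t *\<^sub>R \<omega>) \<partial>lborel)"
      using nn_integral_lborel_shift[of "\<lambda>x. f x * ?I (x - t *\<^sub>R \<omega>)" "t *\<^sub>R \<omega>"]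
      by (simp add: add.commute)
  qed
  also have "\<dots> = (\<integral>\<^sup>+x. \<integral>\<^sup>+t. f x * ?I (x - t *\<^sub>R \<omega>) \<partial>lborel \<partial>lborel)"
    by (rule lborel_pair.Fubini') measurable
  also have "\<dots> = (\<integral>\<^sup>+x. \<integral>\<^sup>+t. f x * indicator {x \<bullet> \<omega> - 1 .. x \<bullet> \<omega>} t \<partial>lborel \<partial>lborel)"
    by (intro nn_integral_cong) (auto simp: inner_diff_left ww split: split_indicator)
  also have "\<dots> = (\<integral>\<^sup>+x. f x \<partial>lborel)"
    by (simp add: nn_integral_cmult)
  finally show ?thesis .
qed

end

theory Submission
  imports Defs "HOL-Probability.Probability"
begin

text \<open>
  Fix a unit vector \<open>\<omega>\<close> and write \<open>d = n - 1\<close>.  On the hemisphere \<open>\<xi> \<bullet> \<omega> > 0\<close> the sphere is the graph of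
  \<open>y \<mapsto> sqrt (1 - |y|\<^sup>2)\<close> over the unit ball of the hyperplane \<open>\<omega>\<^sup>\<bottom>\<close>, and \<open>dy = (\<xi> \<bullet> \<omega>) d\<sigma>(\<xi>)\<close>
  (\<open>nn_integral_sphere_graph\<close>).  On the plane \<open>x \<bullet> \<omega> = t\<close> the extension of \<open>g\<close> is therefore the
  \<open>d\<close>-dimensional Fourier transform of \<open>F(y) = exp(i t (\<xi> \<bullet> \<omega>)) g(\<xi>) / (\<xi> \<bullet> \<omega>)\<close>, with \<open>\<xi>\<close> the point
  above \<open>y\<close>.  Plancherel turns the Radon transform of its square into
  \<open>(2\<pi>)\<^sup>d \<integral> |F|\<^sup>2 dy = (2\<pi>)\<^sup>d \<integral> |g|\<^sup>2 / (\<xi> \<bullet> \<omega>) d\<sigma>\<close>, which is \<open>(2\<pi>)\<^sup>d T\<^sub>0(|g|\<^sup>2)(\<omega>)\<close>.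
  The Radon transform of \<open>X\<^sub>0\<^sup>*(|g|\<^sup>2)\<close> is computed by central instead of vertical projection: the ray
  through \<open>\<xi>\<close> meets the plane at distance \<open>|t| / |\<xi> \<bullet> \<omega>|\<close>, and surface measure there is
  \<open>|x|\<^sup>d / |\<xi> \<bullet> \<omega>| d\<sigma>\<close>, so that the weight \<open>|x| powr (-d)\<close> cancels and \<open>T\<^sub>0(|g|\<^sup>2)\<close> appears again
  (\<open>nn_integral_hyperplane_gnomonic\<close>).

  Here \<open>F\<close> is integrable but need not be square integrable, so Plancherel is needed for integrable
  functions as an identity in \<open>[0, \<infinity>]\<close> (\<open>plancherel_hyperplane\<close>).  Everything about Fourier transforms goes
  through one formula: with the weight \<open>exp(-\<epsilon>|y|\<^sup>2)\<close>, the integral over the hyperplane of the squared transform of \<open>f d\<mu>\<close> is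
  the quadratic form \<open>\<integral>\<integral> K\<^sub>\<epsilon>(\<xi> - \<eta>) f(\<xi>) cnj (f(\<eta>)) d\<mu> d\<mu>\<close> with a positive Gaussian kernel of total mass
  \<open>(2\<pi>)\<^sup>d\<close> (\<open>gaussian_fourier_form\<close>).  Schur's test bounds this form, which is half of Plancherel; the other
  half follows because \<open>K\<^sub>\<epsilon>\<close> is an approximate identity as \<open>\<epsilon> \<rightarrow> 0\<close>.

  For the local estimate, the indicator of the ball of radius \<open>R\<close> is at most \<open>e exp(-|y|\<^sup>2/R\<^sup>2)\<close> on the
  hyperplane, and Schur's test is applied on the sphere itself with the weight
  \<open>a(\<xi>) = |\<xi> \<bullet> \<omega>| + 1/R\<close>.  It remains to bound \<open>\<integral> K(\<xi> - \<eta>) a(\<eta>) d\<sigma>(\<eta>)\<close> uniformly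
  (\<open>sphere_kernel_bound\<close>).  The part \<open>|\<eta> \<bullet> \<omega>|\<close> of the weight is the Jacobian of the vertical projection and
  leaves the mass of \<open>K\<close> on the hyperplane.  For the constant part, \<open>1 \<le> \<Sum> |\<eta> \<bullet> e|\<close> over an
  orthonormal basis, so that one may project along each basis vector in turn; a direction \<open>e\<close> orthogonal
  to \<open>\<omega>\<close> costs one of the \<open>d\<close> Gaussian integrations, which loses exactly a factor comparable to \<open>R\<close>.
\<close>


section \<open>Lebesgue measure on hyperplanes\<close>

lemma sets_hyperplane_measure [measurable_cong, simp]: "sets (hyperplane_measure \<omega> t) = sets borel"
  by (simp add: hyperplane_measure_def)

lemma space_hyperplane_measure [simp]: "space (hyperplane_measure \<omega> t) = UNIV"
  by (simp add: hyperplane_measure_def)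

lemma nn_integral_hyperplane_slab:
  fixes \<omega> :: "real^'n"
  assumes [measurable]: "f \<in> borel_measurable borel"
  shows "(\<integral>\<^sup>+x. f x \<partial>hyperplane_measure \<omega> t)
    = (\<integral>\<^sup>+x. f (x + (t - x \<bullet> \<omega>) *\<^sub>R \<omega>) * indicator {0..1} (x \<bullet> \<omega>) \<partial>lborel)"
  unfolding hyperplane_measure_def
  by (subst nn_integral_distr)
    (auto simp: nn_integral_restrict_space indicator_def intro!: measurable_restrict_space1 nn_integral_cong)

lemma nn_integral_hyperplane_shift:
  fixes \<omega> :: "real^'n"
  assumes [measurable]: "f \<in> borel_measurable borel"
  shows "(\<integral>\<^sup>+x. f x \<partial>hyperplane_measure \<omega> t) = (\<integral>\<^sup>+y. f (y + t *\<^sub>R \<omega>) \<partial>hyperplane_measure \<omega> 0)"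
proof -
  have "x + (t - x \<bullet> \<omega>) *\<^sub>R \<omega> = x + (0 - x \<bullet> \<omega>) *\<^sub>R \<omega> + t *\<^sub>R \<omega>" for x
    by (simp add: scaleR_diff_left)
  then show ?thesis by (simp only: nn_integral_hyperplane_slab[OF assms] nn_integral_hyperplane_slab[of "\<lambda>y. f (y + t *\<^sub>R \<omega>)"] measurable assms)
    (subst nn_integral_hyperplane_slab, simp_all)
qed

lemma nn_integral_lborel_hyperplane:
  fixes \<omega> :: "real^'n"
  assumes "norm \<omega> = 1" and [measurable]: "f \<in> borel_measurable borel"
  shows "(\<integral>\<^sup>+x. f x \<partial>lborel) = (\<integral>\<^sup>+t. \<integral>\<^sup>+y. f (y + t *\<^sub>R \<omega>) \<partial>hyperplane_measure \<omega> 0 \<partial>lborel)"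
  unfolding hyperplane_measure_disintegration[OF assms, symmetric]
  by (intro nn_integral_cong nn_integral_hyperplane_shift assms)

lemma AE_hyperplane_inner:
  fixes \<omega> :: "real^'n"
  assumes "norm \<omega> = 1"
  shows "AE x in hyperplane_measure \<omega> t. x \<bullet> \<omega> = t"
proof (rule AE_I[where N="{x. x \<bullet> \<omega> \<noteq> t}"])
  have ww: "\<omega> \<bullet> \<omega> = 1" using assms by (simp add: norm_eq_1)
  have "emeasure (hyperplane_measure \<omega> t) {x. x \<bullet> \<omega> \<noteq> t}
     = (\<integral>\<^sup>+x. indicator {x. x \<bullet> \<omega> \<noteq> t} x \<partial>hyperplane_measure \<omega> t)"
    by simp
  also have "\<dots> = 0"
    by (subst nn_integral_hyperplane_slab) (auto simp: inner_add_left ww)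
  finally show "emeasure (hyperplane_measure \<omega> t) {x. x \<bullet> \<omega> \<noteq> t} = 0" .
qed auto

lemma nn_integral_hyperplane_translate:
  fixes \<omega> :: "real^'n"
  assumes z: "z \<bullet> \<omega> = 0" and [measurable]: "f \<in> borel_measurable borel"
  shows "(\<integral>\<^sup>+y. f (y + z) \<partial>hyperplane_measure \<omega> t) = (\<integral>\<^sup>+y. f y \<partial>hyperplane_measure \<omega> t)"
proof -
  have "(\<integral>\<^sup>+y. f (y + z) \<partial>hyperplane_measure \<omega> t)
     = (\<integral>\<^sup>+x. f ((z + x) + (t - (z + x) \<bullet> \<omega>) *\<^sub>R \<omega>) * indicator {0..1} ((z + x) \<bullet> \<omega>) \<partial>lborel)"
    by (subst nn_integral_hyperplane_slab) (simp_all add: z inner_add_left ac_simps)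
  also have "\<dots> = (\<integral>\<^sup>+y. f y \<partial>hyperplane_measure \<omega> t)"
    by (subst nn_integral_lborel_shift) (simp_all add: nn_integral_hyperplane_slab)
  finally show ?thesis .
qed

text \<open>
  Fubini for the splitting of space into \<open>\<omega>\<^sup>\<bottom>\<close> and the line through \<open>\<omega>\<close>.  It frees the hyperplane measure
  from the particular slab in its definition: any profile \<open>u\<close> of total mass 1 along \<open>\<omega>\<close> gives the same measure.
\<close>
lemma nn_integral_lborel_product:
  fixes \<omega> :: "real^'n" and u :: "real \<Rightarrow> ennreal"
  assumes \<omega>: "norm \<omega> = 1" and [measurable]: "f \<in> borel_measurable borel" "u \<in> borel_measurable borel"
  shows "(\<integral>\<^sup>+x. f (x - (x \<bullet> \<omega>) *\<^sub>R \<omega>) * u (x \<bullet> \<omega>) \<partial>lborel)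
    = (\<integral>\<^sup>+y. f y \<partial>hyperplane_measure \<omega> 0) * (\<integral>\<^sup>+s. u s \<partial>lborel)"
proof -
  have ww: "\<omega> \<bullet> \<omega> = 1" using \<omega> by (simp add: norm_eq_1)
  have "(\<integral>\<^sup>+x. f (x - (x \<bullet> \<omega>) *\<^sub>R \<omega>) * u (x \<bullet> \<omega>) \<partial>lborel)
     = (\<integral>\<^sup>+t. \<integral>\<^sup>+y. f y * u t \<partial>hyperplane_measure \<omega> 0 \<partial>lborel)"
    using AE_hyperplane_inner[OF \<omega>, of 0]
    by (subst nn_integral_lborel_hyperplane[OF \<omega>])
      (auto simp: inner_add_left ww intro!: nn_integral_cong nn_integral_cong_AE)
  then show ?thesis by (simp add: nn_integral_multc nn_integral_cmult)
qed

lemma hyperplane_measure_uminus: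
  fixes \<omega> :: "real^'n"
  assumes \<omega>: "norm \<omega> = 1"
  shows "hyperplane_measure (- \<omega>) t = hyperplane_measure \<omega> (- t)"
proof (rule measure_eqI)
  fix A assume "A \<in> sets (hyperplane_measure (- \<omega>) t)"
  then have [measurable]: "A \<in> sets borel" by simp
  have "emeasure (hyperplane_measure (- \<omega>) t) A = (\<integral>\<^sup>+x. indicator A x \<partial>hyperplane_measure (- \<omega>) t)"
    by simp
  also have "\<dots> = (\<integral>\<^sup>+x. indicator A ((x - (x \<bullet> \<omega>) *\<^sub>R \<omega>) - t *\<^sub>R \<omega>) * indicator {-1..0} (x \<bullet> \<omega>) \<partial>lborel)"
    by (subst nn_integral_hyperplane_slab)
      (auto simp: algebra_simps indicator_def intro!: nn_integral_cong)
  also have "\<dots> = (\<integral>\<^sup>+y. indicator A (y + (- t) *\<^sub>R \<omega>) \<partial>hyperplane_measure \<omega> 0)"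
    by (subst nn_integral_lborel_product[OF \<omega>, of "\<lambda>y. indicator A (y - t *\<^sub>R \<omega>)" "indicator {-1..0}"]) auto
  also have "\<dots> = (\<integral>\<^sup>+x. indicator A x \<partial>hyperplane_measure \<omega> (- t))"
    by (subst (2) nn_integral_hyperplane_shift) auto
  finally show "emeasure (hyperplane_measure (- \<omega>) t) A = emeasure (hyperplane_measure \<omega> (- t)) A"
    by simp
qed simp

lemma nn_integral_lborel_scale:
  fixes f :: "'a::euclidean_space \<Rightarrow> ennreal"
  assumes r: "r > 0" and [measurable]: "f \<in> borel_measurable borel"
  shows "ennreal (r ^ DIM('a)) * (\<integral>\<^sup>+x. f (r *\<^sub>R x) \<partial>lborel) = (\<integral>\<^sup>+x. f x \<partial>lborel)"
proof -
  have "(\<integral>\<^sup>+x. f x \<partial>lborel) = (\<integral>\<^sup>+x. f x \<partial>density (distr lborel borel (\<lambda>x. 0 + r *\<^sub>R x)) (\<lambda>_. ennreal (\<bar>r\<bar> ^ DIM('a))))"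
    using lborel_affine[of r "0::'a"] r by simp
  also have "\<dots> = ennreal (r ^ DIM('a)) * (\<integral>\<^sup>+x. f (r *\<^sub>R x) \<partial>lborel)"
    using r by (simp add: nn_integral_density nn_integral_distr nn_integral_cmult)
  finally show ?thesis by simp
qed

text \<open>
  Scaling space by \<open>r\<close> contributes \<open>r ^ n\<close>, and the slab becomes thinner by the factor \<open>r\<close>, which takes
  one power back.
\<close>
lemma nn_integral_hyperplane_scale:
  fixes \<omega> :: "real^'n"
  assumes \<omega>: "norm \<omega> = 1" and r: "r > 0" and [measurable]: "f \<in> borel_measurable borel"
  shows "ennreal (r ^ (CARD('n) - 1)) * (\<integral>\<^sup>+y. f (r *\<^sub>R y) \<partial>hyperplane_measure \<omega> 0)
    = (\<integral>\<^sup>+y. f y \<partial>hyperplane_measure \<omega> 0)"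
proof -
  let ?I = "\<integral>\<^sup>+y. f (r *\<^sub>R y) \<partial>hyperplane_measure \<omega> 0"
  have "(\<integral>\<^sup>+y. f y \<partial>hyperplane_measure \<omega> 0)
     = (\<integral>\<^sup>+x. f (x - (x \<bullet> \<omega>) *\<^sub>R \<omega>) * indicator {0..1} (x \<bullet> \<omega>) \<partial>lborel)"
    by (subst nn_integral_hyperplane_slab) simp_all
  also have "\<dots> = ennreal (r ^ CARD('n)) * (\<integral>\<^sup>+x. f (r *\<^sub>R x - ((r *\<^sub>R x) \<bullet> \<omega>) *\<^sub>R \<omega>) * indicator {0..1} ((r *\<^sub>R x) \<bullet> \<omega>) \<partial>lborel)"
    by (subst nn_integral_lborel_scale[OF r, symmetric]) simp_all
  also have "(\<integral>\<^sup>+x. f (r *\<^sub>R x - ((r *\<^sub>R x) \<bullet> \<omega>) *\<^sub>R \<omega>) * indicator {0..1} ((r *\<^sub>R x) \<bullet> \<omega>) \<partial>lborel)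
     = (\<integral>\<^sup>+x. f (r *\<^sub>R (x - (x \<bullet> \<omega>) *\<^sub>R \<omega>)) * indicator {0..1/r} (x \<bullet> \<omega>) \<partial>lborel)"
  proof (rule nn_integral_cong)
    fix x
    have "r * (x \<bullet> \<omega>) \<in> {0..1} \<longleftrightarrow> x \<bullet> \<omega> \<in> {0..1/r}"
      using r by (auto simp: field_simps zero_le_mult_iff)
    then show "f (r *\<^sub>R x - ((r *\<^sub>R x) \<bullet> \<omega>) *\<^sub>R \<omega>) * indicator {0..1} ((r *\<^sub>R x) \<bullet> \<omega>)
      = f (r *\<^sub>R (x - (x \<bullet> \<omega>) *\<^sub>R \<omega>)) * indicator {0..1/r} (x \<bullet> \<omega>)"
      by (simp add: indicator_def scaleR_diff_right)
  qed
  also have "(\<integral>\<^sup>+x. f (r *\<^sub>R (x - (x \<bullet> \<omega>) *\<^sub>R \<omega>)) * indicator {0..1/r} (x \<bullet> \<omega>) \<partial>lborel) = ?I * ennreal (1/r)"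
    using r by (subst nn_integral_lborel_product[OF \<omega>, of "\<lambda>y. f (r *\<^sub>R y)" "indicator {0..1/r}"]) auto
  also have "ennreal (r ^ CARD('n)) * (?I * ennreal (1/r)) = ennreal (r ^ CARD('n) * (1/r)) * ?I"
    using r by (subst ennreal_mult) (auto simp only: mult_ac intro: zero_le_power less_imp_le divide_nonneg_pos zero_le_one)
  also have "r ^ CARD('n) * (1/r) = r ^ (CARD('n) - 1)"
    using r by (simp add: power_diff)
  finally show ?thesis ..
qed

text \<open>
  A ball in the hyperplane is the image of a bounded part of the slab, so it has finite measure.
\<close>
lemma sigma_finite_hyperplane_measure:
  fixes \<omega> :: "real^'n"
  shows "sigma_finite_measure (hyperplane_measure \<omega> t)"
proof (rule sigma_finite_measure.intro, rule exI[of _ "range (\<lambda>k::nat. ball 0 (real k))"], intro conjI ballI)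
  let ?H = "hyperplane_measure \<omega> t"
  show "\<Union> (range (\<lambda>k::nat. ball 0 (real k))) = space ?H"
    using reals_Archimedean2 by fastforce
  fix A assume "A \<in> range (\<lambda>k::nat. ball (0::real^'n) (real k))"
  then obtain k :: nat where A: "A = ball 0 (real k)" by auto
  have "emeasure ?H A = (\<integral>\<^sup>+x. indicator A x \<partial>?H)" by (simp add: A)
  also have "\<dots> = (\<integral>\<^sup>+x. indicator A (x + (t - x \<bullet> \<omega>) *\<^sub>R \<omega>) * indicator {0..1} (x \<bullet> \<omega>) \<partial>lborel)"
    by (subst nn_integral_hyperplane_slab) (auto simp: A intro: borel_measurable_indicator)
  also have "\<dots> \<le> (\<integral>\<^sup>+x. indicator (cball (0::real^'n) (real k + (\<bar>t\<bar> + 1) * norm \<omega>)) x \<partial>lborel)"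
  proof (rule nn_integral_mono)
    fix x :: "real^'n"
    have "norm x \<le> norm (x + (t - x \<bullet> \<omega>) *\<^sub>R \<omega>) + \<bar>t - x \<bullet> \<omega>\<bar> * norm \<omega>"
      using norm_triangle_ineq4[of "x + (t - x \<bullet> \<omega>) *\<^sub>R \<omega>" "(t - x \<bullet> \<omega>) *\<^sub>R \<omega>"] by simp
    moreover have "\<bar>t - x \<bullet> \<omega>\<bar> * norm \<omega> \<le> (\<bar>t\<bar> + 1) * norm \<omega>" if "x \<bullet> \<omega> \<in> {0..1}"
      using that by (intro mult_right_mono) auto
    ultimately show "indicator A (x + (t - x \<bullet> \<omega>) *\<^sub>R \<omega>) * indicator {0..1} (x \<bullet> \<omega>)
      \<le> (indicator (cball 0 (real k + (\<bar>t\<bar> + 1) * norm \<omega>)) x :: ennreal)"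
      by (auto simp: A indicator_def)
  qed
  also have "\<dots> < \<infinity>"
    using emeasure_bounded_finite[of "cball (0::real^'n) (real k + (\<bar>t\<bar> + 1) * norm \<omega>)"] by (simp add: top_unique)
  finally show "emeasure ?H A \<noteq> \<infinity>" by simp
qed auto

section \<open>Gaussians on a hyperplane\<close>

lemma borel_measurable_cis [measurable (raw)]:
  assumes "f \<in> borel_measurable M"
  shows "(\<lambda>x. cis (f x)) \<in> borel_measurable M"
proof -
  have "cis \<in> borel_measurable borel"
    by (intro borel_measurable_continuous_onI continuous_intros)
  then show ?thesis using assms by (rule measurable_compose[rotated])
qed

text \<open>
  The characteristic function of the normal law, rescaled to variance \<open>1 / (2\<epsilon>)\<close>.
\<close>
lemma gaussian_integral_real:
  fixes \<epsilon> v :: real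
  assumes \<epsilon>: "\<epsilon> > 0"
  shows integrable_gaussian_character: "integrable lborel (\<lambda>s. exp (- \<epsilon> * s\<^sup>2) *\<^sub>R cis (s * v))"
    and integral_gaussian_character: "(LINT s|lborel. exp (- \<epsilon> * s\<^sup>2) *\<^sub>R cis (s * v))
      = complex_of_real (sqrt (pi / \<epsilon>) * exp (- v\<^sup>2 / (4 * \<epsilon>)))"
    and nn_integral_gaussian: "(\<integral>\<^sup>+s. ennreal (exp (- \<epsilon> * s\<^sup>2)) \<partial>lborel) = ennreal (sqrt (pi / \<epsilon>))"
proof -
  define \<sigma> where "\<sigma> = 1 / sqrt (2 * \<epsilon>)"
  have \<sigma>: "\<sigma> > 0" "\<sigma>\<^sup>2 = 1 / (2 * \<epsilon>)" using \<epsilon> by (simp_all add: \<sigma>_def power_divide)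
  have den: "exp (- \<epsilon> * s\<^sup>2) = sqrt (pi / \<epsilon>) * normal_density 0 \<sigma> s" for s
    using \<epsilon> by (simp add: normal_density_def \<sigma>(2) real_sqrt_divide)
  show "(\<integral>\<^sup>+s. ennreal (exp (- \<epsilon> * s\<^sup>2)) \<partial>lborel) = ennreal (sqrt (pi / \<epsilon>))"
    using \<sigma> \<epsilon> unfolding den
    by (subst nn_integral_eq_integral) auto
  have I: "integrable lborel (\<lambda>s. sqrt (pi / \<epsilon>) * normal_density 0 \<sigma> s)"
    using \<sigma> by simp
  show "integrable lborel (\<lambda>s. exp (- \<epsilon> * s\<^sup>2) *\<^sub>R cis (s * v))"
    unfolding den
    by (rule Bochner_Integration.integrable_bound[OF I]) (auto simp: \<epsilon> less_imp_le cis_conv_exp)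
  \<comment> \<open>The substitution \<open>s = \<sigma> x\<close> turns the integral into the characteristic function of the standard normal law.\<close>
  have "\<sigma> * sqrt (2 * pi) = sqrt (pi / \<epsilon>)"
    using \<epsilon> by (simp add: \<sigma>_def real_sqrt_mult real_sqrt_divide)
  moreover have "(\<sigma> * v)\<^sup>2 / 2 = v\<^sup>2 / (4 * \<epsilon>)"
    by (simp add: power_mult_distrib \<sigma>(2))
  moreover have "(LINT s|lborel. exp (- \<epsilon> * s\<^sup>2) *\<^sub>R cis (s * v))
      = \<sigma> *\<^sub>R (LINT x|lborel. exp (- (x\<^sup>2 / 2)) *\<^sub>R cis (\<sigma> * x * v))"
    using \<sigma>(1) \<epsilon> by (subst lborel_integral_real_affine[where c=\<sigma> and t=0]) (simp_all add: power_mult_distrib \<sigma>(2))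
  moreover have "(LINT x|lborel. exp (- (x\<^sup>2 / 2)) *\<^sub>R cis (\<sigma> * x * v))
      = (LINT x|lborel. sqrt (2 * pi) *\<^sub>R (std_normal_density x *\<^sub>R iexp ((\<sigma> * v) * x)))"
    by (intro Bochner_Integration.integral_cong refl) (simp add: std_normal_density_def cis_conv_exp mult_ac)
  moreover have "\<dots> = sqrt (2 * pi) *\<^sub>R char std_normal_distribution (\<sigma> * v)"
    by (subst integral_scaleR_right) (simp_all add: char_def integral_density)
  ultimately have "(LINT s|lborel. exp (- \<epsilon> * s\<^sup>2) *\<^sub>R cis (s * v)) = \<sigma> *\<^sub>R sqrt (2 * pi) *\<^sub>R char std_normal_distribution (\<sigma> * v)"
    by simp
  with \<open>\<sigma> * sqrt (2 * pi) = sqrt (pi / \<epsilon>)\<close> \<open>(\<sigma> * v)\<^sup>2 / 2 = v\<^sup>2 / (4 * \<epsilon>)\<close> show "(LINT s|lborel. exp (- \<epsilon> * s\<^sup>2) *\<^sub>R cis (s * v))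
      = complex_of_real (sqrt (pi / \<epsilon>) * exp (- v\<^sup>2 / (4 * \<epsilon>)))"
    by (simp only: char_std_normal_distribution scaleR_scaleR)
      (simp add: scaleR_conv_of_real del: real_sqrt_mult)
qed

definition perp :: "'a::real_inner \<Rightarrow> 'a \<Rightarrow> 'a" where
  "perp \<omega> x = x - (x \<bullet> \<omega>) *\<^sub>R \<omega>"

lemma orthonormal_parseval:
  fixes v :: "'a::euclidean_space"
  assumes B: "pairwise orthogonal B" "\<And>b. b \<in> B \<Longrightarrow> norm b = 1" "finite B" "span B = UNIV"
  shows "(\<Sum>b\<in>B. (v \<bullet> b)\<^sup>2) = (norm v)\<^sup>2"
proof -
  have bb: "a \<bullet> b = (if a = b then 1 else 0)" if "a \<in> B" "b \<in> B" for a b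
    using that B by (auto simp: pairwise_def orthogonal_def norm_eq_1)
  have "v \<in> span B" using B by simp
  then obtain c where c: "v = (\<Sum>b\<in>B. c b *\<^sub>R b)"
    unfolding span_finite[OF B(3)] by auto
  have "v \<bullet> b = c b" if "b \<in> B" for b
    using that B(3) by (simp add: c inner_sum_left bb if_distrib sum.delta cong: if_cong)
  then have "v = (\<Sum>b\<in>B. (v \<bullet> b) *\<^sub>R b)" using c by simp
  then have "v \<bullet> v = (\<Sum>b\<in>B. (v \<bullet> b) *\<^sub>R b) \<bullet> v" by simp
  also have "\<dots> = (\<Sum>b\<in>B. (v \<bullet> b)\<^sup>2)"
    unfolding inner_sum_left by (intro sum.cong refl) (simp add: power2_eq_square inner_commute)
  finally show ?thesis by (simp add: power2_norm_eq_inner)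
qed

lemma norm_perp_le: "norm \<omega> = 1 \<Longrightarrow> norm (perp \<omega> x) \<le> norm x"
proof -
  assume \<omega>: "norm \<omega> = 1"
  have "(norm (perp \<omega> x))\<^sup>2 = (norm x)\<^sup>2 - (x \<bullet> \<omega>)\<^sup>2"
    using \<omega> unfolding perp_def power2_norm_eq_inner
    by (simp add: inner_diff_left inner_diff_right inner_commute norm_eq_1 power2_eq_square)
  then show ?thesis by (metis diff_ge_0_iff_ge norm_ge_zero power2_le_imp_le diff_le_eq le_add_same_cancel1 zero_le_power2)
qed

text \<open>
  Orthonormal coordinates on \<open>\<omega>\<^sup>\<bottom>\<close>.  They are used to factor Gaussian integrals into integrals over the line;
  a basis exists for each unit vector, so that the statements below that do not mention \<open>B\<close> hold for every
  \<open>\<omega>\<close> of norm 1.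
\<close>
locale hyperplane_orthonormal_basis =
  fixes \<omega> :: "real^'n" and B :: "(real^'n) set"
  assumes unit: "norm \<omega> = 1"
    and orth: "pairwise orthogonal B" and unitB: "\<And>b. b \<in> B \<Longrightarrow> norm b = 1 \<and> b \<bullet> \<omega> = 0"
    and card_B: "card B = CARD('n) - 1" and fin: "finite B" and span_B: "span (insert \<omega> B) = UNIV" "\<omega> \<notin> B"

lemma hyperplane_basis_exists:
  fixes \<omega> :: "real^'n"
  assumes \<omega>: "norm \<omega> = 1"
  obtains B where "hyperplane_orthonormal_basis \<omega> B"
proof -
  obtain S where S: "\<omega> \<in> S" "pairwise orthogonal S" "\<And>x. x \<in> S \<Longrightarrow> norm x = 1"
    "independent S" "card S = DIM(real^'n)" "span S = UNIV"
    using vector_in_orthonormal_basis[OF \<omega>] by blast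
  have fS: "finite S" using S(4) by (rule independent_imp_finite)
  have "norm b = 1 \<and> b \<bullet> \<omega> = 0" if "b \<in> S - {\<omega>}" for b
    using that S(1,3) S(2) by (auto simp: pairwise_def orthogonal_def)
  then have "hyperplane_orthonormal_basis \<omega> (S - {\<omega>})"
    using S fS \<omega> by unfold_locales (auto simp: pairwise_def insert_absorb)
  then show thesis by (rule that)
qed

context hyperplane_orthonormal_basis
begin

lemma hyperplane_eq_distr:
  "hyperplane_measure \<omega> 0 = distr (\<Pi>\<^sub>M b\<in>B. lborel) borel (\<lambda>c. \<Sum>b\<in>B. c b *\<^sub>R b)"
  using hyperplane_measure_orthonormal[OF unit orth unitB card_B fin, of 0] by simp

lemma basis_inner: "a \<in> B \<Longrightarrow> b \<in> B \<Longrightarrow> a \<bullet> b = (if a = b then 1 else 0)"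
  using orth unitB by (auto simp: pairwise_def orthogonal_def norm_eq_1)

lemma combination_inner: "b \<in> B \<Longrightarrow> (\<Sum>a\<in>B. c a *\<^sub>R a) \<bullet> b = c b"
  using fin by (simp add: inner_sum_left basis_inner if_distrib sum.delta cong: if_cong)

lemma norm_combination: "(norm (\<Sum>b\<in>B. c b *\<^sub>R b))\<^sup>2 = (\<Sum>b\<in>B. (c b)\<^sup>2)"
proof -
  have "v \<bullet> (\<Sum>b\<in>B. c b *\<^sub>R b) = (\<Sum>b\<in>B. c b * (v \<bullet> b))" for v
    by (simp add: inner_sum_right)
  from this[of "\<Sum>b\<in>B. c b *\<^sub>R b"] show ?thesis
    unfolding power2_norm_eq_inner by (simp add: combination_inner power2_eq_square)
qed

lemma norm_perp: "(norm (perp \<omega> v))\<^sup>2 = (\<Sum>b\<in>B. (v \<bullet> b)\<^sup>2)"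
proof -
  have "(norm (perp \<omega> v))\<^sup>2 = (\<Sum>b\<in>insert \<omega> B. (perp \<omega> v \<bullet> b)\<^sup>2)"
    by (rule orthonormal_parseval[symmetric])
      (use fin span_B unit unitB orth in \<open>auto simp: pairwise_insert orthogonal_def inner_commute\<close>)
  also have "\<dots> = (\<Sum>b\<in>B. (perp \<omega> v \<bullet> b)\<^sup>2)"
    using fin span_B unit by (simp add: perp_def inner_diff_left norm_eq_1)
  also have "\<dots> = (\<Sum>b\<in>B. (v \<bullet> b)\<^sup>2)"
    by (intro sum.cong refl) (simp add: perp_def inner_diff_left inner_commute[of \<omega>] unitB)
  finally show ?thesis .
qed

lemma product_lborel: "product_sigma_finite (\<lambda>_::real^'n. lborel :: real measure)"
  by standard

lemma nn_integral_hyperplane_prod: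
  fixes f :: "real^'n \<Rightarrow> real \<Rightarrow> ennreal"
  assumes [measurable]: "\<And>b. f b \<in> borel_measurable borel"
  shows "(\<integral>\<^sup>+y. (\<Prod>b\<in>B. f b (y \<bullet> b)) \<partial>hyperplane_measure \<omega> 0) = (\<Prod>b\<in>B. \<integral>\<^sup>+s. f b s \<partial>lborel)"
  unfolding hyperplane_eq_distr
  by (subst nn_integral_distr)
    (auto simp: combination_inner fin intro!: product_sigma_finite.product_nn_integral_prod[OF product_lborel])

lemma gaussian_character_hyperplane:
  assumes \<epsilon>: "\<epsilon> > 0"
  shows integrable_gaussian_character_hyperplane:
      "integrable (hyperplane_measure \<omega> 0) (\<lambda>y. exp (- \<epsilon> * (norm y)\<^sup>2) *\<^sub>R cis (y \<bullet> v))"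
    and integral_gaussian_character_hyperplane:
      "(LINT y|hyperplane_measure \<omega> 0. exp (- \<epsilon> * (norm y)\<^sup>2) *\<^sub>R cis (y \<bullet> v))
        = complex_of_real (sqrt (pi / \<epsilon>) ^ (CARD('n) - 1) * exp (- (norm (perp \<omega> v))\<^sup>2 / (4 * \<epsilon>)))"
proof -
  let ?F = "\<lambda>y. exp (- \<epsilon> * (norm y)\<^sup>2) *\<^sub>R cis (y \<bullet> v)"
  have eq: "?F (\<Sum>b\<in>B. c b *\<^sub>R b) = (\<Prod>b\<in>B. exp (- \<epsilon> * (c b)\<^sup>2) *\<^sub>R cis (c b * (b \<bullet> v)))" for c :: "real^'n \<Rightarrow> real"
  proof -
    have "exp (- \<epsilon> * (norm (\<Sum>b\<in>B. c b *\<^sub>R b))\<^sup>2) = (\<Prod>b\<in>B. exp (- \<epsilon> * (c b)\<^sup>2))"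
      by (simp add: norm_combination sum_distrib_left exp_sum fin flip: sum_negf)
    moreover have "cis ((\<Sum>b\<in>B. c b *\<^sub>R b) \<bullet> v) = (\<Prod>b\<in>B. cis (c b * (b \<bullet> v)))"
      by (simp add: cis_conv_exp inner_sum_left sum_distrib_left exp_sum fin)
    ultimately show ?thesis
      by (simp add: scaleR_conv_of_real prod.distrib)
  qed
  have M[measurable]: "?F \<in> borel_measurable borel" by measurable
  have S[measurable]: "(\<lambda>c. \<Sum>b\<in>B. c b *\<^sub>R b) \<in> borel_measurable (\<Pi>\<^sub>M b\<in>B. lborel)" by measurable
  interpret P: product_sigma_finite "\<lambda>_::real^'n. lborel :: real measure" by (rule product_lborel)
  show "integrable (hyperplane_measure \<omega> 0) ?F"
    unfolding hyperplane_eq_distr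
    by (subst integrable_distr_eq[OF S M])
      (simp only: eq, intro P.product_integrable_prod fin integrable_gaussian_character[OF \<epsilon>])
  have "integral\<^sup>L (hyperplane_measure \<omega> 0) ?F
     = (LINT c|(\<Pi>\<^sub>M b\<in>B. lborel). (\<Prod>b\<in>B. exp (- \<epsilon> * (c b)\<^sup>2) *\<^sub>R cis (c b * (b \<bullet> v))))"
    unfolding hyperplane_eq_distr by (subst integral_distr) (auto simp only: eq S M)
  also have "\<dots> = (\<Prod>b\<in>B. LINT s|lborel. exp (- \<epsilon> * s\<^sup>2) *\<^sub>R cis (s * (b \<bullet> v)))"
    by (rule P.product_integral_prod[OF fin integrable_gaussian_character[OF \<epsilon>]])
  also have "\<dots> = (\<Prod>b\<in>B. complex_of_real (sqrt (pi / \<epsilon>) * exp (- (b \<bullet> v)\<^sup>2 / (4 * \<epsilon>))))"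
    by (simp only: integral_gaussian_character[OF \<epsilon>])
  also have "\<dots> = complex_of_real (sqrt (pi / \<epsilon>) ^ (CARD('n) - 1) * exp (\<Sum>b\<in>B. - (b \<bullet> v)\<^sup>2 / (4 * \<epsilon>)))"
    by (simp add: prod.distrib card_B exp_sum fin)
  also have "(\<Sum>b\<in>B. - (b \<bullet> v)\<^sup>2 / (4 * \<epsilon>)) = - (norm (perp \<omega> v))\<^sup>2 / (4 * \<epsilon>)"
    by (simp add: norm_perp sum_negf sum_divide_distrib inner_commute)
  finally show "integral\<^sup>L (hyperplane_measure \<omega> 0) ?F
    = complex_of_real (sqrt (pi / \<epsilon>) ^ (CARD('n) - 1) * exp (- (norm (perp \<omega> v))\<^sup>2 / (4 * \<epsilon>)))" .
qed

end

section \<open>The Gaussian quadratic form\<close>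

text \<open>
  The Fourier transform of \<open>exp(-\<epsilon>|y|\<^sup>2)\<close> on the hyperplane orthogonal to \<open>\<omega>\<close>.  It is defined on all of
  space and depends only on the component of its argument in the hyperplane, since frequencies will be points of
  the sphere.
\<close>
definition gauss_kernel :: "real^'n \<Rightarrow> real \<Rightarrow> real^'n \<Rightarrow> real" where
  "gauss_kernel \<omega> \<epsilon> v = sqrt (pi / \<epsilon>) ^ (CARD('n) - 1) * exp (- (norm (perp \<omega> v))\<^sup>2 / (4 * \<epsilon>))"

lemma borel_measurable_cnj [measurable (raw)]:
  assumes "f \<in> borel_measurable M"
  shows "(\<lambda>x. cnj (f x)) \<in> borel_measurable M"
proof -
  have "cnj \<in> borel_measurable borel"
    by (intro borel_measurable_continuous_onI continuous_intros)
  then show ?thesis using assms by (rule measurable_compose[rotated])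
qed

text \<open>
  The measure is a parameter because the transform is used for two measures: surface measure on the sphere
  (the extension operator) and Lebesgue measure on a hyperplane (Plancherel).
\<close>
definition fourier :: "(real^'n) measure \<Rightarrow> (real^'n \<Rightarrow> complex) \<Rightarrow> real^'n \<Rightarrow> complex" where
  "fourier \<mu> f y = (LINT \<xi>|\<mu>. cis (y \<bullet> \<xi>) * f \<xi>)"

lemma borel_measurable_perp [measurable (raw)]:
  fixes f :: "'a \<Rightarrow> real^'n"
  assumes [measurable]: "f \<in> borel_measurable M"
  shows "(\<lambda>x. perp \<omega> (f x)) \<in> borel_measurable M"
  unfolding perp_def by measurable

lemma borel_measurable_gauss_kernel [measurable (raw)]:
  fixes f :: "'a \<Rightarrow> real^'n"
  assumes [measurable]: "f \<in> borel_measurable M"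
  shows "(\<lambda>x. gauss_kernel \<omega> \<epsilon> (f x)) \<in> borel_measurable M"
  unfolding gauss_kernel_def by measurable

lemma gauss_kernel_nonneg: "\<epsilon> > 0 \<Longrightarrow> gauss_kernel \<omega> \<epsilon> v \<ge> 0"
  by (simp add: gauss_kernel_def)

lemma gauss_kernel_minus: "gauss_kernel \<omega> \<epsilon> (v - w) = gauss_kernel \<omega> \<epsilon> (w - v)"
proof -
  have "perp \<omega> (v - w) = - perp \<omega> (w - v)"
    by (simp add: perp_def inner_diff_left algebra_simps)
  then show ?thesis by (simp add: gauss_kernel_def)
qed

lemma borel_measurable_fourier:
  assumes "sigma_finite_measure \<mu>" and [measurable_cong]: "sets \<mu> = sets borel"
    and [measurable]: "f \<in> borel_measurable borel"
  shows "fourier \<mu> f \<in> borel_measurable borel"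
proof -
  interpret sigma_finite_measure \<mu> by fact
  show ?thesis
    unfolding fourier_def[abs_def]
    by (rule borel_measurable_lebesgue_integral) measurable
qed

lemma
  fixes f g :: "_ \<Rightarrow> 'c::{real_normed_field, banach, second_countable_topology}"
  assumes M: "pair_sigma_finite M N" and f: "integrable M f" and g: "integrable N g"
  shows integrable_pair_mult: "integrable (M \<Otimes>\<^sub>M N) (\<lambda>(x, y). f x * g y)"
    and integral_pair_mult: "(LINT (x, y)|(M \<Otimes>\<^sub>M N). f x * g y) = integral\<^sup>L M f * integral\<^sup>L N g"
proof -
  interpret pair_sigma_finite M N by fact
  have [measurable]: "f \<in> borel_measurable M" "g \<in> borel_measurable N" using f g by auto
  show I: "integrable (M \<Otimes>\<^sub>M N) (\<lambda>(x, y). f x * g y)"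
    using f g by (intro Fubini_integrable) (auto simp: norm_mult)
  show "(LINT (x, y)|(M \<Otimes>\<^sub>M N). f x * g y) = integral\<^sup>L M f * integral\<^sup>L N g"
    using integral_fst[of "\<lambda>x y. f x * g y"] I by simp
qed

context hyperplane_orthonormal_basis
begin

abbreviation "H \<equiv> hyperplane_measure \<omega> 0"

sublocale H: sigma_finite_measure "hyperplane_measure \<omega> 0"
  by (rule sigma_finite_hyperplane_measure)

lemma integrable_gaussian_hyperplane:
  "\<epsilon> > 0 \<Longrightarrow> integrable H (\<lambda>y. exp (- \<epsilon> * (norm y)\<^sup>2))"
  using integrable_norm[OF integrable_gaussian_character_hyperplane, of \<epsilon> 0] by simp

text \<open>
  Expand the product of the two transforms as a double integral over the frequencies and integrate in \<open>y\<close>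
  first: this is legitimate because the Gaussian weight makes the triple integral absolutely convergent, and it
  leaves the Gaussian kernel.
\<close>
lemma
  assumes \<mu>: "sigma_finite_measure \<mu>" and sets[measurable_cong]: "sets \<mu> = sets borel"
    and f: "integrable \<mu> f" and h: "integrable \<mu> h" and \<epsilon>: "\<epsilon> > 0"
  shows integrable_gaussian_fourier:
      "integrable H (\<lambda>y. exp (- \<epsilon> * (norm y)\<^sup>2) *\<^sub>R (fourier \<mu> f y * cnj (fourier \<mu> h y)))"
    and integrable_gauss_kernel_form:
      "integrable (\<mu> \<Otimes>\<^sub>M \<mu>) (\<lambda>(\<xi>, \<eta>). gauss_kernel \<omega> \<epsilon> (\<xi> - \<eta>) *\<^sub>R (f \<xi> * cnj (h \<eta>)))"
    and gaussian_fourier_form: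
      "(LINT y|H. exp (- \<epsilon> * (norm y)\<^sup>2) *\<^sub>R (fourier \<mu> f y * cnj (fourier \<mu> h y)))
      = (LINT (\<xi>, \<eta>)|(\<mu> \<Otimes>\<^sub>M \<mu>). gauss_kernel \<omega> \<epsilon> (\<xi> - \<eta>) *\<^sub>R (f \<xi> * cnj (h \<eta>)))"
proof -
  interpret \<mu>: sigma_finite_measure \<mu> by fact
  interpret \<mu>\<mu>: pair_sigma_finite \<mu> \<mu> by standard
  interpret HM: pair_sigma_finite H "\<mu> \<Otimes>\<^sub>M \<mu>"
    by (intro pair_sigma_finite.intro H.sigma_finite_measure_axioms \<mu>\<mu>.sigma_finite_measure_axioms)
  have [measurable]: "f \<in> borel_measurable borel" "h \<in> borel_measurable borel"
    using f h measurable_cong_sets[OF sets refl] by auto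
  define w where "w y = exp (- \<epsilon> * (norm y)\<^sup>2)" for y :: "real^'n"
  have wm[measurable]: "w \<in> borel_measurable borel" unfolding w_def by measurable
  have w0: "w y > 0" for y by (simp add: w_def)
  have iw: "integrable H (\<lambda>y. complex_of_real (w y))"
    unfolding w_def[abs_def] by (rule integrable_of_real[OF integrable_gaussian_hyperplane[OF \<epsilon>]])
  define \<Phi> where "\<Phi> y p = (w y *\<^sub>R cis (y \<bullet> (fst p - snd p))) * (f (fst p) * cnj (h (snd p)))" for y p
  have \<Phi>m[measurable]: "case_prod \<Phi> \<in> borel_measurable (H \<Otimes>\<^sub>M (\<mu> \<Otimes>\<^sub>M \<mu>))"
    unfolding \<Phi>_def by measurable
  have fh: "integrable (\<mu> \<Otimes>\<^sub>M \<mu>) (\<lambda>(\<xi>, \<eta>). f \<xi> * cnj (h \<eta>))"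
    using f h by (intro integrable_pair_mult) (auto simp: \<mu>\<mu>.pair_sigma_finite_axioms)
  have \<Phi>i: "integrable (H \<Otimes>\<^sub>M (\<mu> \<Otimes>\<^sub>M \<mu>)) (case_prod \<Phi>)"
    using w0 by (intro Bochner_Integration.integrable_bound[OF integrable_pair_mult[OF HM.pair_sigma_finite_axioms iw fh] \<Phi>m])
      (auto simp: \<Phi>_def norm_mult)
  have 1: "(LINT p|(\<mu> \<Otimes>\<^sub>M \<mu>). \<Phi> y p) = w y *\<^sub>R (fourier \<mu> f y * cnj (fourier \<mu> h y))" for y
  proof -
    have "integrable \<mu> (\<lambda>\<xi>. cis (y \<bullet> \<xi>) * f \<xi>)" if "integrable \<mu> f" for f
      using that borel_measurable_integrable[OF that]
      by (intro Bochner_Integration.integrable_bound[OF that]) (auto simp: norm_mult)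
    note I = this[OF f] this[OF h]
    have cis_diff: "cis (y \<bullet> (\<xi> - \<eta>)) = cis (y \<bullet> \<xi>) * cnj (cis (y \<bullet> \<eta>))" for \<xi> \<eta>
      by (simp add: inner_diff_right cis_cnj cis_mult)
    have "(LINT p|(\<mu> \<Otimes>\<^sub>M \<mu>). \<Phi> y p)
       = (LINT p|(\<mu> \<Otimes>\<^sub>M \<mu>). w y *\<^sub>R (case p of (\<xi>, \<eta>) \<Rightarrow> (cis (y \<bullet> \<xi>) * f \<xi>) * cnj (cis (y \<bullet> \<eta>) * h \<eta>)))"
      by (intro Bochner_Integration.integral_cong refl)
        (auto simp: \<Phi>_def cis_diff mult_ac)
    also have "\<dots> = w y *\<^sub>R (integral\<^sup>L \<mu> (\<lambda>\<xi>. cis (y \<bullet> \<xi>) * f \<xi>) * integral\<^sup>L \<mu> (\<lambda>\<eta>. cnj (cis (y \<bullet> \<eta>) * h \<eta>)))"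
      by (subst integral_scaleR_right, subst integral_pair_mult[OF \<mu>\<mu>.pair_sigma_finite_axioms])
        (use I in \<open>simp_all only: complex_integrable_cnj\<close>)
    also have "\<dots> = w y *\<^sub>R (fourier \<mu> f y * cnj (fourier \<mu> h y))"
      by (simp only: fourier_def integral_bounded_linear[OF bounded_linear_cnj I(2)])
    finally show ?thesis .
  qed
  have 2: "(LINT y|H. \<Phi> y p) = (case p of (\<xi>, \<eta>) \<Rightarrow> gauss_kernel \<omega> \<epsilon> (\<xi> - \<eta>) *\<^sub>R (f \<xi> * cnj (h \<eta>)))" for p
    unfolding \<Phi>_def w_def
    by (simp only: integral_mult_left_zero integral_gaussian_character_hyperplane[OF \<epsilon>])
      (simp add: gauss_kernel_def scaleR_conv_of_real split: prod.split)
  show "integrable H (\<lambda>y. exp (- \<epsilon> * (norm y)\<^sup>2) *\<^sub>R (fourier \<mu> f y * cnj (fourier \<mu> h y)))"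
    using HM.integrable_fst[OF \<Phi>i] unfolding 1 by (simp add: w_def)
  show "integrable (\<mu> \<Otimes>\<^sub>M \<mu>) (\<lambda>(\<xi>, \<eta>). gauss_kernel \<omega> \<epsilon> (\<xi> - \<eta>) *\<^sub>R (f \<xi> * cnj (h \<eta>)))"
    using HM.integrable_snd[OF \<Phi>i] unfolding 2 by simp
  show "(LINT y|H. exp (- \<epsilon> * (norm y)\<^sup>2) *\<^sub>R (fourier \<mu> f y * cnj (fourier \<mu> h y)))
      = (LINT (\<xi>, \<eta>)|(\<mu> \<Otimes>\<^sub>M \<mu>). gauss_kernel \<omega> \<epsilon> (\<xi> - \<eta>) *\<^sub>R (f \<xi> * cnj (h \<eta>)))"
    using HM.Fubini_integral[OF \<Phi>i] unfolding 1 2 by (simp add: w_def)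
qed

text \<open>
  Schur's test: the arithmetic-geometric mean inequality
  \<open>2 |f(\<xi>)| |f(\<eta>)| \<le> |f(\<xi>)|\<^sup>2 a(\<eta>) / a(\<xi>) + |f(\<eta>)|\<^sup>2 a(\<xi>) / a(\<eta>)\<close> and the symmetry of the kernel.  The weight
  \<open>a\<close> is what brings the kernel of \<open>T_op\<close> into the bound.
\<close>
lemma gaussian_schur_test:
  assumes \<mu>: "sigma_finite_measure \<mu>" and sets[measurable_cong]: "sets \<mu> = sets borel"
    and f: "integrable \<mu> f" and \<epsilon>: "\<epsilon> > 0"
    and a[measurable]: "a \<in> borel_measurable borel" and a0: "\<And>\<xi>. a \<xi> > 0"
    and C: "AE \<xi> in \<mu>. (\<integral>\<^sup>+\<eta>. ennreal (gauss_kernel \<omega> \<epsilon> (\<xi> - \<eta>) * a \<eta>) \<partial>\<mu>) \<le> ennreal C"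
  shows "(\<integral>\<^sup>+y. ennreal (exp (- \<epsilon> * (norm y)\<^sup>2) * (norm (fourier \<mu> f y))\<^sup>2) \<partial>H)
      \<le> ennreal C * (\<integral>\<^sup>+\<xi>. ennreal ((norm (f \<xi>))\<^sup>2 / a \<xi>) \<partial>\<mu>)" (is "?L \<le> _")
proof -
  interpret \<mu>: sigma_finite_measure \<mu> by fact
  interpret \<mu>\<mu>: pair_sigma_finite \<mu> \<mu> by standard
  have [measurable]: "f \<in> borel_measurable borel"
    using f measurable_cong_sets[OF sets refl] by auto
  let ?K = "gauss_kernel \<omega> \<epsilon>"
  let ?G = "\<lambda>\<xi> \<eta>. ennreal (?K (\<xi> - \<eta>) * a \<eta> * ((norm (f \<xi>))\<^sup>2 / a \<xi>))"
  have K0: "?K v \<ge> 0" for v by (rule gauss_kernel_nonneg[OF \<epsilon>])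
  let ?Q = "LINT y|H. exp (- \<epsilon> * (norm y)\<^sup>2) *\<^sub>R (fourier \<mu> f y * cnj (fourier \<mu> f y))"
  have iQ: "integrable H (\<lambda>y. exp (- \<epsilon> * (norm y)\<^sup>2) * (norm (fourier \<mu> f y))\<^sup>2)"
    using integrable_norm[OF integrable_gaussian_fourier[OF \<mu> sets f f \<epsilon>]]
    by (simp add: norm_mult power2_eq_square)
  have "?Q = (LINT y|H. complex_of_real (exp (- \<epsilon> * (norm y)\<^sup>2) * (norm (fourier \<mu> f y))\<^sup>2))"
    by (intro Bochner_Integration.integral_cong refl) (simp add: scaleR_conv_of_real complex_norm_square[symmetric])
  then have "?Q = complex_of_real (LINT y|H. exp (- \<epsilon> * (norm y)\<^sup>2) * (norm (fourier \<mu> f y))\<^sup>2)"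
    by (simp only: integral_complex_of_real)
  then have "(\<integral>\<^sup>+y. ennreal (exp (- \<epsilon> * (norm y)\<^sup>2) * (norm (fourier \<mu> f y))\<^sup>2) \<partial>H) = ennreal (norm ?Q)"
    by (subst nn_integral_eq_integral[OF iQ]) auto
  also have "\<dots> \<le> (\<integral>\<^sup>+(\<xi>, \<eta>). ennreal (?K (\<xi> - \<eta>) * norm (f \<xi>) * norm (f \<eta>)) \<partial>(\<mu> \<Otimes>\<^sub>M \<mu>))"
    unfolding gaussian_fourier_form[OF \<mu> sets f f \<epsilon>]
    by (rule order_trans[OF integral_norm_bound_ennreal[OF integrable_gauss_kernel_form[OF \<mu> sets f f \<epsilon>]]])
      (auto intro!: nn_integral_mono simp: norm_mult K0 mult_ac)
  also have "\<dots> = (\<integral>\<^sup>+\<xi>. \<integral>\<^sup>+\<eta>. ennreal (?K (\<xi> - \<eta>) * norm (f \<xi>) * norm (f \<eta>)) \<partial>\<mu> \<partial>\<mu>)"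
    by (subst \<mu>.nn_integral_fst[symmetric]) auto
  finally have *: "?L \<le> (\<integral>\<^sup>+\<xi>. \<integral>\<^sup>+\<eta>. ennreal (?K (\<xi> - \<eta>) * norm (f \<xi>) * norm (f \<eta>)) \<partial>\<mu> \<partial>\<mu>)" .
  have "2 * (\<integral>\<^sup>+\<xi>. \<integral>\<^sup>+\<eta>. ennreal (?K (\<xi> - \<eta>) * norm (f \<xi>) * norm (f \<eta>)) \<partial>\<mu> \<partial>\<mu>)
      = (\<integral>\<^sup>+\<xi>. \<integral>\<^sup>+\<eta>. 2 * ennreal (?K (\<xi> - \<eta>) * norm (f \<xi>) * norm (f \<eta>)) \<partial>\<mu> \<partial>\<mu>)"
    by (simp add: nn_integral_cmult)
  also have "\<dots> \<le> (\<integral>\<^sup>+\<xi>. \<integral>\<^sup>+\<eta>. ?G \<xi> \<eta> + ?G \<eta> \<xi> \<partial>\<mu> \<partial>\<mu>)"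
  proof (intro nn_integral_mono)
    fix \<xi> \<eta>
    have am_gm: "2 * x * y \<le> q * (x\<^sup>2 / p) + p * (y\<^sup>2 / q)" if "p > 0" "q > 0" for x y p q :: real
    proof -
      have "0 \<le> (q * x - p * y)\<^sup>2 / (p * q)" using that by simp
      also have "\<dots> = q * (x\<^sup>2 / p) + p * (y\<^sup>2 / q) - 2 * x * y"
        using that by (simp add: field_simps power2_eq_square)
      finally show ?thesis by simp
    qed
    from mult_left_mono[OF am_gm[OF a0[of \<xi>] a0[of \<eta>], of "norm (f \<xi>)" "norm (f \<eta>)"] K0[of "\<xi> - \<eta>"]]
    have "2 * (?K (\<xi> - \<eta>) * norm (f \<xi>) * norm (f \<eta>))
        \<le> ?K (\<xi> - \<eta>) * a \<eta> * ((norm (f \<xi>))\<^sup>2 / a \<xi>) + ?K (\<eta> - \<xi>) * a \<xi> * ((norm (f \<eta>))\<^sup>2 / a \<eta>)"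
      unfolding gauss_kernel_minus[of \<omega> \<epsilon> \<eta> \<xi>] by (simp add: distrib_left mult_ac)
    then have "ennreal (2 * (?K (\<xi> - \<eta>) * norm (f \<xi>) * norm (f \<eta>)))
        \<le> ennreal (?K (\<xi> - \<eta>) * a \<eta> * ((norm (f \<xi>))\<^sup>2 / a \<xi>) + ?K (\<eta> - \<xi>) * a \<xi> * ((norm (f \<eta>))\<^sup>2 / a \<eta>))"
      by (rule ennreal_leI)
    then show "2 * ennreal (?K (\<xi> - \<eta>) * norm (f \<xi>) * norm (f \<eta>)) \<le> ?G \<xi> \<eta> + ?G \<eta> \<xi>"
      by (subst (asm) ennreal_mult, simp, simp add: K0, subst (asm) ennreal_plus)
        (simp_all add: K0 a0 less_imp_le)
  qed
  also have "\<dots> = (\<integral>\<^sup>+\<xi>. \<integral>\<^sup>+\<eta>. ?G \<xi> \<eta> \<partial>\<mu> \<partial>\<mu>) + (\<integral>\<^sup>+\<xi>. \<integral>\<^sup>+\<eta>. ?G \<eta> \<xi> \<partial>\<mu> \<partial>\<mu>)"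
    by (simp add: nn_integral_add)
  also have "(\<integral>\<^sup>+\<xi>. \<integral>\<^sup>+\<eta>. ?G \<eta> \<xi> \<partial>\<mu> \<partial>\<mu>) = (\<integral>\<^sup>+\<xi>. \<integral>\<^sup>+\<eta>. ?G \<xi> \<eta> \<partial>\<mu> \<partial>\<mu>)"
    by (rule \<mu>\<mu>.Fubini') measurable
  also have "(\<integral>\<^sup>+\<xi>. \<integral>\<^sup>+\<eta>. ?G \<xi> \<eta> \<partial>\<mu> \<partial>\<mu>) + (\<integral>\<^sup>+\<xi>. \<integral>\<^sup>+\<eta>. ?G \<xi> \<eta> \<partial>\<mu> \<partial>\<mu>) = 2 * (\<integral>\<^sup>+\<xi>. \<integral>\<^sup>+\<eta>. ?G \<xi> \<eta> \<partial>\<mu> \<partial>\<mu>)"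
    by (simp add: mult_2)
  finally have "(\<integral>\<^sup>+\<xi>. \<integral>\<^sup>+\<eta>. ennreal (?K (\<xi> - \<eta>) * norm (f \<xi>) * norm (f \<eta>)) \<partial>\<mu> \<partial>\<mu>)
      \<le> (\<integral>\<^sup>+\<xi>. \<integral>\<^sup>+\<eta>. ?G \<xi> \<eta> \<partial>\<mu> \<partial>\<mu>)"
    by (subst (asm) ennreal_mult_le_mult_iff) auto
  also have "\<dots> = (\<integral>\<^sup>+\<xi>. (\<integral>\<^sup>+\<eta>. ennreal (?K (\<xi> - \<eta>) * a \<eta>) \<partial>\<mu>) * ennreal ((norm (f \<xi>))\<^sup>2 / a \<xi>) \<partial>\<mu>)"
    by (intro nn_integral_cong, subst nn_integral_multc[symmetric])
      (auto simp: a0 less_imp_le ennreal_mult''[symmetric] intro!: nn_integral_cong)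
  also have "\<dots> \<le> (\<integral>\<^sup>+\<xi>. ennreal C * ennreal ((norm (f \<xi>))\<^sup>2 / a \<xi>) \<partial>\<mu>)"
    by (intro nn_integral_mono_AE) (use C in eventually_elim, auto intro: mult_right_mono)
  also have "\<dots> = ennreal C * (\<integral>\<^sup>+\<xi>. ennreal ((norm (f \<xi>))\<^sup>2 / a \<xi>) \<partial>\<mu>)"
    by (rule nn_integral_cmult) measurable
  finally show ?thesis using * by (rule order_trans[rotated])
qed

end

section \<open>Continuity of translations in the mean\<close>

lemma nn_integral_lborel_shift':
  fixes f :: "'a::euclidean_space \<Rightarrow> ennreal"
  assumes "f \<in> borel_measurable borel"
  shows "(\<integral>\<^sup>+x. f (x + z) \<partial>lborel) = (\<integral>\<^sup>+x. f x \<partial>lborel)"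
  using nn_integral_lborel_shift[OF assms, of z] by (simp add: add.commute)

text \<open>The modulus of continuity of \<open>f\<close> in the mean.\<close>
definition L1_shift :: "('a::euclidean_space \<Rightarrow> complex) \<Rightarrow> 'a \<Rightarrow> ennreal" where
  "L1_shift f z = (\<integral>\<^sup>+x. ennreal (norm (f (x + z) - f x)) \<partial>lborel)"

lemma L1_shift_triangle:
  assumes [measurable]: "f \<in> borel_measurable borel" "g \<in> borel_measurable borel"
  shows "L1_shift f z \<le> L1_shift g z + 2 * (\<integral>\<^sup>+x. ennreal (norm (f x - g x)) \<partial>lborel)"
proof -
  have "L1_shift f z \<le> (\<integral>\<^sup>+x. ennreal (norm (g (x + z) - g x)) + (ennreal (norm (f (x + z) - g (x + z))) + ennreal (norm (f x - g x))) \<partial>lborel)"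
    unfolding L1_shift_def
  proof (rule nn_integral_mono)
    fix x
    have "norm (f (x + z) - f x) \<le> norm (g (x + z) - g x) + (norm (f (x + z) - g (x + z)) + norm (f x - g x))"
      by norm
    then show "ennreal (norm (f (x + z) - f x)) \<le> ennreal (norm (g (x + z) - g x)) + (ennreal (norm (f (x + z) - g (x + z))) + ennreal (norm (f x - g x)))"
      by (simp add: ennreal_leI flip: ennreal_plus)
  qed
  also have "\<dots> = L1_shift g z + ((\<integral>\<^sup>+x. ennreal (norm (f (x + z) - g (x + z))) \<partial>lborel) + (\<integral>\<^sup>+x. ennreal (norm (f x - g x)) \<partial>lborel))"
    unfolding L1_shift_def by (simp add: nn_integral_add)
  also have "(\<integral>\<^sup>+x. ennreal (norm (f (x + z) - g (x + z))) \<partial>lborel) = (\<integral>\<^sup>+x. ennreal (norm (f x - g x)) \<partial>lborel)"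
    by (rule nn_integral_lborel_shift'[of "\<lambda>x. ennreal (norm (f x - g x))"]) measurable
  finally show ?thesis by (simp add: mult_2)
qed

text \<open>
  Translation preserves Lebesgue measure, so functions close in the mean have close moduli of continuity,
  uniformly in the shift.
\<close>
lemma L1_shift_tendsto_approx:
  assumes f[measurable]: "f \<in> borel_measurable borel"
    and approx: "\<And>\<delta>. \<delta> > 0 \<Longrightarrow> \<exists>g \<in> borel_measurable borel. (L1_shift g \<longlongrightarrow> 0) (at 0) \<and> (\<integral>\<^sup>+x. ennreal (norm (f x - g x)) \<partial>lborel) \<le> ennreal \<delta>"
  shows "(L1_shift f \<longlongrightarrow> 0) (at 0)"
proof (rule order_tendstoI)
  fix e :: ennreal assume "0 < e"
  then obtain d where d: "0 < d" "d < e" using dense by blast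
  then obtain \<delta> where "d = ennreal \<delta>" "\<delta> \<ge> 0" by (cases d) auto
  with d have \<delta>: "0 < \<delta>" "ennreal \<delta> < e" by auto
  obtain g where g[measurable]: "g \<in> borel_measurable borel" and lim: "(L1_shift g \<longlongrightarrow> 0) (at 0)"
    and fg: "(\<integral>\<^sup>+x. ennreal (norm (f x - g x)) \<partial>lborel) \<le> ennreal (\<delta> / 4)"
    using approx[of "\<delta>/4"] \<delta> by auto
  have "\<forall>\<^sub>F z in at 0. L1_shift g z < ennreal (\<delta> / 2)"
    using \<delta> by (intro order_tendstoD(2)[OF lim]) auto
  then show "\<forall>\<^sub>F z in at 0. L1_shift f z < e"
  proof eventually_elim
    case (elim z)
    have "L1_shift f z \<le> L1_shift g z + 2 * ennreal (\<delta> / 4)"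
      by (rule order_trans[OF L1_shift_triangle[OF f g]]) (intro add_left_mono mult_left_mono fg, simp)
    also have "\<dots> \<le> ennreal (\<delta> / 2) + 2 * ennreal (\<delta> / 4)"
      using elim by (intro add_right_mono) simp
    also have "2 * ennreal (\<delta> / 4) = ennreal (\<delta> / 2)"
      using \<delta> by (subst ennreal_numeral[symmetric], subst ennreal_mult[symmetric]) auto
    also have "ennreal (\<delta> / 2) + ennreal (\<delta> / 2) = ennreal \<delta>"
      using \<delta> by (subst ennreal_plus[symmetric]) auto
    finally show ?case using \<delta>(2) by simp
  qed
qed simp

text \<open>
  For an open set \<open>U\<close>, a point of \<open>U\<close> stays in \<open>U\<close> under every small shift, so dominated convergence handles
  the part of \<open>U\<close> that the shift moves out; the part moved in is the same quantity for the opposite shift.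
\<close>
lemma L1_shift_indicator_open:
  assumes U: "open U" "emeasure lborel U < \<infinity>"
  shows "(L1_shift (\<lambda>x. indicator U x *\<^sub>R c) \<longlongrightarrow> 0) (at (0::'a::euclidean_space))"
proof -
  have [measurable]: "U \<in> sets borel" using U by simp
  define J where "J z = (\<integral>\<^sup>+x. ennreal (norm c) * (indicator U x * indicator (- U) (x + z)) \<partial>lborel)" for z :: 'a
  have eq: "L1_shift (\<lambda>x. indicator U x *\<^sub>R c) z = J z + J (- z)" for z
  proof -
    have "L1_shift (\<lambda>x. indicator U x *\<^sub>R c) z
      = (\<integral>\<^sup>+x. ennreal (norm c) * (indicator U x * indicator (- U) (x + z)) + ennreal (norm c) * (indicator U (x + z) * indicator (- U) (x + z + - z)) \<partial>lborel)"
      unfolding L1_shift_def by (intro nn_integral_cong) (auto simp: indicator_def)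
    also have "\<dots> = J z + (\<integral>\<^sup>+x. ennreal (norm c) * (indicator U (x + z) * indicator (- U) (x + z + - z)) \<partial>lborel)"
      unfolding J_def by (rule nn_integral_add) measurable
    also have "(\<integral>\<^sup>+x. ennreal (norm c) * (indicator U (x + z) * indicator (- U) (x + z + - z)) \<partial>lborel) = J (- z)"
      unfolding J_def by (rule nn_integral_lborel_shift'[of "\<lambda>x. ennreal (norm c) * (indicator U x * indicator (- U) (x + - z))"]) measurable
    finally show ?thesis .
  qed
  have J: "(J \<longlongrightarrow> 0) (at 0)"
    unfolding tendsto_at_iff_sequentially comp_def
  proof (intro allI impI)
    fix X :: "nat \<Rightarrow> 'a" assume X: "X \<longlonglongrightarrow> 0"
    have "(\<lambda>k. J (X k)) \<longlonglongrightarrow> (\<integral>\<^sup>+x. 0 \<partial>(lborel :: 'a measure))"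
      unfolding J_def
    proof (rule nn_integral_dominated_convergence[where w="\<lambda>x. ennreal (norm c) * indicator U x"])
      show "(\<integral>\<^sup>+x. ennreal (norm c) * indicator U x \<partial>lborel) < \<infinity>"
        using U by (simp add: nn_integral_cmult_indicator ennreal_mult_less_top)
      show "AE x in lborel. (\<lambda>i. ennreal (norm c) * (indicator U x * indicator (- U) (x + X i))) \<longlonglongrightarrow> 0"
      proof (rule AE_I2)
        fix x :: 'a
        have "\<forall>\<^sub>F i in sequentially. ennreal (norm c) * (indicator U x * indicator (- U) (x + X i)) = 0"
        proof (cases "x \<in> U")
          case True
          have "(\<lambda>i. x + X i) \<longlonglongrightarrow> x" using tendsto_add[OF tendsto_const X, of x] by simp
          then have "\<forall>\<^sub>F i in sequentially. x + X i \<in> U" using U(1) True by (rule topological_tendstoD)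
          then show ?thesis by eventually_elim simp
        qed simp
        then show "(\<lambda>i. ennreal (norm c) * (indicator U x * indicator (- U) (x + X i))) \<longlonglongrightarrow> 0"
          by (rule tendsto_eventually)
      qed
    qed (auto simp: indicator_def)
    then show "(\<lambda>k. J (X k)) \<longlonglongrightarrow> 0" by simp
  qed
  moreover have "filterlim uminus (at (0::'a)) (at 0)"
    using tendsto_minus[OF tendsto_ident_at, of "0::'a" UNIV]
    by (auto simp: filterlim_at eventually_at_filter)
  ultimately have "((\<lambda>z. J z + J (- z)) \<longlongrightarrow> 0 + 0) (at 0)"
    by (intro tendsto_add) (auto intro: filterlim_compose)
  moreover have "L1_shift (\<lambda>x. indicator U x *\<^sub>R c) = (\<lambda>z. J z + J (- z))"
    by (rule ext) (rule eq)
  ultimately show ?thesis by simp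
qed

text \<open>
  Outer regularity passes from open sets to measurable sets of finite measure, and integrable functions are
  limits in the mean of combinations of these.
\<close>
lemma L1_shift_tendsto:
  fixes f :: "'a::euclidean_space \<Rightarrow> complex"
  assumes "integrable lborel f"
  shows "(L1_shift f \<longlongrightarrow> 0) (at 0)"
  using assms
proof (induction rule: integrable_induct)
  case (base A c)
  then have [measurable]: "A \<in> sets borel" by simp
  show ?case
  proof (rule L1_shift_tendsto_approx)
    fix \<delta> :: real assume \<delta>: "\<delta> > 0"
    define e where "e = \<delta> / (norm c + 1)"
    have e: "e > 0" unfolding e_def using \<delta> by (intro divide_pos_pos add_nonneg_pos) auto
    obtain U where U: "open U" "A \<subseteq> U" "emeasure lborel (U - A) < ennreal e"
      using outer_regular_lborel[OF \<open>A \<in> sets borel\<close> e] by blast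
    have "emeasure lborel U \<le> emeasure lborel A + emeasure lborel (U - A)"
      using U emeasure_subadditive[of A lborel "U - A"] by (simp add: Un_absorb1)
    also have "\<dots> < \<infinity>"
      using base(2) U(3) by (auto simp: less_top[symmetric] top_unique)
    finally have "emeasure lborel U < \<infinity>" .
    have "(\<integral>\<^sup>+x. ennreal (norm (indicator A x *\<^sub>R c - indicator U x *\<^sub>R c)) \<partial>lborel) = (\<integral>\<^sup>+x. ennreal (norm c) * indicator (U - A) x \<partial>lborel)"
      using U by (intro nn_integral_cong) (auto simp: indicator_def)
    also have "\<dots> = ennreal (norm c) * emeasure lborel (U - A)"
      using U by (subst nn_integral_cmult_indicator) auto
    also have "\<dots> \<le> ennreal (norm c) * ennreal e"
      using U by (intro mult_left_mono) auto
    also have "\<dots> \<le> ennreal \<delta>"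
    proof -
      have "norm c * e \<le> \<delta>"
      proof -
        have "norm c * \<delta> \<le> \<delta> * (norm c + 1)" using \<delta> by (simp add: algebra_simps)
        moreover have "norm c + 1 > 0" by (intro add_nonneg_pos) auto
        ultimately show ?thesis by (simp add: e_def pos_divide_le_eq)
      qed
      then show ?thesis using e by (simp add: ennreal_leI flip: ennreal_mult)
    qed
    finally show "\<exists>g\<in>borel_measurable borel. (L1_shift g \<longlongrightarrow> 0) (at 0) \<and> (\<integral>\<^sup>+x. ennreal (norm (indicator A x *\<^sub>R c - g x)) \<partial>lborel) \<le> ennreal \<delta>"
      using L1_shift_indicator_open[OF U(1) \<open>emeasure lborel U < \<infinity>\<close>, of c] U(1)
      by (intro bexI[of _ "\<lambda>x. indicator U x *\<^sub>R c"] conjI) simp_all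
  qed simp
next
  case (add f g)
  then have [measurable]: "f \<in> borel_measurable borel" "g \<in> borel_measurable borel" by auto
  have "L1_shift (\<lambda>x. f x + g x) z \<le> L1_shift f z + L1_shift g z" for z
  proof -
    have "L1_shift (\<lambda>x. f x + g x) z \<le> (\<integral>\<^sup>+x. ennreal (norm (f (x + z) - f x)) + ennreal (norm (g (x + z) - g x)) \<partial>lborel)"
      unfolding L1_shift_def
    proof (intro nn_integral_mono)
      fix x
      have "norm (f (x + z) + g (x + z) - (f x + g x)) \<le> norm (f (x + z) - f x) + norm (g (x + z) - g x)"
        by (rule norm_diff_triangle_ineq)
      from ennreal_leI[OF this]
      show "ennreal (norm (f (x + z) + g (x + z) - (f x + g x))) \<le> ennreal (norm (f (x + z) - f x)) + ennreal (norm (g (x + z) - g x))"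
        by simp
    qed
    also have "\<dots> = L1_shift f z + L1_shift g z"
      unfolding L1_shift_def by (rule nn_integral_add) measurable
    finally show ?thesis .
  qed
  moreover have "((\<lambda>z. L1_shift f z + L1_shift g z) \<longlongrightarrow> 0) (at 0)"
    using tendsto_add[OF add.IH] by simp
  ultimately show ?case
    by - (rule tendsto_sandwich[where f="\<lambda>z. 0", OF always_eventually always_eventually tendsto_const], simp_all)
next
  case (lim f s)
  have [measurable]: "f \<in> borel_measurable borel" "\<And>i. s i \<in> borel_measurable borel"
    using borel_measurable_integrable[OF lim(1)] borel_measurable_integrable[OF lim(4)] by simp_all
  have L: "(\<lambda>i. \<integral>\<^sup>+x. ennreal (norm (f x - s i x)) \<partial>lborel) \<longlonglongrightarrow> 0"
  proof (rule nn_integral_dominated_convergence_norm[where w="\<lambda>x. 2 * norm (f x)"])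
    have "integrable lborel (\<lambda>x. 2 * norm (f x))" using lim(4) by simp
    then show "(\<integral>\<^sup>+x. ennreal (2 * norm (f x)) \<partial>lborel) < \<infinity>"
      by (subst nn_integral_eq_integral) auto
    show "AE x in lborel. norm (s i x) \<le> 2 * norm (f x)" for i
      by (intro AE_I2 lim(3)) simp
    show "AE x in lborel. (\<lambda>i. s i x) \<longlonglongrightarrow> f x"
      by (intro AE_I2 lim(2)) simp
  qed measurable
  show ?case
  proof (rule L1_shift_tendsto_approx)
    fix \<delta> :: real assume \<delta>: "\<delta> > 0"
    then have "\<forall>\<^sub>F i in sequentially. (\<integral>\<^sup>+x. ennreal (norm (f x - s i x)) \<partial>lborel) < ennreal \<delta>"
      by (intro order_tendstoD(2)[OF L]) simp
    then obtain i where "(\<integral>\<^sup>+x. ennreal (norm (f x - s i x)) \<partial>lborel) < ennreal \<delta>"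
      using eventually_happens by force
    then show "\<exists>g\<in>borel_measurable borel. (L1_shift g \<longlongrightarrow> 0) (at 0) \<and> (\<integral>\<^sup>+x. ennreal (norm (f x - g x)) \<partial>lborel) \<le> ennreal \<delta>"
      using lim.IH[of i] by (intro bexI[of _ "s i"] conjI less_imp_le) simp_all
  qed simp
qed

section \<open>Plancherel's identity on a hyperplane\<close>

lemma ennreal_tendsto_0_nn_integral_dominated:
  fixes u :: "nat \<Rightarrow> 'a \<Rightarrow> ennreal"
  assumes "\<And>i. u i \<in> borel_measurable M" "w \<in> borel_measurable M"
    "\<And>j. AE x in M. u j x \<le> w x" "(\<integral>\<^sup>+x. w x \<partial>M) < \<infinity>" "AE x in M. (\<lambda>i. u i x) \<longlonglongrightarrow> 0"
  shows "(\<lambda>i. \<integral>\<^sup>+x. u i x \<partial>M) \<longlonglongrightarrow> 0"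
  using nn_integral_dominated_convergence[of u M "\<lambda>_. 0" w] assms by simp

context hyperplane_orthonormal_basis
begin

lemma inner_unit: "\<omega> \<bullet> \<omega> = 1"
  using unit by (simp add: norm_eq_1)

text \<open>
  The mass does not depend on \<open>\<epsilon>\<close>, because the one-dimensional factors are
  \<open>sqrt (\<pi> / \<epsilon>) * sqrt (4 \<pi> \<epsilon>) = 2 \<pi>\<close>.
\<close>
lemma nn_integral_gauss_kernel:
  assumes \<epsilon>: "\<epsilon> > 0"
  shows "(\<integral>\<^sup>+y. ennreal (gauss_kernel \<omega> \<epsilon> (y + v)) \<partial>H) = ennreal ((2 * pi) ^ (CARD('n) - 1))"
proof -
  have p0: "perp \<omega> v \<bullet> \<omega> = 0" by (simp add: perp_def inner_diff_left inner_unit)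
  have "(\<integral>\<^sup>+y. ennreal (gauss_kernel \<omega> \<epsilon> (y + v)) \<partial>H) = (\<integral>\<^sup>+y. ennreal (gauss_kernel \<omega> \<epsilon> (y + perp \<omega> v)) \<partial>H)"
    by (simp add: gauss_kernel_def perp_def inner_add_left inner_diff_left inner_unit algebra_simps)
  also have "\<dots> = (\<integral>\<^sup>+y. ennreal (gauss_kernel \<omega> \<epsilon> y) \<partial>H)"
    by (rule nn_integral_hyperplane_translate[OF p0]) measurable
  also have "\<dots> = (\<integral>\<^sup>+y. ennreal (sqrt (pi / \<epsilon>) ^ (CARD('n) - 1)) * (\<Prod>b\<in>B. ennreal (exp (- (1 / (4 * \<epsilon>)) * (y \<bullet> b)\<^sup>2))) \<partial>H)"
    using \<epsilon> by (intro nn_integral_cong)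
      (simp add: gauss_kernel_def norm_perp prod_ennreal exp_sum fin sum_divide_distrib prod_nonneg flip: sum_negf ennreal_mult)
  also have "\<dots> = ennreal (sqrt (pi / \<epsilon>) ^ (CARD('n) - 1)) * (\<Prod>b\<in>B. \<integral>\<^sup>+s. ennreal (exp (- (1 / (4 * \<epsilon>)) * s\<^sup>2)) \<partial>lborel)"
    by (subst nn_integral_cmult) (measurable, subst nn_integral_hyperplane_prod, simp_all)
  also have "\<dots> = ennreal (sqrt (pi / \<epsilon>) ^ (CARD('n) - 1)) * ennreal (sqrt (4 * pi * \<epsilon>) ^ (CARD('n) - 1))"
    using \<epsilon> by (subst nn_integral_gaussian) (simp_all add: card_B ennreal_power mult_ac)
  also have "\<dots> = ennreal ((sqrt (pi / \<epsilon>) * sqrt (4 * pi * \<epsilon>)) ^ (CARD('n) - 1))"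
    using \<epsilon> by (simp add: power_mult_distrib ennreal_mult)
  also have "sqrt (pi / \<epsilon>) * sqrt (4 * pi * \<epsilon>) = 2 * pi"
  proof -
    have "sqrt (pi / \<epsilon>) * sqrt (4 * pi * \<epsilon>) = sqrt ((2 * pi)\<^sup>2)"
      using \<epsilon> by (simp add: power2_eq_square flip: real_sqrt_mult)
    then show ?thesis by (simp only: real_sqrt_abs) simp
  qed
  finally show ?thesis .
qed

text \<open>
  By the definition of hyperplane measure as a slab, continuity of translations on the hyperplane is
  inherited from the full space, for the function that is constant along \<open>\<omega>\<close> inside the slab.
\<close>
lemma hyperplane_L1_shift:
  assumes F: "integrable H F" and z: "z \<bullet> \<omega> = 0"
  shows "(\<integral>\<^sup>+y. ennreal (norm (F (y + z) - F y)) \<partial>H) = L1_shift (\<lambda>x. indicator {0..1} (x \<bullet> \<omega>) *\<^sub>R F (perp \<omega> x)) z"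
proof -
  have [measurable]: "F \<in> borel_measurable borel"
    using borel_measurable_integrable[OF F] by simp
  have "perp \<omega> (x + z) = x + (0 - x \<bullet> \<omega>) *\<^sub>R \<omega> + z" for x
    by (simp add: perp_def inner_add_left z)
  then show ?thesis
    unfolding L1_shift_def
    by (subst nn_integral_hyperplane_slab, simp, intro nn_integral_cong)
      (auto simp: inner_add_left z indicator_def, simp add: perp_def)
qed

lemma integrable_slab:
  assumes F: "integrable H F"
  shows "integrable lborel (\<lambda>x. indicator {0..1} (x \<bullet> \<omega>) *\<^sub>R F (perp \<omega> x) :: complex)"
proof -
  have [measurable]: "F \<in> borel_measurable borel"
    using borel_measurable_integrable[OF F] by simp
  have "(\<integral>\<^sup>+x. ennreal (norm (indicator {0..1} (x \<bullet> \<omega>) *\<^sub>R F (perp \<omega> x))) \<partial>lborel) = (\<integral>\<^sup>+y. ennreal (norm (F y)) \<partial>H)"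
    by (subst nn_integral_hyperplane_slab, simp, intro nn_integral_cong)
      (auto simp: indicator_def perp_def)
  also have "\<dots> < \<infinity>" using F by (simp add: integrable_iff_bounded)
  finally show ?thesis by (simp add: integrable_iff_bounded)
qed

lemma hyperplane_L1_shift_tendsto:
  fixes F :: "real^'n \<Rightarrow> complex"
  assumes F: "integrable H F" and X: "X \<longlonglongrightarrow> 0" "\<And>k. X k \<bullet> \<omega> = 0"
  shows "(\<lambda>k. \<integral>\<^sup>+y. ennreal (norm (F (y + X k) - F y)) \<partial>H) \<longlonglongrightarrow> 0"
proof -
  let ?G = "\<lambda>x. indicator {0..1} (x \<bullet> \<omega>) *\<^sub>R F (perp \<omega> x)"
  have "continuous (at 0) (L1_shift ?G)"
    using L1_shift_tendsto[OF integrable_slab[OF F]]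
    by (simp add: continuous_at L1_shift_def)
  then have "(\<lambda>k. L1_shift ?G (X k)) \<longlonglongrightarrow> L1_shift ?G 0"
    using X(1) by (rule isCont_tendsto_compose)
  then show ?thesis
    by (simp add: hyperplane_L1_shift[OF F X(2)]) (simp add: L1_shift_def)
qed

lemma hyperplane_L1_shift_le:
  assumes [measurable]: "F \<in> borel_measurable borel" and z: "z \<bullet> \<omega> = 0"
  shows "(\<integral>\<^sup>+y. ennreal (norm (F (y + z) - F y :: complex)) \<partial>H) \<le> 2 * (\<integral>\<^sup>+y. ennreal (norm (F y)) \<partial>H)"
proof -
  have "(\<integral>\<^sup>+y. ennreal (norm (F (y + z) - F y)) \<partial>H) \<le> (\<integral>\<^sup>+y. ennreal (norm (F (y + z))) + ennreal (norm (F y)) \<partial>H)"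
    by (intro nn_integral_mono) (simp add: ennreal_leI norm_triangle_ineq4 flip: ennreal_plus)
  also have "\<dots> = (\<integral>\<^sup>+y. ennreal (norm (F (y + z))) \<partial>H) + (\<integral>\<^sup>+y. ennreal (norm (F y)) \<partial>H)"
    by (rule nn_integral_add) measurable
  also have "(\<integral>\<^sup>+y. ennreal (norm (F (y + z))) \<partial>H) = (\<integral>\<^sup>+y. ennreal (norm (F y)) \<partial>H)"
    by (rule nn_integral_hyperplane_translate[OF z]) measurable
  finally show ?thesis by (simp add: mult_2)
qed

text \<open>
  The Gaussian kernels form an approximate identity in \<open>L\<^sup>1\<close>.  After rescaling, the double integral is the
  average of the modulus of continuity at \<open>r z\<close> against a fixed Gaussian, and it vanishes with \<open>r\<close> by dominated
  convergence.
\<close>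
lemma gauss_kernel_L1_approximation:
  fixes F :: "real^'n \<Rightarrow> complex"
  assumes F: "integrable H F"
  shows "(\<lambda>k. \<integral>\<^sup>+y. \<integral>\<^sup>+z. ennreal (gauss_kernel \<omega> (1 / (real (Suc k))\<^sup>2) (y - z) * norm (F y - F z)) \<partial>H \<partial>H) \<longlonglongrightarrow> 0"
proof -
  have [measurable]: "F \<in> borel_measurable borel"
    using borel_measurable_integrable[OF F] by simp
  interpret HH: pair_sigma_finite H H ..
  define \<tau> where "\<tau> z = (\<integral>\<^sup>+y. ennreal (norm (F (y + z) - F y)) \<partial>H)" for z
  have \<tau>m[measurable]: "\<tau> \<in> borel_measurable borel"
    unfolding \<tau>_def by measurable
  let ?d = "CARD('n) - 1"
  have eq: "(\<integral>\<^sup>+y. \<integral>\<^sup>+z. ennreal (gauss_kernel \<omega> (r\<^sup>2) (y - z) * norm (F y - F z)) \<partial>H \<partial>H)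
      = (\<integral>\<^sup>+z. ennreal (gauss_kernel \<omega> 1 z) * \<tau> (r *\<^sub>R z) \<partial>H)" if r: "r > 0" for r
  proof -
    have K0: "gauss_kernel \<omega> (r\<^sup>2) v \<ge> 0" for v using r by (simp add: gauss_kernel_nonneg)
    have "(\<integral>\<^sup>+y. \<integral>\<^sup>+z. ennreal (gauss_kernel \<omega> (r\<^sup>2) (y - z) * norm (F y - F z)) \<partial>H \<partial>H)
       = (\<integral>\<^sup>+z. \<integral>\<^sup>+y. ennreal (gauss_kernel \<omega> (r\<^sup>2) (y - z) * norm (F y - F z)) \<partial>H \<partial>H)"
      by (rule HH.Fubini'[symmetric]) measurable
    also have "\<dots> = (\<integral>\<^sup>+z. \<integral>\<^sup>+y. ennreal (gauss_kernel \<omega> (r\<^sup>2) y * norm (F (y + z) - F z)) \<partial>H \<partial>H)"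
    proof (rule nn_integral_cong_AE, use AE_hyperplane_inner[OF unit, of 0] in eventually_elim)
      case (elim z)
      show ?case
        using nn_integral_hyperplane_translate[OF elim, of "\<lambda>y. ennreal (gauss_kernel \<omega> (r\<^sup>2) (y - z) * norm (F y - F z))" 0]
        by simp
    qed
    also have "\<dots> = (\<integral>\<^sup>+y. \<integral>\<^sup>+z. ennreal (gauss_kernel \<omega> (r\<^sup>2) y * norm (F (y + z) - F z)) \<partial>H \<partial>H)"
      by (rule HH.Fubini') measurable
    also have "\<dots> = (\<integral>\<^sup>+y. ennreal (gauss_kernel \<omega> (r\<^sup>2) y) * \<tau> y \<partial>H)"
      by (simp add: \<tau>_def ennreal_mult K0 nn_integral_cmult add.commute)
    also have "\<dots> = ennreal (r ^ ?d) * (\<integral>\<^sup>+y. ennreal (gauss_kernel \<omega> (r\<^sup>2) (r *\<^sub>R y)) * \<tau> (r *\<^sub>R y) \<partial>H)"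
      by (rule nn_integral_hyperplane_scale[OF unit r, symmetric]) measurable
    also have "\<dots> = (\<integral>\<^sup>+y. ennreal (r ^ ?d) * (ennreal (gauss_kernel \<omega> (r\<^sup>2) (r *\<^sub>R y)) * \<tau> (r *\<^sub>R y)) \<partial>H)"
      by (rule nn_integral_cmult[symmetric]) measurable
    also have "\<dots> = (\<integral>\<^sup>+z. ennreal (gauss_kernel \<omega> 1 z) * \<tau> (r *\<^sub>R z) \<partial>H)"
    proof (rule nn_integral_cong)
      fix y
      have "norm (perp \<omega> (r *\<^sub>R y)) = r * norm (perp \<omega> y)"
      proof -
        have "perp \<omega> (r *\<^sub>R y) = r *\<^sub>R perp \<omega> y" by (simp add: perp_def scaleR_diff_right)
        then show ?thesis using r by simp
      qed
      then have "r ^ ?d * gauss_kernel \<omega> (r\<^sup>2) (r *\<^sub>R y) = gauss_kernel \<omega> 1 y"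
        using r by (simp add: gauss_kernel_def real_sqrt_divide power_divide power_mult_distrib)
      then show "ennreal (r ^ ?d) * (ennreal (gauss_kernel \<omega> (r\<^sup>2) (r *\<^sub>R y)) * \<tau> (r *\<^sub>R y)) = ennreal (gauss_kernel \<omega> 1 y) * \<tau> (r *\<^sub>R y)"
        using r K0 by (metis ennreal_mult' mult.assoc zero_le_power less_imp_le)
    qed
    finally show ?thesis .
  qed
  have "(\<lambda>k. \<integral>\<^sup>+z. ennreal (gauss_kernel \<omega> 1 z) * \<tau> ((1 / real (Suc k)) *\<^sub>R z) \<partial>H) \<longlonglongrightarrow> 0"
  proof (rule ennreal_tendsto_0_nn_integral_dominated)
    let ?c = "2 * (\<integral>\<^sup>+y. ennreal (norm (F y)) \<partial>H)"
    show "AE z in H. ennreal (gauss_kernel \<omega> 1 z) * \<tau> ((1 / real (Suc k)) *\<^sub>R z) \<le> ennreal (gauss_kernel \<omega> 1 z) * ?c" for k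
      using AE_hyperplane_inner[OF unit, of 0]
    proof eventually_elim
      case (elim z)
      then show ?case unfolding \<tau>_def by (intro mult_left_mono hyperplane_L1_shift_le) simp_all
    qed
    have "(\<integral>\<^sup>+z. ennreal (gauss_kernel \<omega> 1 z) \<partial>H) < \<infinity>"
      using nn_integral_gauss_kernel[of 1 0] by simp
    moreover have "?c < \<infinity>"
      using F by (simp add: integrable_iff_bounded ennreal_mult_less_top)
    ultimately show "(\<integral>\<^sup>+z. ennreal (gauss_kernel \<omega> 1 z) * ?c \<partial>H) < \<infinity>"
      by (subst nn_integral_multc) (auto simp: ennreal_mult_less_top)
    show "AE z in H. (\<lambda>k. ennreal (gauss_kernel \<omega> 1 z) * \<tau> ((1 / real (Suc k)) *\<^sub>R z)) \<longlonglongrightarrow> 0"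
      using AE_hyperplane_inner[OF unit, of 0]
    proof eventually_elim
      case (elim z)
      have "(\<lambda>k. (1 / real (Suc k)) *\<^sub>R z) \<longlonglongrightarrow> 0 *\<^sub>R z"
        by (intro tendsto_scaleR tendsto_const) (use LIMSEQ_Suc[OF lim_1_over_n] in simp)
      then have "(\<lambda>k. \<tau> ((1 / real (Suc k)) *\<^sub>R z)) \<longlonglongrightarrow> 0"
        unfolding \<tau>_def by (intro hyperplane_L1_shift_tendsto[OF F]) (simp_all add: elim)
      from ennreal_tendsto_cmult[OF _ this, of "ennreal (gauss_kernel \<omega> 1 z)"] show ?case by simp
    qed
  qed measurable
  then show ?thesis
    using eq[of "1 / real (Suc k)" for k] by (simp add: power_divide)
qed

text \<open>
  Monotone convergence as \<open>\<epsilon>\<close> decreases to 0 removes the Gaussian weight.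
\<close>
lemma nn_integral_gaussian_weight_le:
  assumes g[measurable]: "g \<in> borel_measurable borel"
    and C: "\<And>\<epsilon>. \<epsilon> > 0 \<Longrightarrow> (\<integral>\<^sup>+y. ennreal (exp (- \<epsilon> * (norm y)\<^sup>2) * (g y)\<^sup>2) \<partial>H) \<le> C"
  shows "(\<integral>\<^sup>+y. ennreal ((g y)\<^sup>2) \<partial>H) \<le> C"
proof -
  define e where "e k = 1 / real (Suc k)" for k
  have e: "e k > 0" "e (Suc k) \<le> e k" for k by (auto simp: e_def frac_le)
  have e0: "e \<longlonglongrightarrow> 0"
    unfolding e_def using LIMSEQ_Suc[OF lim_1_over_n] by simp
  let ?u = "\<lambda>k y. ennreal (exp (- e k * (norm y)\<^sup>2) * (g y)\<^sup>2)"
  have inc: "incseq ?u"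
    by (intro incseq_SucI le_funI ennreal_leI mult_right_mono) (auto intro!: mult_right_mono e)
  have "(SUP k. ?u k y) = ennreal ((g y)\<^sup>2)" for y
  proof (rule LIMSEQ_unique[OF LIMSEQ_SUP])
    show "incseq (\<lambda>k. ?u k y)" using inc by (auto simp: incseq_def le_fun_def)
    have "(\<lambda>k. exp (- e k * (norm y)\<^sup>2) * (g y)\<^sup>2) \<longlonglongrightarrow> exp (- 0 * (norm y)\<^sup>2) * (g y)\<^sup>2"
      by (intro tendsto_intros e0)
    then show "(\<lambda>k. ?u k y) \<longlonglongrightarrow> ennreal ((g y)\<^sup>2)"
      by (intro tendsto_ennrealI) simp
  qed
  then have "(\<integral>\<^sup>+y. ennreal ((g y)\<^sup>2) \<partial>H) = (\<integral>\<^sup>+y. (SUP k. ?u k y) \<partial>H)"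
    by simp
  also have "\<dots> = (SUP k. \<integral>\<^sup>+y. ?u k y \<partial>H)"
    by (rule nn_integral_monotone_convergence_SUP[OF inc]) measurable
  also have "\<dots> \<le> C"
    by (intro SUP_least C e)
  finally show ?thesis .
qed

lemma gaussian_fourier_le:
  assumes F: "integrable H F" and \<epsilon>: "\<epsilon> > 0"
  shows "(\<integral>\<^sup>+y. ennreal (exp (- \<epsilon> * (norm y)\<^sup>2) * (norm (fourier H F y))\<^sup>2) \<partial>H)
    \<le> ennreal ((2 * pi) ^ (CARD('n) - 1)) * (\<integral>\<^sup>+y. ennreal ((norm (F y))\<^sup>2) \<partial>H)"
proof -
  have "(\<integral>\<^sup>+\<eta>. ennreal (gauss_kernel \<omega> \<epsilon> (\<xi> - \<eta>)) \<partial>H) = ennreal ((2 * pi) ^ (CARD('n) - 1))" for \<xi>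
    unfolding gauss_kernel_minus[of \<omega> \<epsilon> \<xi>] using nn_integral_gauss_kernel[OF \<epsilon>, of "- \<xi>"] by simp
  then show ?thesis
    using gaussian_schur_test[OF H.sigma_finite_measure_axioms sets_hyperplane_measure F \<epsilon>, of "\<lambda>_. 1"]
    by simp
qed

text \<open>
  The upper bound is Schur's test with constant weight.  For the lower bound let \<open>h\<close> be \<open>F\<close> truncated to the
  values of norm at most \<open>N\<close>, which is square integrable.  From \<open>2 Re (a cnj b) - |b|\<^sup>2 \<le> |a|\<^sup>2\<close>, the weighted
  square integral of the transform of \<open>F\<close> is at least \<open>2 Re\<close> of the bilinear form in \<open>F\<close> and \<open>h\<close> minus the form in \<open>h\<close>;
  the first tends to \<open>2 (2\<pi>)\<^sup>d \<parallel>h\<parallel>\<^sup>2\<close> and the second is at most \<open>(2\<pi>)\<^sup>d \<parallel>h\<parallel>\<^sup>2\<close>.  Then \<open>N\<close> tends to infinity.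
  If \<open>F\<close> is not square integrable, this shows that its transform is not either.
\<close>
theorem plancherel_hyperplane:
  assumes F: "integrable H F"
  shows "(\<integral>\<^sup>+y. ennreal ((norm (fourier H F y))\<^sup>2) \<partial>H)
    = ennreal ((2 * pi) ^ (CARD('n) - 1)) * (\<integral>\<^sup>+y. ennreal ((norm (F y))\<^sup>2) \<partial>H)" (is "?M = ennreal ?c * _")
proof (rule antisym)
  have Fm[measurable]: "F \<in> borel_measurable borel"
    using borel_measurable_integrable[OF F] by simp
  have fm[measurable]: "fourier H g \<in> borel_measurable borel" if "g \<in> borel_measurable borel" for g
    using that by (intro borel_measurable_fourier H.sigma_finite_measure_axioms) simp_all
  show "?M \<le> ennreal ?c * (\<integral>\<^sup>+y. ennreal ((norm (F y))\<^sup>2) \<partial>H)"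
    by (rule nn_integral_gaussian_weight_le[OF _ gaussian_fourier_le[OF F]]) measurable
  interpret HH: pair_sigma_finite H H ..
  have trunc: "ennreal ?c * (\<integral>\<^sup>+y. ennreal ((norm (if norm (F y) \<le> N then F y else 0))\<^sup>2) \<partial>H) \<le> ?M" for N :: real
  proof (cases "?M = \<infinity>")
    case False
    \<comment> \<open>The truncation is chosen so that \<open>F y * cnj (h y) = |h y|\<^sup>2\<close>.\<close>
    define h where "h y = (if norm (F y) \<le> N then F y else 0)" for y
    have hm[measurable]: "h \<in> borel_measurable borel" unfolding h_def by measurable
    have hF: "norm (h y) \<le> norm (F y)" "norm (h y) \<le> max N 0" "F y * cnj (h y) = complex_of_real ((norm (h y))\<^sup>2)" for y
      by (auto simp: h_def complex_norm_square simp del: of_real_power)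
    have h: "integrable H h"
      by (rule Bochner_Integration.integrable_bound[OF F]) (auto simp: hF)
    have h2: "integrable H (\<lambda>y. (norm (h y))\<^sup>2)"
      by (rule Bochner_Integration.integrable_bound[OF integrable_mult_right[OF integrable_norm[OF F], of "max N 0"]])
        (auto simp: power2_eq_square hF intro!: mult_mono)
    define S where "S = (LINT y|H. (norm (h y))\<^sup>2)"
    have S: "(\<integral>\<^sup>+y. ennreal ((norm (h y))\<^sup>2) \<partial>H) = ennreal S" "S \<ge> 0"
      unfolding S_def by (subst nn_integral_eq_integral[OF h2]) auto
    obtain m where m: "?M = ennreal m" "m \<ge> 0" using False by (cases ?M) auto
    define B where "B \<epsilon> = (LINT y|H. exp (- \<epsilon> * (norm y)\<^sup>2) *\<^sub>R (fourier H F y * cnj (fourier H h y)))" for \<epsilon>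
    note sH = H.sigma_finite_measure_axioms sets_hyperplane_measure
    have sq: "integrable H (\<lambda>y. exp (- \<epsilon> * (norm y)\<^sup>2) * (norm (fourier H g y))\<^sup>2)" if "integrable H g" "\<epsilon> > 0" for g \<epsilon>
      using integrable_norm[OF integrable_gaussian_fourier[OF sH that(1) that]]
      by (simp add: norm_mult power2_eq_square)
    have lower: "2 * Re (B \<epsilon>) - ?c * S \<le> m" if \<epsilon>: "\<epsilon> > 0" for \<epsilon>
    proof -
      let ?w = "\<lambda>y::real^'n. exp (- \<epsilon> * (norm y)\<^sup>2)"
      have iB: "integrable H (\<lambda>y. Re (?w y *\<^sub>R (fourier H F y * cnj (fourier H h y))))"
        by (intro integrable_Re integrable_gaussian_fourier[OF sH F h \<epsilon>])
      have "2 * Re (B \<epsilon>) = (LINT y|H. 2 * Re (?w y *\<^sub>R (fourier H F y * cnj (fourier H h y))))"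
        unfolding B_def using integral_Re[OF integrable_gaussian_fourier[OF sH F h \<epsilon>]] by simp
      also have "\<dots> \<le> (LINT y|H. ?w y * (norm (fourier H F y))\<^sup>2 + ?w y * (norm (fourier H h y))\<^sup>2)"
      proof (intro integral_mono Bochner_Integration.integrable_add sq F h \<epsilon> integrable_mult_right iB)
        fix y
        have "2 * Re (a * cnj b) \<le> (norm a)\<^sup>2 + (norm b)\<^sup>2" for a b :: complex
          using zero_le_power2[of "norm (a - b)"] unfolding cmod_power2 by (simp add: power2_eq_square algebra_simps)
        from mult_left_mono[OF this[of "fourier H F y" "fourier H h y"], of "?w y"]
        show "2 * Re (?w y *\<^sub>R (fourier H F y * cnj (fourier H h y))) \<le> ?w y * (norm (fourier H F y))\<^sup>2 + ?w y * (norm (fourier H h y))\<^sup>2"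
          by (simp add: distrib_left mult.left_commute del: mult_minus_left)
      qed
      also have "\<dots> = (LINT y|H. ?w y * (norm (fourier H F y))\<^sup>2) + (LINT y|H. ?w y * (norm (fourier H h y))\<^sup>2)"
        by (intro Bochner_Integration.integral_add sq F h \<epsilon>)
      also have "(LINT y|H. ?w y * (norm (fourier H F y))\<^sup>2) \<le> m"
      proof -
        have "ennreal (LINT y|H. ?w y * (norm (fourier H F y))\<^sup>2) = (\<integral>\<^sup>+y. ennreal (?w y * (norm (fourier H F y))\<^sup>2) \<partial>H)"
          by (rule nn_integral_eq_integral[symmetric, OF sq[OF F \<epsilon>]]) simp
        also have "\<dots> \<le> ennreal m"
          unfolding m(1)[symmetric] using \<epsilon> by (intro nn_integral_mono ennreal_leI mult_left_le_one_le) auto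
        finally show ?thesis using m(2) by simp
      qed
      also have "(LINT y|H. ?w y * (norm (fourier H h y))\<^sup>2) \<le> ?c * S"
      proof -
        have "ennreal (LINT y|H. ?w y * (norm (fourier H h y))\<^sup>2) = (\<integral>\<^sup>+y. ennreal (?w y * (norm (fourier H h y))\<^sup>2) \<partial>H)"
          by (rule nn_integral_eq_integral[symmetric, OF sq[OF h \<epsilon>]]) simp
        also have "\<dots> \<le> ennreal ?c * ennreal S"
          using gaussian_fourier_le[OF h \<epsilon>] by (simp only: S)
        also have "\<dots> = ennreal (?c * S)" by (simp add: ennreal_mult S)
        finally show ?thesis using S(2) by simp
      qed
      finally show ?thesis by simp
    qed
    define \<epsilon> where "\<epsilon> k = 1 / (real (Suc k))\<^sup>2" for k
    have \<epsilon>: "\<epsilon> k > 0" for k by (simp add: \<epsilon>_def)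
    \<comment> \<open>The kernel has mass \<open>?c\<close>, so \<open>?c * S\<close> is the form with \<open>F \<xi>\<close> replaced by \<open>F \<eta>\<close>.\<close>
    have bound: "ennreal (norm (B (\<epsilon> k) - complex_of_real (?c * S)))
        \<le> ennreal (max N 0) * (\<integral>\<^sup>+\<xi>. \<integral>\<^sup>+\<eta>. ennreal (gauss_kernel \<omega> (\<epsilon> k) (\<xi> - \<eta>) * norm (F \<xi> - F \<eta>)) \<partial>H \<partial>H)" for k
    proof -
      let ?K = "gauss_kernel \<omega> (\<epsilon> k)"
      have K0: "?K v \<ge> 0" for v by (rule gauss_kernel_nonneg[OF \<epsilon>])
      have "(\<integral>\<^sup>+(\<xi>, \<eta>). ennreal (?K (\<xi> - \<eta>) * (norm (h \<eta>))\<^sup>2) \<partial>(H \<Otimes>\<^sub>M H))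
          = (\<integral>\<^sup>+\<eta>. \<integral>\<^sup>+\<xi>. ennreal (?K (\<xi> - \<eta>)) * ennreal ((norm (h \<eta>))\<^sup>2) \<partial>H \<partial>H)"
        by (subst HH.nn_integral_snd[symmetric]) (auto simp: ennreal_mult K0)
      also have "\<dots> = (\<integral>\<^sup>+\<eta>. ennreal ?c * ennreal ((norm (h \<eta>))\<^sup>2) \<partial>H)"
      proof (rule nn_integral_cong)
        fix \<eta>
        show "(\<integral>\<^sup>+\<xi>. ennreal (?K (\<xi> - \<eta>)) * ennreal ((norm (h \<eta>))\<^sup>2) \<partial>H) = ennreal ?c * ennreal ((norm (h \<eta>))\<^sup>2)"
          using nn_integral_gauss_kernel[OF \<epsilon>, of k "- \<eta>"] by (subst nn_integral_multc) simp_all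
      qed
      also have "\<dots> = ennreal (?c * S)"
        by (subst nn_integral_cmult) (simp_all add: S(1) ennreal_mult S(2))
      finally have diag: "(\<integral>\<^sup>+(\<xi>, \<eta>). ennreal (?K (\<xi> - \<eta>) * (norm (h \<eta>))\<^sup>2) \<partial>(H \<Otimes>\<^sub>M H)) = ennreal (?c * S)" .
      have "integrable (H \<Otimes>\<^sub>M H) (\<lambda>(\<xi>, \<eta>). ?K (\<xi> - \<eta>) * (norm (h \<eta>))\<^sup>2)
          \<and> (LINT (\<xi>, \<eta>)|(H \<Otimes>\<^sub>M H). ?K (\<xi> - \<eta>) * (norm (h \<eta>))\<^sup>2) = ?c * S"
        by (subst nn_integral_eq_integrable[symmetric]) (use diag S(2) in \<open>auto simp: K0 split_beta'\<close>)
      then have idiag: "integrable (H \<Otimes>\<^sub>M H) (\<lambda>p. complex_of_real (case p of (\<xi>, \<eta>) \<Rightarrow> ?K (\<xi> - \<eta>) * (norm (h \<eta>))\<^sup>2))"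
        and vdiag: "(LINT p|(H \<Otimes>\<^sub>M H). complex_of_real (case p of (\<xi>, \<eta>) \<Rightarrow> ?K (\<xi> - \<eta>) * (norm (h \<eta>))\<^sup>2)) = complex_of_real (?c * S)"
        by (auto intro!: integrable_of_real simp only: integral_complex_of_real)
      have ioff: "integrable (H \<Otimes>\<^sub>M H) (\<lambda>(\<xi>, \<eta>). ?K (\<xi> - \<eta>) *\<^sub>R (F \<xi> * cnj (h \<eta>)))"
        by (rule integrable_gauss_kernel_form[OF sH F h \<epsilon>])
      let ?D = "\<lambda>p. (case p of (\<xi>, \<eta>) \<Rightarrow> ?K (\<xi> - \<eta>) *\<^sub>R (F \<xi> * cnj (h \<eta>)))
           - complex_of_real (case p of (\<xi>, \<eta>) \<Rightarrow> ?K (\<xi> - \<eta>) * (norm (h \<eta>))\<^sup>2)"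
      have "B (\<epsilon> k) - complex_of_real (?c * S) = (LINT p|(H \<Otimes>\<^sub>M H). ?D p)"
        unfolding B_def gaussian_fourier_form[OF sH F h \<epsilon>] vdiag[symmetric]
        by (rule Bochner_Integration.integral_diff[OF ioff idiag, symmetric])
      then have "ennreal (norm (B (\<epsilon> k) - complex_of_real (?c * S))) \<le> (\<integral>\<^sup>+p. ennreal (norm (?D p)) \<partial>(H \<Otimes>\<^sub>M H))"
        by (simp only: integral_norm_bound_ennreal[OF Bochner_Integration.integrable_diff[OF ioff idiag]])
      also have "\<dots> \<le> (\<integral>\<^sup>+(\<xi>, \<eta>). ennreal (max N 0) * ennreal (?K (\<xi> - \<eta>) * norm (F \<xi> - F \<eta>)) \<partial>(H \<Otimes>\<^sub>M H))"
      proof (rule nn_integral_mono)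
        fix p :: "(real^'n) \<times> (real^'n)"
        obtain \<xi> \<eta> where p: "p = (\<xi>, \<eta>)" by (cases p)
        have "?D (\<xi>, \<eta>) = ?K (\<xi> - \<eta>) *\<^sub>R ((F \<xi> - F \<eta>) * cnj (h \<eta>))"
          using hF(3)[of \<eta>] by (simp add: scaleR_conv_of_real algebra_simps)
        then have "norm (?D (\<xi>, \<eta>)) = ?K (\<xi> - \<eta>) * norm (F \<xi> - F \<eta>) * norm (h \<eta>)"
          by (simp add: norm_mult K0 del: case_prod_conv)
        also have "\<dots> \<le> ?K (\<xi> - \<eta>) * norm (F \<xi> - F \<eta>) * max N 0"
          by (intro mult_left_mono hF mult_nonneg_nonneg K0) simp
        finally have "ennreal (norm (?D (\<xi>, \<eta>))) \<le> ennreal (max N 0 * (?K (\<xi> - \<eta>) * norm (F \<xi> - F \<eta>)))"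
          by (intro ennreal_leI) (simp only: mult_ac)
        then show "ennreal (norm (?D p)) \<le> (case p of (\<xi>, \<eta>) \<Rightarrow> ennreal (max N 0) * ennreal (?K (\<xi> - \<eta>) * norm (F \<xi> - F \<eta>)))"
          by (simp only: p prod.case ennreal_mult'[of "max N 0"] max.cobounded2)
      qed
      also have "\<dots> = (\<integral>\<^sup>+\<xi>. \<integral>\<^sup>+\<eta>. ennreal (max N 0) * ennreal (?K (\<xi> - \<eta>) * norm (F \<xi> - F \<eta>)) \<partial>H \<partial>H)"
        by (subst H.nn_integral_fst[symmetric]) auto
      also have "\<dots> = ennreal (max N 0) * (\<integral>\<^sup>+\<xi>. \<integral>\<^sup>+\<eta>. ennreal (?K (\<xi> - \<eta>) * norm (F \<xi> - F \<eta>)) \<partial>H \<partial>H)"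
        by (simp add: nn_integral_cmult)
      finally show ?thesis .
    qed
    have "(\<lambda>k. ennreal (max N 0) * (\<integral>\<^sup>+\<xi>. \<integral>\<^sup>+\<eta>. ennreal (gauss_kernel \<omega> (\<epsilon> k) (\<xi> - \<eta>) * norm (F \<xi> - F \<eta>)) \<partial>H \<partial>H)) \<longlonglongrightarrow> ennreal (max N 0) * 0"
      unfolding \<epsilon>_def by (intro ennreal_tendsto_cmult gauss_kernel_L1_approximation[OF F]) simp
    then have lim: "(\<lambda>k. ennreal (max N 0) * (\<integral>\<^sup>+\<xi>. \<integral>\<^sup>+\<eta>. ennreal (gauss_kernel \<omega> (\<epsilon> k) (\<xi> - \<eta>) * norm (F \<xi> - F \<eta>)) \<partial>H \<partial>H)) \<longlonglongrightarrow> 0"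
      by (simp only: mult_zero_right)
    have "(\<lambda>k. ennreal (norm (B (\<epsilon> k) - complex_of_real (?c * S)))) \<longlonglongrightarrow> 0"
    proof (rule tendsto_sandwich[OF _ _ tendsto_const lim])
      show "\<forall>\<^sub>F k in sequentially. ennreal (norm (B (\<epsilon> k) - complex_of_real (?c * S)))
          \<le> ennreal (max N 0) * (\<integral>\<^sup>+\<xi>. \<integral>\<^sup>+\<eta>. ennreal (gauss_kernel \<omega> (\<epsilon> k) (\<xi> - \<eta>) * norm (F \<xi> - F \<eta>)) \<partial>H \<partial>H)"
        by (intro always_eventually allI bound)
    qed simp
    then have "(\<lambda>k. B (\<epsilon> k) - complex_of_real (?c * S)) \<longlonglongrightarrow> 0"
      by (simp add: tendsto_ennreal_iff tendsto_norm_zero_iff flip: ennreal_0)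
    then have "(\<lambda>k. B (\<epsilon> k)) \<longlonglongrightarrow> complex_of_real (?c * S)"
      by (rule LIM_zero_cancel)
    from tendsto_Re[OF this] have "(\<lambda>k. 2 * Re (B (\<epsilon> k)) - ?c * S) \<longlonglongrightarrow> 2 * (?c * S) - ?c * S"
      by (intro tendsto_intros) simp
    then have "2 * (?c * S) - ?c * S \<le> m"
      by (rule LIMSEQ_le_const2) (use lower[OF \<epsilon>] in blast)
    then have "?c * S \<le> m" by (simp only: mult_2 add_diff_cancel_right')
    then have "ennreal ?c * ennreal S \<le> ennreal m"
      by (simp add: ennreal_leI S(2) flip: ennreal_mult)
    then show ?thesis unfolding m S(1)[symmetric] h_def .
  qed simp
  have "(SUP k. ennreal ((norm (if norm (F y) \<le> real k then F y else 0))\<^sup>2)) = ennreal ((norm (F y))\<^sup>2)" for y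
  proof (rule antisym)
    show "(SUP k. ennreal ((norm (if norm (F y) \<le> real k then F y else 0))\<^sup>2)) \<le> ennreal ((norm (F y))\<^sup>2)"
      by (intro SUP_least ennreal_leI) auto
    obtain k :: nat where "norm (F y) \<le> real k" using real_arch_simple by blast
    then show "ennreal ((norm (F y))\<^sup>2) \<le> (SUP k. ennreal ((norm (if norm (F y) \<le> real k then F y else 0))\<^sup>2))"
      by (intro SUP_upper2[of k]) auto
  qed
  then have "(\<integral>\<^sup>+y. ennreal ((norm (F y))\<^sup>2) \<partial>H)
      = (\<integral>\<^sup>+y. (SUP k. ennreal ((norm (if norm (F y) \<le> real k then F y else 0))\<^sup>2)) \<partial>H)"
    by simp
  also have "\<dots> = (SUP k. \<integral>\<^sup>+y. ennreal ((norm (if norm (F y) \<le> real k then F y else 0))\<^sup>2) \<partial>H)"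
    by (rule nn_integral_monotone_convergence_SUP) (auto simp: incseq_def le_fun_def)
  finally show "ennreal ?c * (\<integral>\<^sup>+y. ennreal ((norm (F y))\<^sup>2) \<partial>H) \<le> ?M"
    using trunc by (auto simp: SUP_mult_left_ennreal intro: SUP_least)
qed

end

section \<open>The sphere as a graph and as a cone\<close>

lemma sets_sphere_measure: "sets (sphere_measure :: (real^'n) measure) = sets (restrict_space borel (sphere 0 1))"
  by (simp add: sphere_measure_def)

lemma space_sphere_measure: "space (sphere_measure :: (real^'n) measure) = sphere 0 1"
  by (simp add: sphere_measure_def space_scale_measure space_restrict_space)

lemma measurable_sphere_measure:
  assumes "f \<in> borel \<rightarrow>\<^sub>M M" shows "f \<in> sphere_measure \<rightarrow>\<^sub>M M"
  using measurable_restrict_space1[OF assms] by (simp cong: measurable_cong_sets add: sets_sphere_measure)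

lemma nn_integral_sphere:
  fixes f :: "real^'n \<Rightarrow> ennreal"
  assumes [measurable]: "f \<in> borel_measurable borel"
  shows "(\<integral>\<^sup>+\<xi>. f \<xi> \<partial>sphere_measure)
    = of_nat CARD('n) * (\<integral>\<^sup>+x. f (x /\<^sub>R norm x) * indicator (cball 0 1 - {0}) x \<partial>lborel)"
proof -
  let ?D = "cball 0 1 - {0} :: (real^'n) set"
  have m: "(\<lambda>x. x /\<^sub>R norm x) \<in> measurable (restrict_space lborel ?D) (restrict_space borel (sphere 0 1))"
    by (rule measurable_restrict_space2) (auto simp: space_restrict_space intro!: measurable_restrict_space1)
  have "(\<integral>\<^sup>+\<xi>. f \<xi> \<partial>sphere_measure)
      = of_nat CARD('n) * (\<integral>\<^sup>+\<xi>. f \<xi> \<partial>distr (restrict_space lborel ?D) (restrict_space borel (sphere 0 1)) (\<lambda>x. x /\<^sub>R norm x))"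
    unfolding sphere_measure_def
    by (rule nn_integral_scale_measure) (simp add: measurable_distr_eq1 measurable_restrict_space1)
  also have "\<dots> = of_nat CARD('n) * (\<integral>\<^sup>+x. f (x /\<^sub>R norm x) \<partial>restrict_space lborel ?D)"
    by (subst nn_integral_distr[OF m]) (simp_all add: measurable_restrict_space1)
  finally show ?thesis by (simp add: nn_integral_restrict_space)
qed

lemma nn_integral_power_Icc:
  assumes "a \<ge> 0"
  shows "of_nat (Suc d) * (\<integral>\<^sup>+s. ennreal (s ^ d) * indicator {0..a} s \<partial>lborel) = ennreal (a ^ Suc d)"
proof -
  have "(\<integral>\<^sup>+s. ennreal (s ^ d) * indicator {0..a} s \<partial>lborel) = ennreal (a ^ Suc d / real (Suc d) - 0 ^ Suc d / real (Suc d))"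
    using assms
    by (intro nn_integral_FTC_Icc) (auto intro!: derivative_eq_intros simp del: power_Suc)
  then show ?thesis
    using assms by (simp add: ennreal_of_nat_eq_real_of_nat del: of_nat_Suc flip: ennreal_mult)
qed

lemma nn_integral_sphere_uminus:
  fixes f :: "real^'n \<Rightarrow> ennreal"
  assumes [measurable]: "f \<in> borel_measurable borel"
  shows "(\<integral>\<^sup>+\<xi>. f (- \<xi>) \<partial>sphere_measure) = (\<integral>\<^sup>+\<xi>. f \<xi> \<partial>sphere_measure)"
proof -
  let ?g = "\<lambda>x. f (x /\<^sub>R norm x) * indicator (cball 0 1 - {0}) x"
  have [measurable]: "cball (0::real^'n) 1 - {0} \<in> sets borel" by simp
  have "(\<integral>\<^sup>+x. ?g x \<partial>lborel) = (\<integral>\<^sup>+x. ?g x \<partial>distr lborel borel uminus)"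
    by (subst lborel_orthogonal) (simp_all add: orthogonal_transformation_def linear_uminus)
  also have "\<dots> = (\<integral>\<^sup>+x. ?g (- x) \<partial>lborel)"
    by (rule nn_integral_distr) simp_all
  finally show ?thesis
    by (simp add: nn_integral_sphere indicator_def cong: nn_integral_cong)
qed

lemma finite_sphere_measure: "finite_measure (sphere_measure :: (real^'n) measure)"
proof
  have "emeasure (sphere_measure :: (real^'n) measure) (space sphere_measure) = (\<integral>\<^sup>+\<xi>. 1 \<partial>(sphere_measure :: (real^'n) measure))"
    by simp
  also have "\<dots> \<le> of_nat CARD('n) * (\<integral>\<^sup>+x. indicator (cball 0 1) (x::real^'n) \<partial>lborel)"
    unfolding nn_integral_sphere[OF borel_measurable_const]
    by (intro mult_left_mono nn_integral_mono) (auto simp: indicator_def)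
  also have "\<dots> < \<infinity>"
    using emeasure_bounded_finite[of "cball (0::real^'n) 1"] by (simp add: ennreal_mult_less_top of_nat_less_top)
  finally show "emeasure (sphere_measure :: (real^'n) measure) (space sphere_measure) \<noteq> \<infinity>" by simp
qed

text \<open>
  For a fixed hyperplane component of norm \<open>c\<close>, pass from the height \<open>s\<close> to the radius
  \<open>r = sqrt (c\<^sup>2 + s\<^sup>2)\<close>; the height of a point in the unit ball runs up to \<open>sqrt (1 - c\<^sup>2)\<close>.
\<close>
lemma nn_integral_radius_substitution:
  fixes h :: "real \<Rightarrow> ennreal"
  assumes [measurable]: "h \<in> borel_measurable borel" and c: "0 < c" "c \<le> 1"
  shows "(\<integral>\<^sup>+s. h (sqrt (c\<^sup>2 + s\<^sup>2)) * ennreal (s / sqrt (c\<^sup>2 + s\<^sup>2)) * indicator {0..sqrt (1 - c\<^sup>2)} s \<partial>lborel)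
    = (\<integral>\<^sup>+r. h r * indicator {c..1} r \<partial>lborel)"
proof -
  let ?g = "\<lambda>s. sqrt (c\<^sup>2 + s\<^sup>2)"
  have pos: "c\<^sup>2 + s\<^sup>2 > 0" for s using c by (intro add_pos_nonneg) auto
  have c1: "c\<^sup>2 \<le> 1" using c by (simp add: power_le_one)
  show ?thesis
  proof (cases "c = 1")
    case True
    have "AE s in lborel. s \<noteq> (0::real)" "AE s in lborel. s \<noteq> (1::real)" by (auto intro: AE_lborel_singleton)
    then have "(\<integral>\<^sup>+s. h (?g s) * ennreal (s / ?g s) * indicator {0..0} s \<partial>lborel) = 0"
      "(\<integral>\<^sup>+r. h r * indicator {1..1} r \<partial>lborel) = 0"
      by (auto simp: nn_integral_0_iff_AE indicator_def elim: eventually_mono)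
    then show ?thesis using True by simp
  next
    case False
    then have c2: "c\<^sup>2 < 1" using c by (simp add: power_less_one_iff)
    have "(\<integral>\<^sup>+r. h r * indicator {?g 0..?g (sqrt (1 - c\<^sup>2))} r \<partial>lborel)
        = (\<integral>\<^sup>+s. h (?g s) * ennreal (s / ?g s) * indicator {0..sqrt (1 - c\<^sup>2)} s \<partial>lborel)"
    proof (rule nn_integral_substitution_aux)
      show "(?g has_real_derivative s / ?g s) (at s)" for s
        using pos[of s] by (auto intro!: derivative_eq_intros simp: field_simps)
      show "continuous_on {0..sqrt (1 - c\<^sup>2)} (\<lambda>s. s / ?g s)"
        using pos by (intro continuous_intros) (metis less_irrefl real_sqrt_eq_zero_cancel_iff)
    qed (use c2 in auto)
    then show ?thesis using c c1 by simp
  qed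
qed

text \<open>
  Vertical projection.  Surface measure is defined through the solid unit ball; for a fixed \<open>y\<close> in the
  hyperplane, the factor \<open>\<xi> \<bullet> \<omega> = s / r\<close> is exactly the derivative of the radius with respect to the height \<open>s\<close>,
  so that integration over \<open>s\<close> becomes integration over \<open>r\<close>.  Rescaling \<open>y\<close> by \<open>r\<close> then separates the radius,
  and \<open>n \<integral> r ^ (n - 1) dr = 1\<close>.  The lower hemisphere drops out because \<open>ennreal\<close> sends negative reals to 0.
\<close>
lemma nn_integral_sphere_graph:
  fixes \<omega> :: "real^'n" and f :: "real^'n \<Rightarrow> ennreal"
  assumes \<omega>: "norm \<omega> = 1" and [measurable]: "f \<in> borel_measurable borel"
  shows "(\<integral>\<^sup>+\<xi>. f \<xi> * ennreal (\<xi> \<bullet> \<omega>) \<partial>sphere_measure)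
    = (\<integral>\<^sup>+y. f (y + sqrt (1 - (norm y)\<^sup>2) *\<^sub>R \<omega>) * indicator (cball 0 1) y \<partial>hyperplane_measure \<omega> 0)"
proof -
  let ?H = "hyperplane_measure \<omega> 0"
  interpret H: sigma_finite_measure ?H by (rule sigma_finite_hyperplane_measure)
  interpret LH: pair_sigma_finite "lborel :: real measure" ?H ..
  have ww: "\<omega> \<bullet> \<omega> = 1" using \<omega> by (simp add: norm_eq_1)
  have [measurable]: "cball (0::real^'n) 1 - {0} \<in> sets borel" "cball (0::real^'n) 1 \<in> sets borel" by simp_all
  define g where "g x = f (x /\<^sub>R norm x) * ennreal ((x /\<^sub>R norm x) \<bullet> \<omega>) * indicator (cball 0 1 - {0}) x" for x
  have gm[measurable]: "g \<in> borel_measurable borel" unfolding g_def by measurable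
  define l where "l y = f (y + sqrt (1 - (norm y)\<^sup>2) *\<^sub>R \<omega>)" for y
  have lm[measurable]: "l \<in> borel_measurable borel" unfolding l_def by measurable
  have inner_int: "(\<integral>\<^sup>+s. g (y + s *\<^sub>R \<omega>) \<partial>lborel) = (\<integral>\<^sup>+r. l (y /\<^sub>R r) * indicator (cball 0 1) (y /\<^sub>R r) * indicator {0..1} r \<partial>lborel)"
    if y: "y \<bullet> \<omega> = 0" for y
  proof -
    have nrm: "norm (y + s *\<^sub>R \<omega>) = sqrt ((norm y)\<^sup>2 + s\<^sup>2)" for s
      using y ww inner_commute[of \<omega> y] unfolding norm_eq_sqrt_inner
      by (simp add: inner_add_left inner_add_right power2_eq_square)
    have dot: "(y + s *\<^sub>R \<omega>) \<bullet> \<omega> = s" for s by (simp add: inner_add_left y ww)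
    let ?c = "norm y"
    have g: "g (y + s *\<^sub>R \<omega>) = l (y /\<^sub>R sqrt (?c\<^sup>2 + s\<^sup>2)) * ennreal (s / sqrt (?c\<^sup>2 + s\<^sup>2)) * indicator {0..sqrt (1 - ?c\<^sup>2)} s"
      if s: "s \<noteq> 0" for s
    proof (cases "s > 0")
      case True
      let ?\<rho> = "sqrt (?c\<^sup>2 + s\<^sup>2)"
      have \<rho>: "?\<rho> > 0" "?\<rho>\<^sup>2 = ?c\<^sup>2 + s\<^sup>2" using True by (simp_all add: add_nonneg_pos)
      have "(norm (y /\<^sub>R ?\<rho>))\<^sup>2 = ?c\<^sup>2 / ?\<rho>\<^sup>2"
        by (simp only: norm_scaleR power_mult_distrib power2_abs power_inverse divide_inverse mult.commute)
      moreover have "?c\<^sup>2 / ?\<rho>\<^sup>2 + s\<^sup>2 / ?\<rho>\<^sup>2 = 1"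
        unfolding add_divide_distrib[symmetric] using \<rho> by (metis divide_self less_irrefl zero_less_power)
      ultimately have "1 - (norm (y /\<^sub>R ?\<rho>))\<^sup>2 = (s / ?\<rho>)\<^sup>2"
        unfolding power_divide by linarith
      then have "sqrt (1 - (norm (y /\<^sub>R ?\<rho>))\<^sup>2) = s / ?\<rho>"
        using True \<rho>(1) by (simp only: real_sqrt_abs) simp
      then have "l (y /\<^sub>R ?\<rho>) = f ((y + s *\<^sub>R \<omega>) /\<^sub>R ?\<rho>)"
        by (simp only: l_def) (simp add: scaleR_add_right divide_inverse_commute)
      moreover have "((y + s *\<^sub>R \<omega>) /\<^sub>R ?\<rho>) \<bullet> \<omega> = s / ?\<rho>"
        by (simp only: inner_scaleR_left dot divide_inverse_commute)
      moreover have "?\<rho> \<le> 1 \<longleftrightarrow> s \<le> sqrt (1 - ?c\<^sup>2)"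
      proof -
        have "s \<le> sqrt (1 - ?c\<^sup>2) \<longleftrightarrow> sqrt (s\<^sup>2) \<le> sqrt (1 - ?c\<^sup>2)" using True by simp
        also have "\<dots> \<longleftrightarrow> ?c\<^sup>2 + s\<^sup>2 \<le> 1" by (simp only: real_sqrt_le_iff) linarith
        finally show ?thesis by (simp add: real_sqrt_le_1_iff)
      qed
      then have "indicator (cball 0 1 - {0}) (y + s *\<^sub>R \<omega>) = (indicator {0..sqrt (1 - ?c\<^sup>2)} s :: ennreal)"
        using True \<rho>(1) nrm[of s] by (auto simp: indicator_def)
      ultimately show ?thesis by (simp only: g_def nrm)
    next
      case False
      then have "s < 0" using s by simp
      then show ?thesis
        by (simp add: g_def dot nrm ennreal_neg mult_nonneg_nonpos)
    qed
    have g_int: "(\<integral>\<^sup>+s. g (y + s *\<^sub>R \<omega>) \<partial>lborel)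
        = (\<integral>\<^sup>+s. l (y /\<^sub>R sqrt (?c\<^sup>2 + s\<^sup>2)) * ennreal (s / sqrt (?c\<^sup>2 + s\<^sup>2)) * indicator {0..sqrt (1 - ?c\<^sup>2)} s \<partial>lborel)"
      using AE_lborel_singleton[of "0::real"] by (intro nn_integral_cong_AE) (elim eventually_mono, rule g)
    consider "?c = 0" | "0 < ?c" "?c \<le> 1" | "?c > 1" using norm_ge_zero[of y] by linarith
    then show ?thesis
    proof cases
      case 1
      then have "l (y /\<^sub>R sqrt (?c\<^sup>2 + s\<^sup>2)) * ennreal (s / sqrt (?c\<^sup>2 + s\<^sup>2)) * indicator {0..sqrt (1 - ?c\<^sup>2)} s
        = l (y /\<^sub>R s) * indicator (cball 0 1) (y /\<^sub>R s) * indicator {0..1} s" if "s \<noteq> 0" for s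
        using that by (cases "s > 0") (simp_all add: indicator_def)
      then show ?thesis
        unfolding g_int using AE_lborel_singleton[of "0::real"]
        by (intro nn_integral_cong_AE) (elim eventually_mono)
    next
      case 2
      have "l (y /\<^sub>R r) * indicator {?c..1} r = l (y /\<^sub>R r) * indicator (cball 0 1) (y /\<^sub>R r) * indicator {0..1} r" if "r \<noteq> 0" for r
      proof (cases "r > 0")
        case True
        have "norm (y /\<^sub>R r) \<le> 1 \<longleftrightarrow> ?c \<le> r" using True by (simp add: field_simps)
        then show ?thesis using True by (auto simp: indicator_def)
      next
        case False
        then have "r < 0" "\<not> ?c \<le> r" using that 2(1) by linarith+
        then have "r \<notin> {?c..1}" "r \<notin> {0..1}" by auto
        then show ?thesis by simp
      qed
      then have "(\<integral>\<^sup>+r. l (y /\<^sub>R r) * indicator {?c..1} r \<partial>lborel) = (\<integral>\<^sup>+r. l (y /\<^sub>R r) * indicator (cball 0 1) (y /\<^sub>R r) * indicator {0..1} r \<partial>lborel)"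
        using AE_lborel_singleton[of "0::real"] by (intro nn_integral_cong_AE) (elim eventually_mono)
      then show ?thesis
        unfolding g_int using nn_integral_radius_substitution[OF _ 2, of "\<lambda>r. l (y /\<^sub>R r)"] by simp
    next
      case 3
      then have "?c\<^sup>2 > 1" by (simp add: one_less_power)
      then have "l (y /\<^sub>R sqrt (?c\<^sup>2 + s\<^sup>2)) * ennreal (s / sqrt (?c\<^sup>2 + s\<^sup>2)) * indicator {0..sqrt (1 - ?c\<^sup>2)} s
        = l (y /\<^sub>R s) * indicator (cball 0 1) (y /\<^sub>R s) * indicator {0..1} s" if "s \<noteq> 0" for s
      proof (cases "s > 0 \<and> s \<le> 1")
        case True
        then have "norm (y /\<^sub>R s) > 1" using 3 by (simp add: field_simps)
        moreover have "sqrt (1 - ?c\<^sup>2) < 0" using \<open>?c\<^sup>2 > 1\<close> by simp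
        ultimately show ?thesis using True by (simp add: indicator_def)
      next
        case False
        then have "s \<notin> {0..1}" using that by auto
        moreover have "sqrt (1 - ?c\<^sup>2) < 0" using \<open>?c\<^sup>2 > 1\<close> by simp
        ultimately show ?thesis by (simp add: indicator_def)
      qed
      then show ?thesis
        unfolding g_int using AE_lborel_singleton[of "0::real"]
        by (intro nn_integral_cong_AE) (elim eventually_mono)
    qed
  qed
  have "(\<integral>\<^sup>+\<xi>. f \<xi> * ennreal (\<xi> \<bullet> \<omega>) \<partial>sphere_measure) = of_nat CARD('n) * (\<integral>\<^sup>+x. g x \<partial>lborel)"
    unfolding g_def by (rule nn_integral_sphere) measurable
  also have "(\<integral>\<^sup>+x. g x \<partial>lborel) = (\<integral>\<^sup>+y. \<integral>\<^sup>+s. g (y + s *\<^sub>R \<omega>) \<partial>lborel \<partial>?H)"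
    by (subst nn_integral_lborel_hyperplane[OF \<omega> gm], rule LH.Fubini'[symmetric]) measurable
  also have "\<dots> = (\<integral>\<^sup>+y. \<integral>\<^sup>+r. l (y /\<^sub>R r) * indicator (cball 0 1) (y /\<^sub>R r) * indicator {0..1} r \<partial>lborel \<partial>?H)"
    using AE_hyperplane_inner[OF \<omega>, of 0]
    by (intro nn_integral_cong_AE) (elim eventually_mono, rule inner_int)
  also have "\<dots> = (\<integral>\<^sup>+r. \<integral>\<^sup>+y. l (y /\<^sub>R r) * indicator (cball 0 1) (y /\<^sub>R r) * indicator {0..1} r \<partial>?H \<partial>lborel)"
    by (rule LH.Fubini') measurable
  also have "\<dots> = (\<integral>\<^sup>+r. ennreal (r ^ (CARD('n) - 1)) * indicator {0..1} r * (\<integral>\<^sup>+y. l y * indicator (cball 0 1) y \<partial>?H) \<partial>lborel)"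
  proof (rule nn_integral_cong_AE, use AE_lborel_singleton[of "0::real"] in eventually_elim)
    case (elim r)
    show ?case
    proof (cases "r > 0")
      case True
      have "(\<integral>\<^sup>+y. l (y /\<^sub>R r) * indicator (cball 0 1) (y /\<^sub>R r) * indicator {0..1} r \<partial>?H)
         = (\<integral>\<^sup>+y. l (y /\<^sub>R r) * indicator (cball 0 1) (y /\<^sub>R r) \<partial>?H) * indicator {0..1} r"
        by (rule nn_integral_multc) measurable
      also have "(\<integral>\<^sup>+y. l (y /\<^sub>R r) * indicator (cball 0 1) (y /\<^sub>R r) \<partial>?H)
         = ennreal (r ^ (CARD('n) - 1)) * (\<integral>\<^sup>+y. l y * indicator (cball 0 1) y \<partial>?H)"
        using True by (subst nn_integral_hyperplane_scale[OF \<omega> True, symmetric]) simp_all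
      finally show ?thesis by (simp add: mult_ac)
    qed (use elim in \<open>simp add: indicator_def\<close>)
  qed
  also have "\<dots> = (\<integral>\<^sup>+r. ennreal (r ^ (CARD('n) - 1)) * indicator {0..1} r \<partial>lborel) * (\<integral>\<^sup>+y. l y * indicator (cball 0 1) y \<partial>?H)"
    by (rule nn_integral_multc) measurable
  also have "of_nat CARD('n) * \<dots> = (\<integral>\<^sup>+y. l y * indicator (cball 0 1) y \<partial>?H)"
    using nn_integral_power_Icc[of 1 "CARD('n) - 1"] by (simp add: mult.assoc[symmetric] del: of_nat_Suc)
  finally show ?thesis by (simp add: l_def)
qed

lemma nn_integral_hyperplane_dilate:
  fixes \<omega> :: "real^'n"
  assumes \<omega>: "norm \<omega> = 1" and r: "r > 0" and [measurable]: "f \<in> borel_measurable borel"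
  shows "(\<integral>\<^sup>+x. f x \<partial>hyperplane_measure \<omega> (r * t)) = ennreal (r ^ (CARD('n) - 1)) * (\<integral>\<^sup>+x. f (r *\<^sub>R x) \<partial>hyperplane_measure \<omega> t)"
proof -
  have "(\<integral>\<^sup>+x. f x \<partial>hyperplane_measure \<omega> (r * t)) = (\<integral>\<^sup>+y. f (y + (r * t) *\<^sub>R \<omega>) \<partial>hyperplane_measure \<omega> 0)"
    by (rule nn_integral_hyperplane_shift) measurable
  also have "\<dots> = ennreal (r ^ (CARD('n) - 1)) * (\<integral>\<^sup>+y. f (r *\<^sub>R y + (r * t) *\<^sub>R \<omega>) \<partial>hyperplane_measure \<omega> 0)"
    by (rule nn_integral_hyperplane_scale[OF \<omega> r, symmetric]) measurable
  also have "(\<integral>\<^sup>+y. f (r *\<^sub>R y + (r * t) *\<^sub>R \<omega>) \<partial>hyperplane_measure \<omega> 0) = (\<integral>\<^sup>+x. f (r *\<^sub>R x) \<partial>hyperplane_measure \<omega> t)"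
    by (subst (2) nn_integral_hyperplane_shift) (simp_all add: scaleR_add_right)
  finally show ?thesis .
qed

lemma borel_measurable_indicator_Icc [measurable (raw)]:
  fixes f g h :: "'a \<Rightarrow> real"
  assumes [measurable]: "f \<in> borel_measurable M" "g \<in> borel_measurable M" "h \<in> borel_measurable M"
  shows "(\<lambda>x. indicator {f x..g x} (h x) :: ennreal) \<in> borel_measurable M"
proof -
  have "(\<lambda>x. if f x \<le> h x \<and> h x \<le> g x then 1 else 0 :: ennreal) \<in> borel_measurable M" by measurable
  then show ?thesis by (simp add: indicator_def of_bool_def)
qed

lemma ennreal_divide_eq_mult: "a > 0 \<Longrightarrow> x / ennreal a = x * ennreal (inverse a)"
  by (simp add: divide_ennreal_def inverse_ennreal)

text \<open>
  Central projection.  Slice the unit ball by the planes at height \<open>s\<close> and dilate each slice onto the plane at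
  height \<open>t\<close>: the direction of a point does not change, the slice contributes \<open>(s / t) ^ (n - 1)\<close>, and the point
  \<open>x\<close> is reached for \<open>s \<le> t / |x|\<close>.  Integrating over \<open>s\<close> leaves the power of \<open>|x|\<close> of the adjoint X-ray
  transform.
\<close>
lemma nn_integral_hyperplane_gnomonic:
  fixes \<omega> :: "real^'n" and f :: "real^'n \<Rightarrow> ennreal"
  assumes \<omega>: "norm \<omega> = 1" and t: "t > 0" and [measurable]: "f \<in> borel_measurable borel"
  shows "(\<integral>\<^sup>+x. f (x /\<^sub>R norm x) / ennreal (norm x ^ (CARD('n) - 1)) \<partial>hyperplane_measure \<omega> t)
    = (\<integral>\<^sup>+\<xi>. f \<xi> / ennreal (\<xi> \<bullet> \<omega>) * indicator {0<..} (\<xi> \<bullet> \<omega>) \<partial>sphere_measure)"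
proof -
  let ?H = "hyperplane_measure \<omega>" and ?d = "CARD('n) - 1"
  interpret H: sigma_finite_measure "?H t" by (rule sigma_finite_hyperplane_measure)
  interpret LH: pair_sigma_finite "lborel :: real measure" "?H t" ..
  have ww: "\<omega> \<bullet> \<omega> = 1" using \<omega> by (simp add: norm_eq_1)
  have [measurable]: "cball (0::real^'n) 1 - {0} \<in> sets borel" by simp
  define g where "g x = f (x /\<^sub>R norm x) / ennreal ((x /\<^sub>R norm x) \<bullet> \<omega>) * indicator {0<..} ((x /\<^sub>R norm x) \<bullet> \<omega>)
      * indicator (cball 0 1 - {0}) x" for x
  have gm[measurable]: "g \<in> borel_measurable borel" unfolding g_def by measurable
  define c where "c x = f (x /\<^sub>R norm x) * ennreal (norm x / t)" for x
  have cm[measurable]: "c \<in> borel_measurable borel" unfolding c_def by measurable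
  have slice: "(\<integral>\<^sup>+y. g (y + s *\<^sub>R \<omega>) \<partial>?H 0) = (\<integral>\<^sup>+x. c x * (ennreal ((s / t) ^ ?d) * indicator {0..t / norm x} s) \<partial>?H t)"
    if s: "s \<noteq> 0" for s
  proof (cases "s > 0")
    case True
    then have r: "s / t > 0" using t by simp
    have "(\<integral>\<^sup>+y. g (y + s *\<^sub>R \<omega>) \<partial>?H 0) = (\<integral>\<^sup>+x. g x \<partial>?H s)"
      by (rule nn_integral_hyperplane_shift[symmetric]) measurable
    also have "\<dots> = ennreal ((s / t) ^ ?d) * (\<integral>\<^sup>+x. g ((s / t) *\<^sub>R x) \<partial>?H t)"
      using nn_integral_hyperplane_dilate[OF \<omega> r gm, of t] t by simp
    also have "\<dots> = (\<integral>\<^sup>+x. ennreal ((s / t) ^ ?d) * g ((s / t) *\<^sub>R x) \<partial>?H t)"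
      by (rule nn_integral_cmult[symmetric]) measurable
    also have "\<dots> = (\<integral>\<^sup>+x. c x * (ennreal ((s / t) ^ ?d) * indicator {0..t / norm x} s) \<partial>?H t)"
    proof (rule nn_integral_cong_AE, use AE_hyperplane_inner[OF \<omega>, of t] in eventually_elim)
      case (elim x)
      have x0: "norm x > 0" using elim t by auto
      have dir: "((s / t) *\<^sub>R x) /\<^sub>R norm ((s / t) *\<^sub>R x) = x /\<^sub>R norm x"
        using r x0 True t by (simp add: field_simps)
      have dot: "(x /\<^sub>R norm x) \<bullet> \<omega> = t / norm x"
        by (simp only: inner_scaleR_left elim divide_inverse_commute)
      have "norm ((s / t) *\<^sub>R x) \<le> 1 \<longleftrightarrow> s \<le> t / norm x"
        using True t x0 by (simp add: field_simps)
      then have ind: "indicator (cball 0 1 - {0}) ((s / t) *\<^sub>R x) = (indicator {0..t / norm x} s :: ennreal)"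
        using True t x0 by (auto simp: indicator_def)
      have "t / norm x > 0" using t x0 by simp
      then show ?case
        by (simp only: g_def dir dot ind ennreal_divide_eq_mult c_def inverse_divide) (simp add: mult_ac)
    qed
    finally show ?thesis .
  next
    case False
    then have "s < 0" using s by simp
    have "g (y + s *\<^sub>R \<omega>) = 0" if "y \<bullet> \<omega> = 0" for y
      using that \<open>s < 0\<close> by (simp add: g_def inner_add_left ww indicator_def zero_less_mult_iff)
    then have "(\<integral>\<^sup>+y. g (y + s *\<^sub>R \<omega>) \<partial>?H 0) = 0"
      using AE_hyperplane_inner[OF \<omega>, of 0] by (subst nn_integral_0_iff_AE) (simp, elim eventually_mono)
    then show ?thesis using \<open>s < 0\<close> by simp
  qed
  have "(\<integral>\<^sup>+\<xi>. f \<xi> / ennreal (\<xi> \<bullet> \<omega>) * indicator {0<..} (\<xi> \<bullet> \<omega>) \<partial>sphere_measure) = of_nat CARD('n) * (\<integral>\<^sup>+x. g x \<partial>lborel)"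
    unfolding g_def by (rule nn_integral_sphere) measurable
  also have "(\<integral>\<^sup>+x. g x \<partial>lborel) = (\<integral>\<^sup>+s. \<integral>\<^sup>+y. g (y + s *\<^sub>R \<omega>) \<partial>?H 0 \<partial>lborel)"
    by (rule nn_integral_lborel_hyperplane[OF \<omega> gm])
  also have "\<dots> = (\<integral>\<^sup>+s. \<integral>\<^sup>+x. c x * (ennreal ((s / t) ^ ?d) * indicator {0..t / norm x} s) \<partial>?H t \<partial>lborel)"
    using AE_lborel_singleton[of "0::real"] by (intro nn_integral_cong_AE) (elim eventually_mono, rule slice)
  also have "\<dots> = (\<integral>\<^sup>+x. \<integral>\<^sup>+s. c x * (ennreal ((s / t) ^ ?d) * indicator {0..t / norm x} s) \<partial>lborel \<partial>?H t)"
    by (rule LH.Fubini'[symmetric]) measurable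
  also have "of_nat CARD('n) * \<dots> = (\<integral>\<^sup>+x. of_nat CARD('n) * (\<integral>\<^sup>+s. c x * (ennreal ((s / t) ^ ?d) * indicator {0..t / norm x} s) \<partial>lborel) \<partial>?H t)"
    by (rule nn_integral_cmult[symmetric]) measurable
  also have "\<dots> = (\<integral>\<^sup>+x. f (x /\<^sub>R norm x) / ennreal (norm x ^ ?d) \<partial>?H t)"
  proof (rule nn_integral_cong_AE, use AE_hyperplane_inner[OF \<omega>, of t] in eventually_elim)
    case (elim x)
    have x0: "norm x > 0" using elim t by auto
    have "of_nat CARD('n) * (\<integral>\<^sup>+s. c x * (ennreal ((s / t) ^ ?d) * indicator {0..t / norm x} s) \<partial>lborel)
        = of_nat CARD('n) * (\<integral>\<^sup>+s. (c x * ennreal (inverse t ^ ?d)) * (ennreal (s ^ ?d) * indicator {0..t / norm x} s) \<partial>lborel)"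
    proof -
      have "ennreal ((s / t) ^ ?d) * indicator {0..t / norm x} s = ennreal (inverse t ^ ?d) * (ennreal (s ^ ?d) * indicator {0..t / norm x} s)" for s
        using t by (cases "s \<ge> 0") (simp_all add: divide_inverse power_mult_distrib mult_ac ennreal_mult)
      then show ?thesis by (simp only: mult.assoc)
    qed
    also have "\<dots> = (c x * ennreal (inverse t ^ ?d)) * (of_nat (Suc ?d) * (\<integral>\<^sup>+s. ennreal (s ^ ?d) * indicator {0..t / norm x} s \<partial>lborel))"
      by (subst nn_integral_cmult) (simp_all add: mult_ac del: of_nat_Suc)
    also have "\<dots> = (c x * ennreal (inverse t ^ ?d)) * ennreal ((t / norm x) ^ Suc ?d)"
      using t x0 by (subst nn_integral_power_Icc) simp_all
    also have "\<dots> = f (x /\<^sub>R norm x) * ennreal (norm x / t * inverse t ^ ?d * (t / norm x) ^ Suc ?d)"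
      using t x0 by (simp only: c_def mult.assoc) (subst ennreal_mult'[symmetric], simp, subst ennreal_mult'[symmetric], simp, rule refl)
    also have "norm x / t * inverse t ^ ?d * (t / norm x) ^ Suc ?d = inverse (norm x ^ ?d)"
    proof -
      have "norm x / t * inverse t ^ d * (t / norm x) ^ Suc d = inverse (norm x ^ d)" for d
        using t x0 by (simp add: power_divide field_simps)
      then show ?thesis .
    qed
    also have "f (x /\<^sub>R norm x) * ennreal (inverse (norm x ^ ?d)) = f (x /\<^sub>R norm x) / ennreal (norm x ^ ?d)"
      using x0 by (simp add: ennreal_divide_eq_mult)
    finally show ?case .
  qed
  finally show ?thesis ..
qed

section \<open>Schur bounds for the Gaussian kernel on the sphere\<close>

lemma nn_integral_sphere_abs_graph:
  fixes e :: "real^'n" and f :: "real^'n \<Rightarrow> ennreal"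
  assumes e: "norm e = 1" and [measurable]: "f \<in> borel_measurable borel"
  shows "(\<integral>\<^sup>+\<xi>. f \<xi> * ennreal \<bar>\<xi> \<bullet> e\<bar> \<partial>sphere_measure)
    = (\<integral>\<^sup>+y. f (y + sqrt (1 - (norm y)\<^sup>2) *\<^sub>R e) * indicator (cball 0 1) y \<partial>hyperplane_measure e 0)
      + (\<integral>\<^sup>+y. f (y - sqrt (1 - (norm y)\<^sup>2) *\<^sub>R e) * indicator (cball 0 1) y \<partial>hyperplane_measure e 0)"
proof -
  have abs: "ennreal \<bar>a\<bar> = ennreal a + ennreal (- a)" for a :: real
    by (cases "a \<ge> 0") (auto simp: ennreal_neg)
  have "(\<integral>\<^sup>+\<xi>. f \<xi> * ennreal \<bar>\<xi> \<bullet> e\<bar> \<partial>sphere_measure)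
      = (\<integral>\<^sup>+\<xi>. f \<xi> * ennreal (\<xi> \<bullet> e) + f \<xi> * ennreal (\<xi> \<bullet> (- e)) \<partial>sphere_measure)"
    by (simp add: abs distrib_left)
  also have "\<dots> = (\<integral>\<^sup>+\<xi>. f \<xi> * ennreal (\<xi> \<bullet> e) \<partial>sphere_measure) + (\<integral>\<^sup>+\<xi>. f \<xi> * ennreal (\<xi> \<bullet> (- e)) \<partial>sphere_measure)"
    by (intro nn_integral_add measurable_sphere_measure) measurable
  also have "\<dots> = (\<integral>\<^sup>+y. f (y + sqrt (1 - (norm y)\<^sup>2) *\<^sub>R e) * indicator (cball 0 1) y \<partial>hyperplane_measure e 0)
      + (\<integral>\<^sup>+y. f (y - sqrt (1 - (norm y)\<^sup>2) *\<^sub>R e) * indicator (cball 0 1) y \<partial>hyperplane_measure e 0)"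
    using e by (subst nn_integral_sphere_graph, simp, simp, subst nn_integral_sphere_graph, simp_all add: hyperplane_measure_uminus)
  finally show ?thesis .
qed

context hyperplane_orthonormal_basis
begin

lemma perp_add_multiple: "perp \<omega> (v + s *\<^sub>R \<omega>) = perp \<omega> v"
  by (simp add: perp_def inner_add_left inner_unit algebra_simps)

lemma gauss_kernel_add_multiple: "gauss_kernel \<omega> \<epsilon> (v + s *\<^sub>R \<omega>) = gauss_kernel \<omega> \<epsilon> v"
  by (simp add: gauss_kernel_def perp_add_multiple)

text \<open>
  Projecting along \<open>\<omega>\<close> does not change the kernel, which ignores that direction, so that each hemisphere
  contributes at most the total mass.
\<close>
lemma sphere_kernel_axis:
  assumes \<epsilon>: "\<epsilon> > 0"
  shows "(\<integral>\<^sup>+\<eta>. ennreal (gauss_kernel \<omega> \<epsilon> (\<xi> - \<eta>)) * ennreal \<bar>\<eta> \<bullet> \<omega>\<bar> \<partial>sphere_measure) \<le> ennreal (2 * (2 * pi) ^ (CARD('n) - 1))"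
proof -
  have *: "(\<integral>\<^sup>+y. ennreal (gauss_kernel \<omega> \<epsilon> (\<xi> - (y + u y *\<^sub>R \<omega>))) * indicator (cball 0 1) y \<partial>H) \<le> ennreal ((2 * pi) ^ (CARD('n) - 1))" for u
  proof -
    have "gauss_kernel \<omega> \<epsilon> (\<xi> - (y + u y *\<^sub>R \<omega>)) = gauss_kernel \<omega> \<epsilon> (y - \<xi>)" for y
      using gauss_kernel_add_multiple[of \<epsilon> "\<xi> - y" "- u y"] gauss_kernel_minus[of \<omega> \<epsilon> \<xi> y] by (simp add: diff_diff_eq)
    then have "(\<integral>\<^sup>+y. ennreal (gauss_kernel \<omega> \<epsilon> (\<xi> - (y + u y *\<^sub>R \<omega>))) * indicator (cball 0 1) y \<partial>H)
        \<le> (\<integral>\<^sup>+y. ennreal (gauss_kernel \<omega> \<epsilon> (y + - \<xi>)) \<partial>H)"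
      by (intro nn_integral_mono) (simp add: indicator_def)
    then show ?thesis by (simp only: nn_integral_gauss_kernel[OF \<epsilon>])
  qed
  have "(\<integral>\<^sup>+\<eta>. ennreal (gauss_kernel \<omega> \<epsilon> (\<xi> - \<eta>)) * ennreal \<bar>\<eta> \<bullet> \<omega>\<bar> \<partial>sphere_measure)
      \<le> ennreal ((2 * pi) ^ (CARD('n) - 1)) + ennreal ((2 * pi) ^ (CARD('n) - 1))"
    using add_mono[OF *[of "\<lambda>y. sqrt (1 - (norm y)\<^sup>2)"] *[of "\<lambda>y. - sqrt (1 - (norm y)\<^sup>2)"]]
    by (subst nn_integral_sphere_abs_graph[OF unit]) simp_all
  also have "\<dots> = ennreal (2 * (2 * pi) ^ (CARD('n) - 1))"
    by (subst ennreal_plus[symmetric]) simp_all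
  finally show ?thesis .
qed

lemma basis_exchange:
  assumes e: "e \<in> B"
  shows "hyperplane_orthonormal_basis e (insert \<omega> (B - {e}))"
proof
  show "norm e = 1" using unitB e by blast
  show "pairwise orthogonal (insert \<omega> (B - {e}))"
    using orth unitB by (auto simp: pairwise_insert orthogonal_def inner_commute pairwise_def)
  show "norm b = 1 \<and> b \<bullet> e = 0" if "b \<in> insert \<omega> (B - {e})" for b
    using that unitB[OF e] unitB[of b] unit basis_inner[of b e] e by (auto simp: inner_commute)
  have "CARD('n) - 1 > 0" using card_B e fin by (metis card_gt_0_iff empty_iff)
  then show "card (insert \<omega> (B - {e})) = CARD('n) - 1"
    using e fin span_B(2) card_B by (simp add: card_Diff_singleton)
  have "insert e (insert \<omega> (B - {e})) = insert \<omega> B" using e by auto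
  then show "span (insert e (insert \<omega> (B - {e}))) = UNIV" using span_B(1) by simp
qed (use fin e span_B in auto)

text \<open>
  Projecting along \<open>e\<close>, one of the coordinates in which the kernel decays is lost.  The remaining \<open>n - 2\<close> of
  them each contribute \<open>2 sqrt \<pi> / R\<close>, while the coordinate along \<open>\<omega>\<close>, where the kernel does not decay, is
  confined to \<open>[-1, 1]\<close>.
\<close>
lemma sphere_kernel_tangent:
  assumes R: "R > 0" and e: "e \<in> B"
  shows "(\<integral>\<^sup>+\<eta>. ennreal (gauss_kernel \<omega> (1 / R\<^sup>2) (\<xi> - \<eta>)) * ennreal \<bar>\<eta> \<bullet> e\<bar> \<partial>sphere_measure)
    \<le> ennreal (4 * sqrt pi * R * (2 * pi) ^ (CARD('n) - 2))"
proof -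
  interpret E: hyperplane_orthonormal_basis e "insert \<omega> (B - {e})" by (rule basis_exchange[OF e])
  let ?d = "CARD('n) - 1"
  \<comment> \<open>The constant in front of the kernel is attached to the factor in the direction \<open>\<omega>\<close>.\<close>
  define f where "f b s = (if b = \<omega> then ennreal (sqrt (pi * R\<^sup>2) ^ ?d) * indicator {-1..1} s
    else ennreal (exp (- (R\<^sup>2 / 4) * (- (\<xi> \<bullet> b) + s)\<^sup>2)))" for b :: "real^'n" and s :: real
  have fm[measurable]: "f b \<in> borel_measurable borel" for b
    unfolding f_def by (cases "b = \<omega>") simp_all
  have \<omega>e: "\<omega> \<bullet> e = 0" using unitB[OF e] by (simp add: inner_commute)
  have card_Be: "card (B - {e}) = CARD('n) - 2"
    using e fin card_B by (simp add: card_Diff_singleton)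
  have d: "?d = Suc (CARD('n) - 2)"
    using card_B e fin card_gt_0_iff[of B] by auto
  have *: "(\<integral>\<^sup>+y. ennreal (gauss_kernel \<omega> (1 / R\<^sup>2) (\<xi> - (y + u y *\<^sub>R e))) * indicator (cball 0 1) y \<partial>hyperplane_measure e 0)
      \<le> ennreal (2 * sqrt pi * R * (2 * pi) ^ (CARD('n) - 2))" for u
  proof -
    have "(\<integral>\<^sup>+y. ennreal (gauss_kernel \<omega> (1 / R\<^sup>2) (\<xi> - (y + u y *\<^sub>R e))) * indicator (cball 0 1) y \<partial>hyperplane_measure e 0)
        \<le> (\<integral>\<^sup>+y. (\<Prod>b\<in>insert \<omega> (B - {e}). f b (y \<bullet> b)) \<partial>hyperplane_measure e 0)"
    proof (rule nn_integral_mono)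
      fix y :: "real^'n"
      let ?v = "\<xi> - (y + u y *\<^sub>R e)"
      show "ennreal (gauss_kernel \<omega> (1 / R\<^sup>2) ?v) * indicator (cball 0 1) y \<le> (\<Prod>b\<in>insert \<omega> (B - {e}). f b (y \<bullet> b))"
      proof (cases "y \<in> cball 0 1")
        case True
        have y\<omega>: "\<bar>y \<bullet> \<omega>\<bar> \<le> 1"
          using Cauchy_Schwarz_ineq2[of y \<omega>] True unit by simp
        have "(\<Sum>b\<in>B - {e}. (- (\<xi> \<bullet> b) + y \<bullet> b)\<^sup>2) = (\<Sum>b\<in>B - {e}. (?v \<bullet> b)\<^sup>2)"
          using basis_inner e
          by (intro sum.cong refl) (auto simp: inner_diff_left inner_add_left power2_commute)
        also have "\<dots> \<le> (\<Sum>b\<in>B. (?v \<bullet> b)\<^sup>2)"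
          using fin by (intro sum_mono2) auto
        also have "\<dots> = (norm (perp \<omega> ?v))\<^sup>2" by (rule norm_perp[symmetric])
        finally have le: "(R\<^sup>2 / 4) * (\<Sum>b\<in>B - {e}. (- (\<xi> \<bullet> b) + y \<bullet> b)\<^sup>2) \<le> (R\<^sup>2 / 4) * (norm (perp \<omega> ?v))\<^sup>2"
          by (intro mult_left_mono) auto
        have "gauss_kernel \<omega> (1 / R\<^sup>2) ?v = sqrt (pi * R\<^sup>2) ^ ?d * exp (- ((R\<^sup>2 / 4) * (norm (perp \<omega> ?v))\<^sup>2))"
          using R by (simp add: gauss_kernel_def field_simps)
        also have "\<dots> \<le> sqrt (pi * R\<^sup>2) ^ ?d * exp (- ((R\<^sup>2 / 4) * (\<Sum>b\<in>B - {e}. (- (\<xi> \<bullet> b) + y \<bullet> b)\<^sup>2)))"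
          using le R by (intro mult_left_mono) simp_all
        also have "exp (- ((R\<^sup>2 / 4) * (\<Sum>b\<in>B - {e}. (- (\<xi> \<bullet> b) + y \<bullet> b)\<^sup>2))) = (\<Prod>b\<in>B - {e}. exp (- (R\<^sup>2 / 4) * (- (\<xi> \<bullet> b) + y \<bullet> b)\<^sup>2))"
          using fin by (simp add: exp_sum sum_distrib_left flip: sum_negf)
        finally have "ennreal (gauss_kernel \<omega> (1 / R\<^sup>2) ?v)
            \<le> ennreal (sqrt (pi * R\<^sup>2) ^ ?d * (\<Prod>b\<in>B - {e}. exp (- (R\<^sup>2 / 4) * (- (\<xi> \<bullet> b) + y \<bullet> b)\<^sup>2)))"
          by (rule ennreal_leI)
        also have "\<dots> = f \<omega> (y \<bullet> \<omega>) * (\<Prod>b\<in>B - {e}. f b (y \<bullet> b))"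
        proof -
          have "(\<Prod>b\<in>B - {e}. f b (y \<bullet> b)) = ennreal (\<Prod>b\<in>B - {e}. exp (- (R\<^sup>2 / 4) * (- (\<xi> \<bullet> b) + y \<bullet> b)\<^sup>2))"
          proof -
            have "f b s = ennreal (exp (- (R\<^sup>2 / 4) * (- (\<xi> \<bullet> b) + s)\<^sup>2))" if "b \<in> B - {e}" for b s
              using that span_B(2) unfolding f_def by auto
            then have "(\<Prod>b\<in>B - {e}. f b (y \<bullet> b)) = (\<Prod>b\<in>B - {e}. ennreal (exp (- (R\<^sup>2 / 4) * (- (\<xi> \<bullet> b) + y \<bullet> b)\<^sup>2)))"
              by (intro prod.cong refl)
            also have "\<dots> = ennreal (\<Prod>b\<in>B - {e}. exp (- (R\<^sup>2 / 4) * (- (\<xi> \<bullet> b) + y \<bullet> b)\<^sup>2))"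
              by (rule prod_ennreal) simp
            finally show ?thesis .
          qed
          then show ?thesis using y\<omega> R by (simp add: f_def ennreal_mult prod_nonneg abs_le_iff)
        qed
        also have "\<dots> = (\<Prod>b\<in>insert \<omega> (B - {e}). f b (y \<bullet> b))"
          using fin span_B(2) by simp
        finally show ?thesis using True by simp
      qed simp
    qed
    also have "\<dots> = (\<Prod>b\<in>insert \<omega> (B - {e}). \<integral>\<^sup>+s. f b s \<partial>lborel)"
      by (rule E.nn_integral_hyperplane_prod) measurable
    also have "\<dots> = (\<integral>\<^sup>+s. f \<omega> s \<partial>lborel) * (\<Prod>b\<in>B - {e}. \<integral>\<^sup>+s. f b s \<partial>lborel)"
      using fin span_B(2) by simp
    also have "(\<integral>\<^sup>+s. f \<omega> s \<partial>lborel) = ennreal (sqrt (pi * R\<^sup>2) ^ ?d * 2)"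
      using R by (simp add: f_def nn_integral_cmult_indicator ennreal_mult)
    also have "(\<Prod>b\<in>B - {e}. \<integral>\<^sup>+s. f b s \<partial>lborel) = (\<Prod>b\<in>B - {e}. ennreal (2 * sqrt pi / R))"
    proof (intro prod.cong refl)
      fix b assume "b \<in> B - {e}"
      then have "b \<noteq> \<omega>" using span_B(2) by auto
      then have "(\<integral>\<^sup>+s. f b s \<partial>lborel) = (\<integral>\<^sup>+s. ennreal (exp (- (R\<^sup>2 / 4) * s\<^sup>2)) \<partial>lborel)"
        unfolding f_def if_not_P[OF \<open>b \<noteq> \<omega>\<close>]
        by (intro nn_integral_lborel_shift[of "\<lambda>s. ennreal (exp (- (R\<^sup>2 / 4) * s\<^sup>2))"]) measurable
      also have "\<dots> = ennreal (sqrt (pi / (R\<^sup>2 / 4)))"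
        using R by (intro nn_integral_gaussian) simp
      also have "sqrt (pi / (R\<^sup>2 / 4)) = 2 * sqrt pi / R"
        using R by (simp add: real_sqrt_divide real_sqrt_mult)
      finally show "(\<integral>\<^sup>+s. f b s \<partial>lborel) = ennreal (2 * sqrt pi / R)" .
    qed
    also have "(\<Prod>b\<in>B - {e}. ennreal (2 * sqrt pi / R)) = ennreal ((2 * sqrt pi / R) ^ (CARD('n) - 2))"
      using R by (simp add: card_Be ennreal_power)
    also have "ennreal (sqrt (pi * R\<^sup>2) ^ ?d * 2) * ennreal ((2 * sqrt pi / R) ^ (CARD('n) - 2))
        = ennreal (2 * sqrt pi * R * (2 * pi) ^ (CARD('n) - 2))"
    proof -
      have "sqrt (pi * R\<^sup>2) ^ Suc m * 2 * (2 * sqrt pi / R) ^ m = 2 * sqrt pi * R * (2 * pi) ^ m" for m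
      proof -
        have "(sqrt pi * R) * (2 * sqrt pi / R) = 2 * pi" using R by simp
        then have "(sqrt pi * R) ^ m * (2 * sqrt pi / R) ^ m = (2 * pi) ^ m" by (simp only: flip: power_mult_distrib)
        moreover have "sqrt (pi * R\<^sup>2) = sqrt pi * R" using R by (simp add: real_sqrt_mult)
        ultimately show ?thesis by (simp add: mult_ac)
      qed
      from this[of "CARD('n) - 2"] show ?thesis
        unfolding d using R by (subst ennreal_mult[symmetric]) simp_all
    qed
    finally show ?thesis .
  qed
  have "(\<integral>\<^sup>+\<eta>. ennreal (gauss_kernel \<omega> (1 / R\<^sup>2) (\<xi> - \<eta>)) * ennreal \<bar>\<eta> \<bullet> e\<bar> \<partial>sphere_measure)
      \<le> ennreal (2 * sqrt pi * R * (2 * pi) ^ (CARD('n) - 2)) + ennreal (2 * sqrt pi * R * (2 * pi) ^ (CARD('n) - 2))"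
    using add_mono[OF *[of "\<lambda>y. sqrt (1 - (norm y)\<^sup>2)"] *[of "\<lambda>y. - sqrt (1 - (norm y)\<^sup>2)"]]
    by (subst nn_integral_sphere_abs_graph[OF E.unit]) simp_all
  also have "\<dots> = ennreal (4 * sqrt pi * R * (2 * pi) ^ (CARD('n) - 2))"
    using R by (subst ennreal_plus[symmetric]) simp_all
  finally show ?thesis .
qed

text \<open>
  For \<open>R \<ge> 1\<close>, split \<open>1 \<le> \<Sum> |\<eta> \<bullet> e|\<close> over an orthonormal basis that contains \<open>\<omega>\<close>; this gives a mass of
  order \<open>R\<close>.  For \<open>R < 1\<close> the kernel is bounded by a multiple of \<open>R ^ (n - 1)\<close>, which is at most a multiple of
  \<open>R\<close> because \<open>n \<ge> 2\<close>, and the sphere has finite measure.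
\<close>
lemma sphere_kernel_bound:
  assumes R: "R > 0" and dim: "CARD('n) \<ge> 2"
  shows "(\<integral>\<^sup>+\<eta>. ennreal (gauss_kernel \<omega> (1 / R\<^sup>2) (\<xi> - \<eta>) * (\<bar>\<eta> \<bullet> \<omega>\<bar> + 1 / R)) \<partial>sphere_measure)
    \<le> ennreal (4 * (2 * pi) ^ (CARD('n) - 1) + real (CARD('n) - 1) * (4 * sqrt pi * (2 * pi) ^ (CARD('n) - 2))
        + sqrt pi ^ (CARD('n) - 1) * measure (sphere_measure :: (real^'n) measure) (sphere 0 1))"
proof -
  let ?d = "CARD('n) - 1" and ?K = "\<lambda>\<eta>. gauss_kernel \<omega> (1 / R\<^sup>2) (\<xi> - \<eta>)" and ?\<sigma> = "sphere_measure :: (real^'n) measure"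
  define A where "A = 2 * (2 * pi) ^ ?d"
  define D where "D = 4 * sqrt pi * (2 * pi) ^ (CARD('n) - 2)"
  define V where "V = sqrt pi ^ ?d * measure ?\<sigma> (sphere 0 1)"
  have nonneg: "A \<ge> 0" "D \<ge> 0" "V \<ge> 0" by (simp_all add: A_def D_def V_def)
  have \<epsilon>: "1 / R\<^sup>2 > 0" using R by simp
  have K0: "?K \<eta> \<ge> 0" for \<eta> by (rule gauss_kernel_nonneg[OF \<epsilon>])
  have m: "f \<in> borel_measurable borel \<Longrightarrow> f \<in> borel_measurable ?\<sigma>" for f :: "real^'n \<Rightarrow> ennreal"
    by (rule measurable_sphere_measure)
  have J\<omega>: "(\<integral>\<^sup>+\<eta>. ennreal (?K \<eta>) * ennreal \<bar>\<eta> \<bullet> \<omega>\<bar> \<partial>?\<sigma>) \<le> ennreal A"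
    unfolding A_def by (rule sphere_kernel_axis[OF \<epsilon>])
  have mass: "(\<integral>\<^sup>+\<eta>. ennreal (?K \<eta>) \<partial>?\<sigma>) \<le> ennreal (R * (A + real ?d * D + V))"
  proof (cases "R \<ge> 1")
    case True
    have "(\<integral>\<^sup>+\<eta>. ennreal (?K \<eta>) \<partial>?\<sigma>) \<le> (\<integral>\<^sup>+\<eta>. (\<Sum>e\<in>insert \<omega> B. ennreal (?K \<eta>) * ennreal \<bar>\<eta> \<bullet> e\<bar>) \<partial>?\<sigma>)"
    proof (rule nn_integral_mono)
      fix \<eta> assume "\<eta> \<in> space ?\<sigma>"
      then have n\<eta>: "norm \<eta> = 1" by (simp add: space_sphere_measure)
      have "1 = (\<Sum>e\<in>insert \<omega> B. (\<eta> \<bullet> e)\<^sup>2)"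
        unfolding n\<eta>[symmetric] power_one[of 2, symmetric]
        by (subst orthonormal_parseval) (use fin span_B unit unitB orth n\<eta> in \<open>auto simp: pairwise_insert orthogonal_def inner_commute\<close>)
      also have "\<dots> \<le> (\<Sum>e\<in>insert \<omega> B. \<bar>\<eta> \<bullet> e\<bar>)"
      proof (rule sum_mono)
        fix e assume "e \<in> insert \<omega> B"
        then have "norm e = 1" using unit unitB by auto
        then have "\<bar>\<eta> \<bullet> e\<bar> \<le> 1" using Cauchy_Schwarz_ineq2[of \<eta> e] n\<eta> by simp
        then have "\<bar>\<eta> \<bullet> e\<bar> * \<bar>\<eta> \<bullet> e\<bar> \<le> \<bar>\<eta> \<bullet> e\<bar>" by (intro mult_left_le) simp_all
        then show "(\<eta> \<bullet> e)\<^sup>2 \<le> \<bar>\<eta> \<bullet> e\<bar>" by (simp add: power2_eq_square)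
      qed
      finally have "?K \<eta> * 1 \<le> ?K \<eta> * (\<Sum>e\<in>insert \<omega> B. \<bar>\<eta> \<bullet> e\<bar>)" by (rule mult_left_mono) (rule K0)
      then have "ennreal (?K \<eta>) \<le> ennreal (?K \<eta> * (\<Sum>e\<in>insert \<omega> B. \<bar>\<eta> \<bullet> e\<bar>))" by (intro ennreal_leI) simp
      also have "\<dots> = (\<Sum>e\<in>insert \<omega> B. ennreal (?K \<eta>) * ennreal \<bar>\<eta> \<bullet> e\<bar>)"
        unfolding sum_distrib_left by (subst sum_ennreal[symmetric]) (simp_all add: K0 ennreal_mult)
      finally show "ennreal (?K \<eta>) \<le> (\<Sum>e\<in>insert \<omega> B. ennreal (?K \<eta>) * ennreal \<bar>\<eta> \<bullet> e\<bar>)" .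
    qed
    also have "\<dots> = (\<Sum>e\<in>insert \<omega> B. \<integral>\<^sup>+\<eta>. ennreal (?K \<eta>) * ennreal \<bar>\<eta> \<bullet> e\<bar> \<partial>?\<sigma>)"
      by (intro nn_integral_sum m) measurable
    also have "\<dots> = (\<integral>\<^sup>+\<eta>. ennreal (?K \<eta>) * ennreal \<bar>\<eta> \<bullet> \<omega>\<bar> \<partial>?\<sigma>) + (\<Sum>e\<in>B. \<integral>\<^sup>+\<eta>. ennreal (?K \<eta>) * ennreal \<bar>\<eta> \<bullet> e\<bar> \<partial>?\<sigma>)"
      using fin span_B(2) by simp
    also have "\<dots> \<le> ennreal A + (\<Sum>e\<in>B. ennreal (R * D))"
      by (intro add_mono J\<omega> sum_mono) (use sphere_kernel_tangent[OF R] in \<open>simp add: D_def mult_ac\<close>)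
    also have "\<dots> = ennreal (A + real ?d * (R * D))"
      using nonneg R by (simp add: card_B ennreal_of_nat_eq_real_of_nat flip: ennreal_mult)
    also have "\<dots> \<le> ennreal (R * (A + real ?d * D + V))"
    proof (rule ennreal_leI)
      have "A \<le> R * A" "0 \<le> R * V" using True nonneg R by (simp_all add: mult_le_cancel_right1)
      then show "A + real ?d * (R * D) \<le> R * (A + real ?d * D + V)" by (simp add: algebra_simps)
    qed
    finally show ?thesis .
  next
    case False
    have "?K \<eta> \<le> R * sqrt pi ^ ?d" for \<eta>
    proof -
      have "?K \<eta> \<le> sqrt (pi * R\<^sup>2) ^ ?d * 1"
        using R unfolding gauss_kernel_def by (intro mult_mono) simp_all
      also have "\<dots> = R ^ ?d * sqrt pi ^ ?d"
        using R by (simp add: real_sqrt_mult power_mult_distrib)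
      also have "R ^ ?d \<le> R ^ 1"
        using R False dim by (intro power_decreasing) auto
      finally show ?thesis by simp
    qed
    then have "(\<integral>\<^sup>+\<eta>. ennreal (?K \<eta>) \<partial>?\<sigma>) \<le> (\<integral>\<^sup>+\<eta>. ennreal (R * sqrt pi ^ ?d) \<partial>?\<sigma>)"
      by (intro nn_integral_mono ennreal_leI)
    also have "\<dots> = ennreal (R * V)"
      using R by (simp add: finite_measure.emeasure_eq_measure[OF finite_sphere_measure] space_sphere_measure V_def mult.assoc flip: ennreal_mult)
    also have "\<dots> \<le> ennreal (R * (A + real ?d * D + V))"
      using R nonneg by (intro ennreal_leI mult_left_mono) simp_all
    finally show ?thesis .
  qed
  have "(\<integral>\<^sup>+\<eta>. ennreal (?K \<eta> * (\<bar>\<eta> \<bullet> \<omega>\<bar> + 1 / R)) \<partial>?\<sigma>)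
      = (\<integral>\<^sup>+\<eta>. ennreal (?K \<eta>) * ennreal \<bar>\<eta> \<bullet> \<omega>\<bar> + ennreal (1 / R) * ennreal (?K \<eta>) \<partial>?\<sigma>)"
    using R by (intro nn_integral_cong) (simp add: distrib_left distrib_right K0 mult.commute flip: ennreal_mult ennreal_plus)
  also have "\<dots> = (\<integral>\<^sup>+\<eta>. ennreal (?K \<eta>) * ennreal \<bar>\<eta> \<bullet> \<omega>\<bar> \<partial>?\<sigma>) + ennreal (1 / R) * (\<integral>\<^sup>+\<eta>. ennreal (?K \<eta>) \<partial>?\<sigma>)"
  proof -
    have "(\<lambda>\<eta>. ennreal (?K \<eta>)) \<in> borel_measurable ?\<sigma>" "(\<lambda>\<eta>. ennreal (?K \<eta>) * ennreal \<bar>\<eta> \<bullet> \<omega>\<bar>) \<in> borel_measurable ?\<sigma>"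
      by (intro m; measurable)+
    then show ?thesis by (simp add: nn_integral_add nn_integral_cmult)
  qed
  also have "\<dots> \<le> ennreal A + ennreal (1 / R) * ennreal (R * (A + real ?d * D + V))"
    by (intro add_mono J\<omega> mult_left_mono mass) simp
  also have "\<dots> = ennreal (A + (A + real ?d * D + V))"
    using R nonneg by (simp flip: ennreal_mult ennreal_plus)
  also have "A + (A + real ?d * D + V) = 4 * (2 * pi) ^ ?d + real ?d * D + V" by (simp add: A_def)
  finally show ?thesis by (simp only: D_def V_def)
qed

end

section \<open>The extension operator on hyperplanes\<close>

text \<open>
  Surface measure as a Borel measure on the whole space, so that it can be integrated against Borel functions of
  the space and compared with hyperplane measures.
\<close>
definition sphere_borel :: "(real^'n) measure" where
  "sphere_borel = distr sphere_measure borel (\<lambda>x. x)"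

lemma sets_sphere_borel [measurable_cong, simp]: "sets sphere_borel = sets borel"
  by (simp add: sphere_borel_def)

lemma measurable_id_sphere: "(\<lambda>x. x) \<in> sphere_measure \<rightarrow>\<^sub>M borel"
  by (rule measurable_sphere_measure) simp

lemma nn_integral_sphere_borel:
  "f \<in> borel_measurable borel \<Longrightarrow> (\<integral>\<^sup>+\<xi>. f \<xi> \<partial>sphere_borel) = (\<integral>\<^sup>+\<xi>. f \<xi> \<partial>sphere_measure)"
  unfolding sphere_borel_def by (subst nn_integral_distr[OF measurable_id_sphere]) simp_all

lemma finite_sphere_borel: "finite_measure sphere_borel"
  unfolding sphere_borel_def by (rule finite_measure.finite_measure_distr[OF finite_sphere_measure measurable_id_sphere])

lemma sigma_finite_sphere_borel: "sigma_finite_measure sphere_borel"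
  by (rule finite_measure.axioms(1)[OF finite_sphere_borel])

lemma extension_op_eq_fourier:
  assumes [measurable]: "h \<in> borel_measurable borel" and "AE \<xi> in sphere_measure. g \<xi> = h \<xi>"
    and gm: "g \<in> borel_measurable sphere_measure"
  shows "extension_op g x = fourier sphere_borel h x"
proof -
  have "extension_op g x = (LINT \<xi>|sphere_measure. cis (x \<bullet> \<xi>) * h \<xi>)"
    unfolding extension_op_def
  proof (rule integral_cong_AE)
    show "AE \<xi> in sphere_measure. exp (\<i> * complex_of_real (x \<bullet> \<xi>)) * g \<xi> = cis (x \<bullet> \<xi>) * h \<xi>"
      using assms(2) by eventually_elim (simp add: cis_conv_exp)
    have "(\<lambda>\<xi>. exp (\<i> * complex_of_real (x \<bullet> \<xi>))) \<in> borel_measurable sphere_measure"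
      by (rule measurable_sphere_measure) measurable
    then show "(\<lambda>\<xi>. exp (\<i> * complex_of_real (x \<bullet> \<xi>)) * g \<xi>) \<in> borel_measurable sphere_measure"
      using gm by (rule borel_measurable_times)
    show "(\<lambda>\<xi>. cis (x \<bullet> \<xi>) * h \<xi>) \<in> borel_measurable sphere_measure"
      by (rule measurable_sphere_measure) measurable
  qed
  also have "\<dots> = fourier sphere_borel h x"
    unfolding fourier_def sphere_borel_def by (rule integral_distr[OF measurable_id_sphere, symmetric]) measurable
  finally show ?thesis .
qed

lemma sphere_borel_representative:
  fixes g :: "real^'n \<Rightarrow> complex"
  assumes "g \<in> borel_measurable sphere_measure"
  shows "(\<lambda>\<xi>. indicator (sphere 0 1) \<xi> *\<^sub>R g \<xi>) \<in> borel_measurable borel"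
proof -
  have "g \<in> borel_measurable (restrict_space borel (sphere 0 1))"
    using assms by (simp cong: measurable_cong_sets add: sets_sphere_measure)
  then show ?thesis by (subst (asm) borel_measurable_restrict_space_iff) simp_all
qed

text \<open>The sphere has finite measure, so square integrable functions are integrable.\<close>
lemma integrable_sphere_borel_L2:
  fixes h :: "real^'n \<Rightarrow> complex"
  assumes [measurable]: "h \<in> borel_measurable borel" and fin: "(\<integral>\<^sup>+\<xi>. ennreal ((norm (h \<xi>))\<^sup>2) \<partial>sphere_measure) < \<infinity>"
  shows "integrable sphere_borel h"
proof -
  interpret finite_measure "sphere_borel :: (real^'n) measure" by (rule finite_sphere_borel)
  have "(\<integral>\<^sup>+\<xi>. ennreal (norm (h \<xi>)) \<partial>sphere_borel) \<le> (\<integral>\<^sup>+\<xi>. 1 + ennreal ((norm (h \<xi>))\<^sup>2) \<partial>sphere_borel)"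
  proof (rule nn_integral_mono)
    fix \<xi>
    have "0 \<le> (norm (h \<xi>) - 1 / 2)\<^sup>2" by simp
    then have "norm (h \<xi>) \<le> 1 + (norm (h \<xi>))\<^sup>2" by (simp add: power2_eq_square algebra_simps)
    then have "ennreal (norm (h \<xi>)) \<le> ennreal (1 + (norm (h \<xi>))\<^sup>2)" by (rule ennreal_leI)
    then show "ennreal (norm (h \<xi>)) \<le> 1 + ennreal ((norm (h \<xi>))\<^sup>2)" by (simp add: ennreal_plus)
  qed
  also have "\<dots> = emeasure sphere_borel (space (sphere_borel :: (real^'n) measure)) + (\<integral>\<^sup>+\<xi>. ennreal ((norm (h \<xi>))\<^sup>2) \<partial>sphere_borel)"
    by (subst nn_integral_add) simp_all
  also have "\<dots> < \<infinity>"
    using fin by (simp add: nn_integral_sphere_borel emeasure_eq_measure less_top[symmetric])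
  finally show ?thesis by (simp add: integrable_iff_bounded)
qed

text \<open>
  The gnomonic formula on the even function \<open>f(\<xi>) + f(-\<xi>)\<close>, followed by a reflection of the second term.  The
  equator must be excluded since the plane at height \<open>t > 0\<close> does not see it, while the kernel of \<open>T_op 0\<close> is
  infinite there.
\<close>
lemma radon_X0_adj:
  fixes \<omega> :: "real^'n" and f :: "real^'n \<Rightarrow> ennreal"
  assumes \<omega>: "norm \<omega> = 1" and t: "t > 0" and [measurable]: "f \<in> borel_measurable borel"
    and equator: "AE \<xi> in sphere_measure. \<xi> \<bullet> \<omega> = 0 \<longrightarrow> f \<xi> = 0"
  shows "radon (X0_adj f) \<omega> t = T_op 0 f \<omega>"
proof -
  have m: "f \<in> borel_measurable borel \<Longrightarrow> f \<in> borel_measurable sphere_measure" for f :: "real^'n \<Rightarrow> ennreal"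
    by (rule measurable_sphere_measure)
  let ?p = "\<lambda>\<xi>. f \<xi> / ennreal (\<xi> \<bullet> \<omega>) * indicator {0<..} (\<xi> \<bullet> \<omega>)"
  let ?m = "\<lambda>\<xi>. f \<xi> / ennreal (- (\<xi> \<bullet> \<omega>)) * indicator {0<..} (- (\<xi> \<bullet> \<omega>))"
  have "radon (X0_adj f) \<omega> t = (\<integral>\<^sup>+\<xi>. (f \<xi> + f (- \<xi>)) / ennreal (\<xi> \<bullet> \<omega>) * indicator {0<..} (\<xi> \<bullet> \<omega>) \<partial>sphere_measure)"
    unfolding radon_def X0_adj_def by (rule nn_integral_hyperplane_gnomonic[OF \<omega> t, of "\<lambda>\<xi>. f \<xi> + f (- \<xi>)"]) measurable
  also have "\<dots> = (\<integral>\<^sup>+\<xi>. ?p \<xi> + ?m (- \<xi>) \<partial>sphere_measure)"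
    by (simp add: divide_ennreal_def distrib_right)
  also have "\<dots> = (\<integral>\<^sup>+\<xi>. ?p \<xi> \<partial>sphere_measure) + (\<integral>\<^sup>+\<xi>. ?m (- \<xi>) \<partial>sphere_measure)"
    by (intro nn_integral_add m) measurable
  also have "(\<integral>\<^sup>+\<xi>. ?m (- \<xi>) \<partial>sphere_measure) = (\<integral>\<^sup>+\<xi>. ?m \<xi> \<partial>sphere_measure)"
    by (rule nn_integral_sphere_uminus) measurable
  also have "(\<integral>\<^sup>+\<xi>. ?p \<xi> \<partial>sphere_measure) + (\<integral>\<^sup>+\<xi>. ?m \<xi> \<partial>sphere_measure) = (\<integral>\<^sup>+\<xi>. ?p \<xi> + ?m \<xi> \<partial>sphere_measure)"
    by (intro nn_integral_add[symmetric] m) measurable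
  also have "\<dots> = T_op 0 f \<omega>"
    unfolding T_op_def
  proof (rule nn_integral_cong_AE, use equator in eventually_elim)
    case (elim \<xi>)
    then show ?case by (cases "\<xi> \<bullet> \<omega>" "0 :: real" rule: linorder_cases) (simp_all add: divide_ennreal_def)
  qed
  finally show ?thesis .
qed

lemma T_op_uminus: "T_op \<delta> f (- \<omega>) = T_op \<delta> f \<omega>"
  by (simp add: T_op_def)

lemma radon_uminus: "norm \<omega> = 1 \<Longrightarrow> radon f (- \<omega>) (- t) = radon f \<omega> t"
  by (simp add: radon_def hyperplane_measure_uminus)


context hyperplane_orthonormal_basis
begin

text \<open>
  The vertical projection as an identity of measures, which also transports integrals of complex functions.
\<close>
lemma sphere_graph_measure:
  "density sphere_borel (\<lambda>\<xi>. ennreal (\<xi> \<bullet> \<omega>))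
    = distr (density H (indicator (cball 0 1))) borel (\<lambda>y. y + sqrt (1 - (norm y)\<^sup>2) *\<^sub>R \<omega>)"
proof (rule measure_eqI)
  fix A assume "A \<in> sets (density sphere_borel (\<lambda>\<xi>. ennreal (\<xi> \<bullet> \<omega>)))"
  then have A[measurable]: "A \<in> sets borel" by simp
  have [measurable]: "cball (0::real^'n) 1 \<in> sets borel" by simp
  have "emeasure (density sphere_borel (\<lambda>\<xi>. ennreal (\<xi> \<bullet> \<omega>))) A = (\<integral>\<^sup>+\<xi>. indicator A \<xi> * ennreal (\<xi> \<bullet> \<omega>) \<partial>sphere_borel)"
    by (subst emeasure_density) (simp_all add: mult.commute)
  also have "\<dots> = (\<integral>\<^sup>+y. indicator A (y + sqrt (1 - (norm y)\<^sup>2) *\<^sub>R \<omega>) * indicator (cball 0 1) y \<partial>H)"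
    by (simp add: nn_integral_sphere_borel nn_integral_sphere_graph[OF unit])
  also have "\<dots> = (\<integral>\<^sup>+x. indicator A x \<partial>distr (density H (indicator (cball 0 1))) borel (\<lambda>y. y + sqrt (1 - (norm y)\<^sup>2) *\<^sub>R \<omega>))"
    by (subst nn_integral_distr, measurable, subst nn_integral_density) (simp_all add: mult.commute)
  finally show "emeasure (density sphere_borel (\<lambda>\<xi>. ennreal (\<xi> \<bullet> \<omega>))) A
    = emeasure (distr (density H (indicator (cball 0 1))) borel (\<lambda>y. y + sqrt (1 - (norm y)\<^sup>2) *\<^sub>R \<omega>)) A"
    by simp
qed simp

text \<open>
  Write \<open>\<phi> = (\<xi> \<bullet> \<omega>) \<psi>\<close>.  The Jacobian \<open>\<xi> \<bullet> \<omega>\<close> turns the transform of \<open>\<phi>\<close> on the sphere into the transform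
  on the hyperplane of \<open>\<psi>\<close> lifted to the graph, and turns \<open>|\<psi>|\<^sup>2 dy\<close> back into \<open>|\<phi>|\<^sup>2 / (\<xi> \<bullet> \<omega>) d\<sigma>\<close>.
\<close>
lemma plancherel_hemisphere:
  assumes \<phi>: "integrable sphere_borel \<phi>" and supp: "\<And>\<xi>. \<phi> \<xi> \<noteq> 0 \<Longrightarrow> \<xi> \<bullet> \<omega> > 0"
  shows "(\<integral>\<^sup>+y. ennreal ((norm (fourier sphere_borel \<phi> y))\<^sup>2) \<partial>H)
    = ennreal ((2 * pi) ^ (CARD('n) - 1)) * (\<integral>\<^sup>+\<xi>. ennreal ((norm (\<phi> \<xi>))\<^sup>2 / (\<xi> \<bullet> \<omega>)) \<partial>sphere_measure)"
proof -
  let ?l = "\<lambda>y. y + sqrt (1 - (norm y)\<^sup>2) *\<^sub>R \<omega>"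
  have [measurable]: "cball (0::real^'n) 1 \<in> sets borel" by simp
  have \<phi>m[measurable]: "\<phi> \<in> borel_measurable borel"
    using borel_measurable_integrable[OF \<phi>] by simp
  define \<psi> where "\<psi> \<xi> = \<phi> \<xi> / complex_of_real (\<xi> \<bullet> \<omega>)" for \<xi>
  have [measurable]: "\<psi> \<in> borel_measurable borel" unfolding \<psi>_def by measurable
  have \<phi>\<psi>: "\<phi> \<xi> = max 0 (\<xi> \<bullet> \<omega>) *\<^sub>R \<psi> \<xi>" for \<xi>
    using supp[of \<xi>] by (cases "\<phi> \<xi> = 0") (simp_all add: \<psi>_def scaleR_conv_of_real max_def)
  define F where "F y = indicator (cball 0 1) y *\<^sub>R \<psi> (?l y)" for y
  have [measurable]: "F \<in> borel_measurable borel" unfolding F_def by measurable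
  have "(\<integral>\<^sup>+y. ennreal (norm (F y)) \<partial>H) = (\<integral>\<^sup>+y. ennreal (norm (\<psi> (?l y))) * indicator (cball 0 1) y \<partial>H)"
    by (intro nn_integral_cong) (simp add: F_def indicator_def)
  also have "\<dots> = (\<integral>\<^sup>+\<xi>. ennreal (norm (\<psi> \<xi>)) * ennreal (\<xi> \<bullet> \<omega>) \<partial>sphere_measure)"
    by (rule nn_integral_sphere_graph[OF unit, symmetric]) measurable
  also have "\<dots> = (\<integral>\<^sup>+\<xi>. ennreal (norm (\<phi> \<xi>)) \<partial>sphere_measure)"
    by (intro nn_integral_cong) (simp add: \<phi>\<psi> ennreal_mult mult.commute)
  also have "\<dots> = (\<integral>\<^sup>+\<xi>. ennreal (norm (\<phi> \<xi>)) \<partial>sphere_borel)"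
    by (rule nn_integral_sphere_borel[symmetric]) measurable
  also have "\<dots> < \<infinity>" using \<phi> by (simp add: integrable_iff_bounded)
  finally have F: "integrable H F" by (simp add: integrable_iff_bounded)
  have fourier: "fourier sphere_borel \<phi> y = fourier H F y" if y: "y \<bullet> \<omega> = 0" for y
  proof -
    have "fourier sphere_borel \<phi> y = (LINT \<xi>|sphere_borel. max 0 (\<xi> \<bullet> \<omega>) *\<^sub>R (cis (y \<bullet> \<xi>) * \<psi> \<xi>))"
      by (simp only: fourier_def \<phi>\<psi> mult_scaleR_right)
    also have "\<dots> = (LINT \<xi>|density sphere_borel (\<lambda>\<xi>. ennreal (max 0 (\<xi> \<bullet> \<omega>))). cis (y \<bullet> \<xi>) * \<psi> \<xi>)"
      by (rule integral_density[symmetric]) simp_all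
    also have "density sphere_borel (\<lambda>\<xi>. ennreal (max 0 (\<xi> \<bullet> \<omega>))) = density sphere_borel (\<lambda>\<xi>. ennreal (\<xi> \<bullet> \<omega>))"
      by (simp add: max.commute)
    also have "(LINT \<xi>|density sphere_borel (\<lambda>\<xi>. ennreal (\<xi> \<bullet> \<omega>)). cis (y \<bullet> \<xi>) * \<psi> \<xi>)
        = (LINT z|density H (indicator (cball 0 1)). cis (y \<bullet> ?l z) * \<psi> (?l z))"
      unfolding sphere_graph_measure by (rule integral_distr) measurable
    also have "\<dots> = (LINT z|density H (\<lambda>z. ennreal (indicator (cball 0 1) z)). cis (y \<bullet> z) * \<psi> (?l z))"
      by (simp add: inner_add_right y ennreal_indicator)
    also have "\<dots> = (LINT z|H. indicator (cball 0 1) z *\<^sub>R (cis (y \<bullet> z) * \<psi> (?l z)))"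
      by (rule integral_density) simp_all
    also have "\<dots> = fourier H F y"
      by (simp only: fourier_def F_def mult_scaleR_right)
    finally show ?thesis .
  qed
  have "(\<integral>\<^sup>+y. ennreal ((norm (fourier sphere_borel \<phi> y))\<^sup>2) \<partial>H) = (\<integral>\<^sup>+y. ennreal ((norm (fourier H F y))\<^sup>2) \<partial>H)"
    using AE_hyperplane_inner[OF unit, of 0]
    by (intro nn_integral_cong_AE) (elim eventually_mono, simp add: fourier)
  also have "\<dots> = ennreal ((2 * pi) ^ (CARD('n) - 1)) * (\<integral>\<^sup>+y. ennreal ((norm (F y))\<^sup>2) \<partial>H)"
    by (rule plancherel_hyperplane[OF F])
  also have "(\<integral>\<^sup>+y. ennreal ((norm (F y))\<^sup>2) \<partial>H) = (\<integral>\<^sup>+y. ennreal ((norm (\<psi> (?l y)))\<^sup>2) * indicator (cball 0 1) y \<partial>H)"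
    by (intro nn_integral_cong) (simp add: F_def indicator_def)
  also have "\<dots> = (\<integral>\<^sup>+\<xi>. ennreal ((norm (\<psi> \<xi>))\<^sup>2) * ennreal (\<xi> \<bullet> \<omega>) \<partial>sphere_measure)"
    by (rule nn_integral_sphere_graph[OF unit, symmetric]) measurable
  also have "\<dots> = (\<integral>\<^sup>+\<xi>. ennreal ((norm (\<phi> \<xi>))\<^sup>2 / (\<xi> \<bullet> \<omega>)) \<partial>sphere_measure)"
  proof (rule nn_integral_cong)
    fix \<xi>
    show "ennreal ((norm (\<psi> \<xi>))\<^sup>2) * ennreal (\<xi> \<bullet> \<omega>) = ennreal ((norm (\<phi> \<xi>))\<^sup>2 / (\<xi> \<bullet> \<omega>))"
    proof (cases "\<phi> \<xi> = 0")
      case False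
      then have "\<xi> \<bullet> \<omega> > 0" by (rule supp)
      then show ?thesis
        by (simp add: \<psi>_def norm_divide power2_eq_square flip: ennreal_mult)
    qed (simp add: \<psi>_def)
  qed
  finally show ?thesis .
qed

text \<open>
  Moving the hyperplane by \<open>t\<close> multiplies the density by a factor of modulus 1, so all estimates for the plane
  through the origin are uniform in \<open>t\<close>.
\<close>
lemma fourier_sphere_shift:
  "fourier sphere_borel h (y + t *\<^sub>R \<omega>) = fourier sphere_borel (\<lambda>\<xi>. cis (t * (\<xi> \<bullet> \<omega>)) * h \<xi>) y"
  by (simp add: fourier_def inner_add_left inner_commute[of \<omega>] mult.assoc flip: cis_mult)

lemma integrable_modulation:
  assumes h: "integrable sphere_borel h"
  shows "integrable sphere_borel (\<lambda>\<xi>. cis (t * (\<xi> \<bullet> \<omega>)) * h \<xi>)"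
proof -
  have [measurable]: "h \<in> borel_measurable borel"
    using borel_measurable_integrable[OF h] by simp
  show ?thesis
    by (rule Bochner_Integration.integrable_bound[OF h]) (simp_all add: norm_mult)
qed

lemma radon_fourier_hemisphere:
  assumes h: "integrable sphere_borel h" and supp: "\<And>\<xi>. h \<xi> \<noteq> 0 \<Longrightarrow> \<xi> \<bullet> \<omega> > 0"
  shows "radon (sqmod (fourier sphere_borel h)) \<omega> t = ennreal ((2 * pi) ^ (CARD('n) - 1)) * T_op 0 (sqmod h) \<omega>"
proof -
  have [measurable]: "h \<in> borel_measurable borel"
    using borel_measurable_integrable[OF h] by simp
  have [measurable]: "fourier sphere_borel h \<in> borel_measurable borel"
    by (rule borel_measurable_fourier[OF sigma_finite_sphere_borel]) simp_all
  let ?\<phi> = "\<lambda>\<xi>. cis (t * (\<xi> \<bullet> \<omega>)) * h \<xi>"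
  have "radon (sqmod (fourier sphere_borel h)) \<omega> t = (\<integral>\<^sup>+y. ennreal ((norm (fourier sphere_borel ?\<phi> y))\<^sup>2) \<partial>H)"
    unfolding radon_def by (subst nn_integral_hyperplane_shift) (simp_all add: fourier_sphere_shift)
  also have "\<dots> = ennreal ((2 * pi) ^ (CARD('n) - 1)) * (\<integral>\<^sup>+\<xi>. ennreal ((norm (?\<phi> \<xi>))\<^sup>2 / (\<xi> \<bullet> \<omega>)) \<partial>sphere_measure)"
    by (rule plancherel_hemisphere[OF integrable_modulation[OF h]]) (simp add: supp)
  also have "(\<integral>\<^sup>+\<xi>. ennreal ((norm (?\<phi> \<xi>))\<^sup>2 / (\<xi> \<bullet> \<omega>)) \<partial>sphere_measure) = T_op 0 (sqmod h) \<omega>"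
    unfolding T_op_def
  proof (rule nn_integral_cong)
    fix \<xi>
    show "ennreal ((norm (?\<phi> \<xi>))\<^sup>2 / (\<xi> \<bullet> \<omega>)) = ennreal ((norm (h \<xi>))\<^sup>2) / ennreal (\<bar>\<xi> \<bullet> \<omega>\<bar> + 0)"
      using supp[of \<xi>] by (cases "h \<xi> = 0") (simp_all add: norm_mult divide_ennreal)
  qed
  finally show ?thesis .
qed

text \<open>
  On the hyperplane the indicator of the ball is at most \<open>e\<close> times the Gaussian weight with
  \<open>\<epsilon> = 1 / R\<^sup>2\<close>, which explains the factor \<open>exp 1\<close>; the rest of the constant is the Schur bound.
\<close>
lemma radon_fourier_ball:
  assumes R: "R > 0" and dim: "CARD('n) \<ge> 2" and h: "integrable sphere_borel h"
  shows "radon (\<lambda>x. indicator (ball 0 R) x * sqmod (fourier sphere_borel h) x) \<omega> t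
    \<le> ennreal (exp 1 * (4 * (2 * pi) ^ (CARD('n) - 1) + real (CARD('n) - 1) * (4 * sqrt pi * (2 * pi) ^ (CARD('n) - 2))
        + sqrt pi ^ (CARD('n) - 1) * measure (sphere_measure :: (real^'n) measure) (sphere 0 1))) * T_op (1 / R) (sqmod h) \<omega>"
    (is "_ \<le> ennreal (exp 1 * ?C) * _")
proof -
  have [measurable]: "h \<in> borel_measurable borel"
    using borel_measurable_integrable[OF h] by simp
  have [measurable]: "fourier sphere_borel h \<in> borel_measurable borel"
    by (rule borel_measurable_fourier[OF sigma_finite_sphere_borel]) simp_all
  have [measurable]: "ball (0::real^'n) R \<in> sets borel" by simp
  let ?\<phi> = "\<lambda>\<xi>. cis (t * (\<xi> \<bullet> \<omega>)) * h \<xi>" and ?a = "\<lambda>\<xi>. \<bar>\<xi> \<bullet> \<omega>\<bar> + 1 / R"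
  have fm[measurable]: "fourier sphere_borel ?\<phi> \<in> borel_measurable borel"
    by (rule borel_measurable_fourier[OF sigma_finite_sphere_borel]) simp_all
  have \<epsilon>: "1 / R\<^sup>2 > 0" using R by simp
  have a0: "?a \<xi> > 0" for \<xi> using R by (intro add_nonneg_pos) simp_all
  have "radon (\<lambda>x. indicator (ball 0 R) x * sqmod (fourier sphere_borel h) x) \<omega> t
      = (\<integral>\<^sup>+y. indicator (ball 0 R) (y + t *\<^sub>R \<omega>) * ennreal ((norm (fourier sphere_borel ?\<phi> y))\<^sup>2) \<partial>H)"
    unfolding radon_def
    by (subst nn_integral_hyperplane_shift) (simp_all add: fourier_sphere_shift)
  also have "\<dots> \<le> (\<integral>\<^sup>+y. ennreal (exp 1) * ennreal (exp (- (1 / R\<^sup>2) * (norm y)\<^sup>2) * (norm (fourier sphere_borel ?\<phi> y))\<^sup>2) \<partial>H)"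
  proof (rule nn_integral_mono_AE, use AE_hyperplane_inner[OF unit, of 0] in eventually_elim)
    case (elim y)
    show ?case
    proof (cases "y + t *\<^sub>R \<omega> \<in> ball 0 R")
      case True
      have "perp \<omega> (y + t *\<^sub>R \<omega>) = y" by (simp add: perp_add_multiple) (simp add: perp_def elim)
      then have "norm y < R" using norm_perp_le[OF unit, of "y + t *\<^sub>R \<omega>"] True by simp
      then have "(norm y)\<^sup>2 \<le> R\<^sup>2" by (intro power_mono) simp_all
      then have "1 \<le> exp (1 + - (1 / R\<^sup>2) * (norm y)\<^sup>2)" using R by (simp add: field_simps)
      then have "1 * (norm (fourier sphere_borel ?\<phi> y))\<^sup>2 \<le> exp (1 + - (1 / R\<^sup>2) * (norm y)\<^sup>2) * (norm (fourier sphere_borel ?\<phi> y))\<^sup>2"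
        by (rule mult_right_mono) simp
      then have "ennreal ((norm (fourier sphere_borel ?\<phi> y))\<^sup>2) \<le> ennreal (exp 1 * (exp (- (1 / R\<^sup>2) * (norm y)\<^sup>2) * (norm (fourier sphere_borel ?\<phi> y))\<^sup>2))"
        by (intro ennreal_leI) (simp only: exp_add mult.assoc mult_1)
      then show ?thesis using True by (simp only: ennreal_mult' exp_ge_zero indicator_simps mult_1)
    qed simp
  qed
  also have "\<dots> = ennreal (exp 1) * (\<integral>\<^sup>+y. ennreal (exp (- (1 / R\<^sup>2) * (norm y)\<^sup>2) * (norm (fourier sphere_borel ?\<phi> y))\<^sup>2) \<partial>H)"
    by (rule nn_integral_cmult) measurable
  also have "\<dots> \<le> ennreal (exp 1) * (ennreal ?C * (\<integral>\<^sup>+\<xi>. ennreal ((norm (?\<phi> \<xi>))\<^sup>2 / ?a \<xi>) \<partial>sphere_borel))"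
  proof (intro mult_left_mono gaussian_schur_test[OF sigma_finite_sphere_borel sets_sphere_borel integrable_modulation[OF h] \<epsilon>] a0 AE_I2)
    fix \<xi> :: "real^'n"
    show "(\<integral>\<^sup>+\<eta>. ennreal (gauss_kernel \<omega> (1 / R\<^sup>2) (\<xi> - \<eta>) * ?a \<eta>) \<partial>sphere_borel) \<le> ennreal ?C"
      using sphere_kernel_bound[OF R dim, of \<xi>] by (subst nn_integral_sphere_borel) simp_all
  qed simp_all
  also have "(\<integral>\<^sup>+\<xi>. ennreal ((norm (?\<phi> \<xi>))\<^sup>2 / ?a \<xi>) \<partial>sphere_borel) = T_op (1 / R) (sqmod h) \<omega>"
    unfolding T_op_def using a0
    by (subst nn_integral_sphere_borel) (simp_all add: norm_mult divide_ennreal)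
  also have "ennreal (exp 1) * (ennreal ?C * T_op (1 / R) (sqmod h) \<omega>) = ennreal (exp 1 * ?C) * T_op (1 / R) (sqmod h) \<omega>"
    by (subst ennreal_mult) (simp_all add: mult.assoc)
  finally show ?thesis .
qed

end


theorem theorem1p1:
  assumes "CARD('n) \<ge> 2"
  shows
    "(\<forall>\<omega> :: real^'n. \<forall>g. norm \<omega> = 1 \<longrightarrow> L2_sphere g \<longrightarrow>
        (AE x in sphere_measure. \<not> x \<bullet> \<omega> > 0 \<longrightarrow> g x = 0) \<longrightarrow>
        (\<forall>t. t \<noteq> 0 \<longrightarrow>
           radon (sqmod (extension_op g)) \<omega> t
             = ennreal ((2 * pi) ^ (CARD('n) - 1)) * radon (X0_adj (sqmod g)) \<omega> t \<and>
           radon (X0_adj (sqmod g)) \<omega> t = T_op 0 (sqmod g) \<omega>))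
   \<and> (\<exists>C::real. \<forall>g :: real^'n \<Rightarrow> complex. L2_sphere g \<longrightarrow>
        (\<forall>\<omega> t R. norm \<omega> = 1 \<longrightarrow> R > 0 \<longrightarrow>
           radon (\<lambda>x. indicator (ball 0 R) x * sqmod (extension_op g) x) \<omega> t
             \<le> ennreal C * T_op (1 / R) (sqmod g) \<omega>))"
proof (rule conjI)
  have T_op_cong: "T_op \<delta> (sqmod g) \<omega> = T_op \<delta> (sqmod h) \<omega>" if "AE \<xi> in sphere_measure. g \<xi> = h \<xi>"
    for g h :: "real^'n \<Rightarrow> complex" and \<delta> \<omega>
    unfolding T_op_def using that by (intro nn_integral_cong_AE) (elim eventually_mono, simp)
  have L2: "g \<in> borel_measurable sphere_measure" "(\<integral>\<^sup>+\<xi>. ennreal ((norm (g \<xi>))\<^sup>2) \<partial>sphere_measure) < \<infinity>"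
    if "L2_sphere g" for g :: "real^'n \<Rightarrow> complex"
    using that by (auto simp: L2_sphere_def integrable_iff_bounded)
  have L1: "integrable sphere_borel h" if "L2_sphere g" "h \<in> borel_measurable borel" "AE \<xi> in sphere_measure. g \<xi> = h \<xi>"
    for g h :: "real^'n \<Rightarrow> complex"
  proof (rule integrable_sphere_borel_L2[OF that(2)])
    have "(\<integral>\<^sup>+\<xi>. ennreal ((norm (h \<xi>))\<^sup>2) \<partial>sphere_measure) = (\<integral>\<^sup>+\<xi>. ennreal ((norm (g \<xi>))\<^sup>2) \<partial>sphere_measure)"
      using that(3) by (intro nn_integral_cong_AE) (elim eventually_mono, simp)
    then show "(\<integral>\<^sup>+\<xi>. ennreal ((norm (h \<xi>))\<^sup>2) \<partial>sphere_measure) < \<infinity>"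
      using L2(2)[OF that(1)] by simp
  qed
  let ?restrict = "\<lambda>(g :: real^'n \<Rightarrow> complex) \<xi>. indicator (sphere 0 1) \<xi> *\<^sub>R g \<xi>"
  have AE_restrict: "AE \<xi> in sphere_measure. g \<xi> = ?restrict g \<xi>" for g
    by (intro AE_I2) (simp add: space_sphere_measure)
  show "\<forall>\<omega> :: real^'n. \<forall>g. norm \<omega> = 1 \<longrightarrow> L2_sphere g \<longrightarrow>
        (AE x in sphere_measure. \<not> x \<bullet> \<omega> > 0 \<longrightarrow> g x = 0) \<longrightarrow>
        (\<forall>t. t \<noteq> 0 \<longrightarrow>
           radon (sqmod (extension_op g)) \<omega> t
             = ennreal ((2 * pi) ^ (CARD('n) - 1)) * radon (X0_adj (sqmod g)) \<omega> t \<and>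
           radon (X0_adj (sqmod g)) \<omega> t = T_op 0 (sqmod g) \<omega>)"
  proof (intro allI impI)
    fix \<omega> :: "real^'n" and g :: "real^'n \<Rightarrow> complex" and t :: real
    assume \<omega>: "norm \<omega> = 1" and g: "L2_sphere g" and supp: "AE x in sphere_measure. \<not> x \<bullet> \<omega> > 0 \<longrightarrow> g x = 0" and t: "t \<noteq> 0"
    obtain B where "hyperplane_orthonormal_basis \<omega> B" by (rule hyperplane_basis_exists[OF \<omega>])
    then interpret hyperplane_orthonormal_basis \<omega> B .
    define g\<^sub>0 where "g\<^sub>0 = ?restrict g"
    have [measurable]: "g\<^sub>0 \<in> borel_measurable borel"
      unfolding g\<^sub>0_def by (rule sphere_borel_representative[OF L2(1)[OF g]])
    have g\<^sub>0: "AE \<xi> in sphere_measure. g \<xi> = g\<^sub>0 \<xi>"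
      unfolding g\<^sub>0_def by (rule AE_restrict)
    \<comment> \<open>The values of \<open>g\<close> off the sphere are arbitrary, and those on the lower half vanish only almost everywhere; \<open>h\<close> makes both 0.\<close>
    define h where "h \<xi> = (if \<xi> \<bullet> \<omega> > 0 then g\<^sub>0 \<xi> else 0)" for \<xi>
    have hm[measurable]: "h \<in> borel_measurable borel" unfolding h_def by measurable
    have gh: "AE \<xi> in sphere_measure. g \<xi> = h \<xi>"
      using supp g\<^sub>0 by eventually_elim (auto simp: h_def)
    have supp_h: "\<xi> \<bullet> \<omega> > 0" if "h \<xi> \<noteq> 0" for \<xi>
      using that by (simp add: h_def split: if_splits)
    have radon_h: "radon (sqmod (fourier sphere_borel h)) \<omega> t = ennreal ((2 * pi) ^ (CARD('n) - 1)) * T_op 0 (sqmod h) \<omega>"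
      by (rule radon_fourier_hemisphere[OF L1[OF g hm gh]]) (rule supp_h)
    have "sqmod (extension_op g) = sqmod (fourier sphere_borel h)"
      using extension_op_eq_fourier[OF hm gh L2(1)[OF g]] by simp
    then have ext: "radon (sqmod (extension_op g)) \<omega> t = ennreal ((2 * pi) ^ (CARD('n) - 1)) * T_op 0 (sqmod g) \<omega>"
      by (simp only: radon_h T_op_cong[OF gh])
    have equator: "AE \<xi> in sphere_measure. \<xi> \<bullet> \<omega> = 0 \<longrightarrow> sqmod g\<^sub>0 \<xi> = 0"
      using supp g\<^sub>0 by eventually_elim auto
    have "radon (X0_adj (sqmod g)) \<omega> t = radon (X0_adj (sqmod g\<^sub>0)) \<omega> t"
      unfolding radon_def
    proof (rule nn_integral_cong_AE, use AE_hyperplane_inner[OF \<omega>, of t] in eventually_elim)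
      case (elim x)
      then have "x \<noteq> 0" using t by auto
      then show ?case by (simp add: X0_adj_def g\<^sub>0_def)
    qed
    also have "\<dots> = T_op 0 (sqmod g\<^sub>0) \<omega>"
    proof (cases "t > 0")
      case True
      show ?thesis by (rule radon_X0_adj[OF \<omega> True _ equator]) measurable
    next
      case False
      then have "radon (X0_adj (sqmod g\<^sub>0)) (- \<omega>) (- t) = T_op 0 (sqmod g\<^sub>0) (- \<omega>)"
        using \<omega> t equator by (intro radon_X0_adj) simp_all
      then show ?thesis by (simp only: radon_uminus[OF \<omega>] T_op_uminus)
    qed
    also have "\<dots> = T_op 0 (sqmod g) \<omega>"
      by (rule T_op_cong[OF g\<^sub>0, symmetric])
    finally have X0: "radon (X0_adj (sqmod g)) \<omega> t = T_op 0 (sqmod g) \<omega>" .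
    show "radon (sqmod (extension_op g)) \<omega> t = ennreal ((2 * pi) ^ (CARD('n) - 1)) * radon (X0_adj (sqmod g)) \<omega> t \<and>
        radon (X0_adj (sqmod g)) \<omega> t = T_op 0 (sqmod g) \<omega>"
      unfolding ext X0 by simp
  qed
  show "\<exists>C::real. \<forall>g :: real^'n \<Rightarrow> complex. L2_sphere g \<longrightarrow>
        (\<forall>\<omega> t R. norm \<omega> = 1 \<longrightarrow> R > 0 \<longrightarrow>
           radon (\<lambda>x. indicator (ball 0 R) x * sqmod (extension_op g) x) \<omega> t
             \<le> ennreal C * T_op (1 / R) (sqmod g) \<omega>)"
  proof (intro exI allI impI)
    fix g :: "real^'n \<Rightarrow> complex" and \<omega> :: "real^'n" and t R :: real
    assume g: "L2_sphere g" and \<omega>: "norm \<omega> = 1" and R: "R > 0"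
    obtain B where "hyperplane_orthonormal_basis \<omega> B" by (rule hyperplane_basis_exists[OF \<omega>])
    then interpret hyperplane_orthonormal_basis \<omega> B .
    have rm: "?restrict g \<in> borel_measurable borel"
      by (rule sphere_borel_representative[OF L2(1)[OF g]])
    have "extension_op g = fourier sphere_borel (?restrict g)"
      using extension_op_eq_fourier[OF rm AE_restrict L2(1)[OF g]] by blast
    then show "radon (\<lambda>x. indicator (ball 0 R) x * sqmod (extension_op g) x) \<omega> t
        \<le> ennreal (exp 1 * (4 * (2 * pi) ^ (CARD('n) - 1) + real (CARD('n) - 1) * (4 * sqrt pi * (2 * pi) ^ (CARD('n) - 2))
          + sqrt pi ^ (CARD('n) - 1) * measure (sphere_measure :: (real^'n) measure) (sphere 0 1))) * T_op (1 / R) (sqmod g) \<omega>"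
      using radon_fourier_ball[OF R assms L1[OF g rm AE_restrict], of t]
      unfolding T_op_cong[OF AE_restrict[of g], of "1 / R" \<omega>] by simp
  qed
qed

end
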